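(* (Sectioning.) Let $Z_1$ satisfy the marginal limit condition with parameters $(\mu,h,\ell,Y_1)$ (defined in the context). Let $m\ge2$, let $Z_1^{(1)},\dots,Z_1^{(m)}$ be independent copies of $Z_1$ with corresponding independent limits $Y_1^{(1)},\dots,Y_1^{(m)}$ (independent copies of $Y_1$), and suppose that the vector process $(Y_1^{(1)},\dots,Y_1^{(m)})$ is quasi-left-continuous with respect to its augmented natural filtration. Define $$Z_1^{\mathrm{sec}}(t)=\bar Z_1(t):=\frac1m\sum_{i=1}^mZ_1^{(i)}(t),\qquad Z_2^{*,\mathrm{sec}}(t)=\frac1{m-1}\sum_{i=1}^m\frac1t\int_0^t\big(Z_1^{(i)}(s)-\bar Z_1(s)\big)^2ds,$$ $$Y_1^{\mathrm{sec}}(t)=\bar Y_1(t):=\frac1m\sum_{i=1}^mY_1^{(i)}(t),\qquad Y_2^{*,\mathrm{sec}}(t)=\frac1{m-1}\sum_{i=1}^m\frac1t\int_0^t\big(Y_1^{(i)}(s)-\bar Y_1(s)\big)^2ds,$$ for $t>0$, where the time-averaged processes $Z_2^{*,\mathrm{sec}},Y_2^{*,\mathrm{sec}}$ are defined to be zero at time zero. Suppose that $\mathbb P(Y_2^{*,\mathrm{sec}}(1)>0)=1$. Then, as $\varepsilon\to0^+$, $$\Big(\varepsilon^h\ell(\varepsilon^{-1})\big(Z_1^{\mathrm{sec}}(\tfrac{\cdot}{\varepsilon})-\tfrac{\cdot}{\varepsilon}\mu\big),\ \varepsilon^h\ell(\varepsilon^{-1})\sqrt{Z_2^{*,\mathrm{sec}}(\tfrac{\cdot}{\varepsilon})}\Big)\Rightarrow\Big(Y_1^{\mathrm{sec}}(\cdot),\sqrt{Y_2^{*,\mathrm{sec}}(\cdot)}\Big)\quad\text{weakly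 in }\mathrm{WM}_2,$$ the process $Y_2^{*,\mathrm{sec}}$ is continuous, and the pair $(Z_1^{\mathrm{sec}},Z_2^{*,\mathrm{sec}})$ satisfies the functional limit condition with parameters $(\mu,h,\ell,Y_1^{\mathrm{sec}},Y_2^{*,\mathrm{sec}})$.
   Context: Topologies. Write $\mathbb D=D([0,\infty),\mathbb R)$ and $\mathbb D_+=D([0,\infty),\mathbb R_+)$ for càdlàg paths. For a càdlàg $x$ on $[0,T]$, its completed graph is $\Gamma_x=\{(t,z): t\in[0,T],\ z$ between $x(t-)$ and $x(t)$ inclusive$\}$, with $x(0-):=x(0)$. The $M_2$ topology on $D([0,T],\mathbb R)$ is induced by the Hausdorff distance between completed graphs. Convergence on $[0,\infty)$ means convergence of the restrictions to $[0,T]$ for every continuity point $T$ of the limit. $\mathrm{WM}_2$ denotes the product of the univariate $M_2$ topologies over the two coordinates. Quasi-left-continuity. A càdlàg (possibly vector-valued) process $Y$ is quasi-left-continuous with respect to a filtration if $\mathbb P(\Delta Y(\tau)=0)=1$ for every finite predictable stopping time $\tau$ of that filtration. Augmented natural filtration means the usual augmentation of the natural filtration. Marginal limit condition with parameters $(\mu,h,\ell,Y_1)$. $Z_1$ has sample paths in $\mathbb D$ with $Z_1(0)=0$ a.s.; $\mu\in\mathbb R$; $0<h<1$; $\ell$ is an eventually positive function slowly varying at infinity; $Y_1\in\mathbb D$ is a process such that $\varepsilon^h\ell(\varepsilon^{-1})(Z_1(\tfrac{\cdot}{\varepsilon})-\tfrac{\cdot}{\varepsilon}\mu)\Rightarrow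 Y_1(\cdot)$ weakly in $M_2$ as $\varepsilon\to0^+$; $(Z_1(t)-\mu t)/t\to0$ a.s. as $t\to\infty$; $Y_1(a\,\cdot)\overset d=a^hY_1(\cdot)$ for every $a>0$; and $Y_1$ is quasi-left-continuous with respect to its augmented natural filtration. Functional limit condition with parameters $(\mu,h,\ell,Y_1,Y_2)$, for a pair $(Z_1,Z_2)$. $Z_1,Z_2$ are processes with sample paths in $\mathbb D$ and $\mathbb D_+$, $Z_1(0)=0$ a.s.; $\mu,h\in\mathbb R$; $\ell$ is an eventually positive function slowly varying at infinity; $Y_1\in\mathbb D$, $Y_2\in\mathbb D_+$ are processes such that, as $\varepsilon\to0^+$, $$\Big(\varepsilon^h\ell(\varepsilon^{-1})\big(Z_1(\tfrac{\cdot}{\varepsilon})-\tfrac{\cdot}{\varepsilon}\mu\big),\ \varepsilon^h\ell(\varepsilon^{-1})\sqrt{Z_2(\tfrac{\cdot}{\varepsilon})}\Big)\Rightarrow\big(Y_1(\cdot),\sqrt{Y_2(\cdot)}\big)\quad\text{weakly in }\mathrm{WM}_2.$$ Moreover: (a) $0<h<1$; (b) as $t\to\infty$, $(Z_1(t)-\mu t)/t\to0$ and $Z_2(t)/t^2\to0$ a.s.; (c) for every $a>0$, $(Y_1(a\,\cdot),Y_2(a\,\cdot))\overset d=(a^hY_1(\cdot),a^{2h}Y_2(\cdot))$; (d) $Y_1$ is quasi-left-continuous with respect to the augmented natural filtration of $(Y_1,Y_2)$; (e) almost surely $Y_2(t)>0$ for every $t>0$, and $Y_2$ has no negative jumps.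 *)

theory Defs
  imports "HOL-Probability.Probability"
begin

section \<open>Paths and the M2 topology\<close>

text \<open>
  A path is a function \<^typ>\<open>real \<Rightarrow> real\<close> of which only the values on \<open>[0,\<infinity>)\<close> matter: every notion
  below ignores the values at negative times, so two paths that agree on \<open>[0,\<infinity>)\<close> are
  indistinguishable.
\<close>

definition cadlag_paths :: "(real \<Rightarrow> real) set" where
  "cadlag_paths = {x. (\<forall>t\<ge>0. continuous (at_right t) x) \<and> (\<forall>t>0. \<exists>l. (x \<longlongrightarrow> l) (at_left t))}"

definition cadlag_paths_nonneg :: "(real \<Rightarrow> real) set" where
  "cadlag_paths_nonneg = {x \<in> cadlag_paths. \<forall>t\<ge>0. x t \<ge> 0}"

definition left_limit :: "(real \<Rightarrow> real) \<Rightarrow> real \<Rightarrow> real" where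
  "left_limit x t = (if t > 0 then Lim (at_left t) x else x t)"

definition jump :: "(real \<Rightarrow> real) \<Rightarrow> real \<Rightarrow> real" where
  "jump x t = x t - left_limit x t"

definition completed_graph :: "real \<Rightarrow> (real \<Rightarrow> real) \<Rightarrow> (real \<times> real) set" where
  "completed_graph T x = {(t, z). t \<in> {0..T} \<and> z \<in> closed_segment (left_limit x t) (x t)}"

definition hausdorff_dist :: "'a::metric_space set \<Rightarrow> 'a set \<Rightarrow> real" where
  "hausdorff_dist A B = max (SUP a\<in>A. infdist a B) (SUP b\<in>B. infdist b A)"

definition M2_dist :: "real \<Rightarrow> (real \<Rightarrow> real) \<Rightarrow> (real \<Rightarrow> real) \<Rightarrow> real" where
  "M2_dist T x y = hausdorff_dist (completed_graph T x) (completed_graph T y)"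

definition M2_converges :: "(nat \<Rightarrow> real \<Rightarrow> real) \<Rightarrow> (real \<Rightarrow> real) \<Rightarrow> bool" where
  "M2_converges xs x \<longleftrightarrow> (\<forall>T>0. isCont x T \<longrightarrow> (\<lambda>n. M2_dist T (xs n) x) \<longlonglongrightarrow> 0)"

text \<open>
  On \<open>[0,\<infinity>)\<close> the M2 topology is specified by its convergent sequences. This convergence is
  metrizable (up to the identification of paths that agree on \<open>[0,\<infinity>)\<close>), so the topology is the one
  whose open sets are the sequentially open ones.
\<close>

definition M2_topology :: "(real \<Rightarrow> real) topology" where
  "M2_topology = topology (\<lambda>U. U \<subseteq> cadlag_paths \<and>
     (\<forall>x\<in>U. \<forall>xs. range xs \<subseteq> cadlag_paths \<and> M2_converges xs x \<longrightarrow> (\<forall>\<^sub>F n in sequentially. xs n \<in> U)))"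

lemma openin_M2_topology:
  "openin M2_topology U \<longleftrightarrow> U \<subseteq> cadlag_paths \<and>
     (\<forall>x\<in>U. \<forall>xs. range xs \<subseteq> cadlag_paths \<and> M2_converges xs x \<longrightarrow> (\<forall>\<^sub>F n in sequentially. xs n \<in> U))"
proof -
  let ?P = "\<lambda>U. U \<subseteq> cadlag_paths \<and>
     (\<forall>x\<in>U. \<forall>xs. range xs \<subseteq> cadlag_paths \<and> M2_converges xs x \<longrightarrow> (\<forall>\<^sub>F n in sequentially. xs n \<in> U))"
  have "istopology ?P"
    unfolding istopology_def
  proof (intro conjI allI impI)
    fix S T assume "?P S" "?P T"
    then show "S \<inter> T \<subseteq> cadlag_paths" by blast
  next
    fix \<K> assume "\<forall>K\<in>\<K>. ?P K"
    then show "\<Union>\<K> \<subseteq> cadlag_paths" by blast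
  next
    fix S T assume "?P S" "?P T"
    then show "\<forall>x\<in>S \<inter> T. \<forall>xs. range xs \<subseteq> cadlag_paths \<and> M2_converges xs x
        \<longrightarrow> (\<forall>\<^sub>F n in sequentially. xs n \<in> S \<inter> T)"
      by (auto simp: eventually_conj_iff)
  next
    fix \<K> assume K: "\<forall>K\<in>\<K>. ?P K"
    show "\<forall>x\<in>\<Union>\<K>. \<forall>xs. range xs \<subseteq> cadlag_paths \<and> M2_converges xs x
        \<longrightarrow> (\<forall>\<^sub>F n in sequentially. xs n \<in> \<Union>\<K>)"
    proof (intro ballI allI impI)
      fix x xs assume "x \<in> \<Union>\<K>" and xs: "range xs \<subseteq> cadlag_paths \<and> M2_converges xs x"
      then obtain A where A: "A \<in> \<K>" "x \<in> A" by blast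
      with K xs have "\<forall>\<^sub>F n in sequentially. xs n \<in> A" by blast
      then show "\<forall>\<^sub>F n in sequentially. xs n \<in> \<Union>\<K>"
        using A(1) by (auto elim: eventually_mono)
    qed
  qed
  then show ?thesis
    by (simp add: M2_topology_def)
qed

lemma topspace_M2_topology [simp]: "topspace M2_topology = cadlag_paths"
proof
  show "topspace M2_topology \<subseteq> cadlag_paths"
    using openin_topspace openin_M2_topology by blast
  have "openin M2_topology cadlag_paths"
    unfolding openin_M2_topology by (auto intro!: always_eventually)
  then show "cadlag_paths \<subseteq> topspace M2_topology"
    by (rule openin_subset)
qed

definition WM2_topology :: "((real \<Rightarrow> real) \<times> (real \<Rightarrow> real)) topology" where
  "WM2_topology = prod_topology M2_topology M2_topology"

section \<open>Processes\<close>

text \<open>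
  A process maps an outcome to a path. Path properties are required almost surely, since the
  time-averaged processes below are cadlag only on the almost sure event that the underlying
  processes start at a common value. Accordingly measurability, laws and expectations refer to the
  completion of the given probability space.
\<close>

definition process :: "'w measure \<Rightarrow> (real \<Rightarrow> real) set \<Rightarrow> ('w \<Rightarrow> real \<Rightarrow> real) \<Rightarrow> bool" where
  "process M D X \<longleftrightarrow> (\<forall>t\<ge>0. (\<lambda>\<omega>. X \<omega> t) \<in> borel_measurable (completion M)) \<and> (AE \<omega> in M. X \<omega> \<in> D)"

abbreviation path_algebra :: "(real \<Rightarrow> real) measure" where
  "path_algebra \<equiv> PiM {0..} (\<lambda>_. borel)"

definition path_law :: "'w measure \<Rightarrow> ('w \<Rightarrow> real \<Rightarrow> real) \<Rightarrow> (real \<Rightarrow> real) measure" where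
  "path_law M X = distr (completion M) path_algebra (\<lambda>\<omega>. restrict (X \<omega>) {0..})"

definition joint_path_law ::
    "'w measure \<Rightarrow> ('w \<Rightarrow> real \<Rightarrow> real) \<Rightarrow> ('w \<Rightarrow> real \<Rightarrow> real)
      \<Rightarrow> ((real \<Rightarrow> real) \<times> (real \<Rightarrow> real)) measure" where
  "joint_path_law M X Y = distr (completion M) (path_algebra \<Otimes>\<^sub>M path_algebra)
     (\<lambda>\<omega>. (restrict (X \<omega>) {0..}, restrict (Y \<omega>) {0..}))"

text \<open>The copies may live on a probability space different from that of the original process.\<close>

definition independent_copies ::
    "'v measure \<Rightarrow> ('v \<Rightarrow> real \<Rightarrow> real) \<Rightarrow> 'w measure \<Rightarrow> ('i \<Rightarrow> 'w \<Rightarrow> real \<Rightarrow> real) \<Rightarrow> 'i set \<Rightarrow> bool" where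
  "independent_copies M X M' Xs I \<longleftrightarrow>
     (\<forall>i\<in>I. process M' cadlag_paths (Xs i) \<and> path_law M' (Xs i) = path_law M X) \<and>
     prob_space.indep_vars (completion M') (\<lambda>_. path_algebra) (\<lambda>i \<omega>. restrict (Xs i \<omega>) {0..}) I"

text \<open>Weak convergence of the random elements \<open>X \<epsilon>\<close> of \<open>S\<close> to \<open>Y\<close>, along the filter \<open>F\<close>.\<close>

definition converges_weakly ::
    "'s topology \<Rightarrow> 'v measure \<Rightarrow> ('e \<Rightarrow> 'v \<Rightarrow> 's) \<Rightarrow> 'w measure \<Rightarrow> ('w \<Rightarrow> 's) \<Rightarrow> 'e filter \<Rightarrow> bool" where
  "converges_weakly S M X N Y F \<longleftrightarrow>
     (\<forall>f. continuous_map S euclideanreal f \<and> (\<exists>B. \<forall>x\<in>topspace S. \<bar>f x\<bar> \<le> B) \<longrightarrow>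
        ((\<lambda>\<epsilon>. LINT \<omega>|completion M. f (X \<epsilon> \<omega>)) \<longlongrightarrow> (LINT \<omega>|completion N. f (Y \<omega>))) F)"

section \<open>Quasi-left-continuity\<close>

text \<open>
  A vector-valued process is given by the set of its coordinate processes. The usual augmentation
  adjoins all subsets of null events and takes the right-continuous version.
\<close>

definition augmented_natural_filtration ::
    "'w measure \<Rightarrow> ('w \<Rightarrow> real \<Rightarrow> real) set \<Rightarrow> real \<Rightarrow> 'w measure" where
  "augmented_natural_filtration M \<X> t = sigma (space M)
     (\<Inter>s\<in>{t<..}. sigma_sets (space M)
        ({(\<lambda>\<omega>. X \<omega> u) -` B \<inter> space M | X u B. X \<in> \<X> \<and> u \<in> {0..s} \<and> B \<in> sets borel}
          \<union> null_sets (completion M)))"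

text \<open>Finite predictable times, given by an announcing sequence \<open>\<sigma>\<close>.\<close>

definition finite_predictable_time ::
    "'w measure \<Rightarrow> (real \<Rightarrow> 'w measure) \<Rightarrow> ('w \<Rightarrow> real) \<Rightarrow> bool" where
  "finite_predictable_time M F \<tau> \<longleftrightarrow>
     stopping_time F \<tau> \<and> (\<forall>\<omega>\<in>space M. 0 \<le> \<tau> \<omega>) \<and>
     (\<exists>\<sigma>::nat \<Rightarrow> 'w \<Rightarrow> real.
        (\<forall>n. stopping_time F (\<sigma> n) \<and> (\<forall>\<omega>\<in>space M. 0 \<le> \<sigma> n \<omega>)) \<and>
        (AE \<omega> in M. incseq (\<lambda>n. \<sigma> n \<omega>) \<and> (\<lambda>n. \<sigma> n \<omega>) \<longlonglongrightarrow> \<tau> \<omega> \<and>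
           (\<tau> \<omega> > 0 \<longrightarrow> (\<forall>n. \<sigma> n \<omega> < \<tau> \<omega>))))"

definition quasi_left_continuous ::
    "'w measure \<Rightarrow> (real \<Rightarrow> 'w measure) \<Rightarrow> ('w \<Rightarrow> real \<Rightarrow> real) set \<Rightarrow> bool" where
  "quasi_left_continuous M F \<X> \<longleftrightarrow>
     (\<forall>\<tau>. finite_predictable_time M F \<tau> \<longrightarrow> (AE \<omega> in M. \<forall>X\<in>\<X>. jump (X \<omega>) (\<tau> \<omega>) = 0))"

section \<open>Limit conditions\<close>

definition slowly_varying :: "(real \<Rightarrow> real) \<Rightarrow> bool" where
  "slowly_varying l \<longleftrightarrow> (\<forall>c>0. ((\<lambda>x. l (c * x) / l x) \<longlongrightarrow> 1) at_top)"

definition centred_scaling ::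
    "real \<Rightarrow> real \<Rightarrow> (real \<Rightarrow> real) \<Rightarrow> ('w \<Rightarrow> real \<Rightarrow> real) \<Rightarrow> real \<Rightarrow> 'w \<Rightarrow> real \<Rightarrow> real" where
  "centred_scaling \<mu> h l Z \<epsilon> \<omega> = (\<lambda>t. \<epsilon> powr h * l (1 / \<epsilon>) * (Z \<omega> (t / \<epsilon>) - t / \<epsilon> * \<mu>))"

definition sqrt_scaling ::
    "real \<Rightarrow> (real \<Rightarrow> real) \<Rightarrow> ('w \<Rightarrow> real \<Rightarrow> real) \<Rightarrow> real \<Rightarrow> 'w \<Rightarrow> real \<Rightarrow> real" where
  "sqrt_scaling h l Z \<epsilon> \<omega> = (\<lambda>t. \<epsilon> powr h * l (1 / \<epsilon>) * sqrt (Z \<omega> (t / \<epsilon>)))"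

definition joint_scaling_limit ::
    "'v measure \<Rightarrow> ('v \<Rightarrow> real \<Rightarrow> real) \<Rightarrow> ('v \<Rightarrow> real \<Rightarrow> real) \<Rightarrow> real \<Rightarrow> real \<Rightarrow> (real \<Rightarrow> real)
      \<Rightarrow> 'w measure \<Rightarrow> ('w \<Rightarrow> real \<Rightarrow> real) \<Rightarrow> ('w \<Rightarrow> real \<Rightarrow> real) \<Rightarrow> bool" where
  "joint_scaling_limit M Z1 Z2 \<mu> h l N Y1 Y2 \<longleftrightarrow>
     converges_weakly WM2_topology
       M (\<lambda>\<epsilon> \<omega>. (centred_scaling \<mu> h l Z1 \<epsilon> \<omega>, sqrt_scaling h l Z2 \<epsilon> \<omega>))
       N (\<lambda>\<omega>. (Y1 \<omega>, \<lambda>t. sqrt (Y2 \<omega> t))) (at_right 0)"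

definition marginal_limit_condition ::
    "'v measure \<Rightarrow> ('v \<Rightarrow> real \<Rightarrow> real) \<Rightarrow> real \<Rightarrow> real \<Rightarrow> (real \<Rightarrow> real)
      \<Rightarrow> 'w measure \<Rightarrow> ('w \<Rightarrow> real \<Rightarrow> real) \<Rightarrow> bool" where
  "marginal_limit_condition M Z1 \<mu> h l N Y1 \<longleftrightarrow>
     process M cadlag_paths Z1 \<and> (AE \<omega> in M. Z1 \<omega> 0 = 0) \<and>
     0 < h \<and> h < 1 \<and>
     (\<forall>\<^sub>F x in at_top. l x > 0) \<and> slowly_varying l \<and>
     process N cadlag_paths Y1 \<and>
     converges_weakly M2_topology M (centred_scaling \<mu> h l Z1) N Y1 (at_right 0) \<and>
     (AE \<omega> in M. ((\<lambda>t. (Z1 \<omega> t - \<mu> * t) / t) \<longlongrightarrow> 0) at_top) \<and>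
     (\<forall>a>0. path_law N (\<lambda>\<omega> t. Y1 \<omega> (a * t)) = path_law N (\<lambda>\<omega> t. a powr h * Y1 \<omega> t)) \<and>
     quasi_left_continuous N (augmented_natural_filtration N {Y1}) {Y1}"

definition functional_limit_condition ::
    "'v measure \<Rightarrow> ('v \<Rightarrow> real \<Rightarrow> real) \<Rightarrow> ('v \<Rightarrow> real \<Rightarrow> real) \<Rightarrow> real \<Rightarrow> real \<Rightarrow> (real \<Rightarrow> real)
      \<Rightarrow> 'w measure \<Rightarrow> ('w \<Rightarrow> real \<Rightarrow> real) \<Rightarrow> ('w \<Rightarrow> real \<Rightarrow> real) \<Rightarrow> bool" where
  "functional_limit_condition M Z1 Z2 \<mu> h l N Y1 Y2 \<longleftrightarrow>
     process M cadlag_paths Z1 \<and> process M cadlag_paths_nonneg Z2 \<and> (AE \<omega> in M. Z1 \<omega> 0 = 0) \<and>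
     (\<forall>\<^sub>F x in at_top. l x > 0) \<and> slowly_varying l \<and>
     process N cadlag_paths Y1 \<and> process N cadlag_paths_nonneg Y2 \<and>
     joint_scaling_limit M Z1 Z2 \<mu> h l N Y1 Y2 \<and>
     0 < h \<and> h < 1 \<and>
     (AE \<omega> in M. ((\<lambda>t. (Z1 \<omega> t - \<mu> * t) / t) \<longlongrightarrow> 0) at_top) \<and>
     (AE \<omega> in M. ((\<lambda>t. Z2 \<omega> t / t\<^sup>2) \<longlongrightarrow> 0) at_top) \<and>
     (\<forall>a>0. joint_path_law N (\<lambda>\<omega> t. Y1 \<omega> (a * t)) (\<lambda>\<omega> t. Y2 \<omega> (a * t))
          = joint_path_law N (\<lambda>\<omega> t. a powr h * Y1 \<omega> t) (\<lambda>\<omega> t. a powr (2 * h) * Y2 \<omega> t)) \<and>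
     quasi_left_continuous N (augmented_natural_filtration N {Y1, Y2}) {Y1} \<and>
     (AE \<omega> in N. \<forall>t>0. Y2 \<omega> t > 0) \<and>
     (AE \<omega> in N. \<forall>t>0. jump (Y2 \<omega>) t \<ge> 0)"

section \<open>Sectioning\<close>

definition section_mean :: "nat \<Rightarrow> (nat \<Rightarrow> 'w \<Rightarrow> real \<Rightarrow> real) \<Rightarrow> 'w \<Rightarrow> real \<Rightarrow> real" where
  "section_mean m X \<omega> t = 1 / real m * (\<Sum>i=1..m. X i \<omega> t)"

definition section_variance :: "nat \<Rightarrow> (nat \<Rightarrow> 'w \<Rightarrow> real \<Rightarrow> real) \<Rightarrow> 'w \<Rightarrow> real \<Rightarrow> real" where
  "section_variance m X \<omega> t =
     (if t > 0
      then 1 / (real m - 1) *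
        (\<Sum>i=1..m. 1 / t * (LINT s:{0..t}|lborel. (X i \<omega> s - section_mean m X \<omega> s)\<^sup>2))
      else 0)"

end

theory Submission
  imports Defs
begin

text \<open>
  Addition is continuous for M2 convergence at paths without common jumps, and the section variance
  is continuous for M2 convergence on paths that start at 0. Independent processes without fixed
  jump times almost surely have no common jumps, so the pair (mean, root of the variance) is an
  almost surely continuous functional of the vector of sections. The joint convergence of this
  vector follows from the marginal one: M2 convergence is the convergence of countably many
  functionals with values in \<open>[0, 1]\<close>, Lipschitz functions of finitely many of them are uniform
  limits of sums of products of tent functions, and the expectations of such products factorise by
  independence. Bounded continuous functionals are then reached from below by infimal convolutions.
  The remaining properties of the sections transfer through equality of laws; positivity of the
  variance at all times follows from self-similarity and the monotonicity of \<open>t\<close> times the variance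
  at \<open>t\<close>.
\<close>

section \<open>Cadlag paths\<close>

text \<open>Addition fails to be M2 continuous where two summands jump together: opposite jumps at
  slightly different times leave a spike in the sum, whereas at a common time they may cancel. The
  absence of fixed jump times comes from quasi-left-continuity, because constant positive times are
  predictable. Starting at 0 matters because the variance is set to 0 at time 0, while time averages
  of paths with different starting values tend to a positive limit there. For \<open>Z\<close> the
  start is inherited from \<open>Z1\<close>; for \<open>Y\<close> it is a consequence of
  self-similarity. Measurability shapes the rest. The copies are tied to the originals only by laws
  on the product sigma-algebra of the coordinates, whose events see countably many times. Each
  transferred path property is therefore restated at countably many times, and the integral in the
  variance is read through such times as well. Test functions are only known to be continuous for a
  topology given by sequences, so their measurability along processes has to be established before
  expectations can be compared.\<close>

lemma eventually_uniform_Icc: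
  fixes P :: "'n \<Rightarrow> real \<Rightarrow> bool"
  assumes loc: "\<And>t. t \<in> {0..T} \<Longrightarrow> \<exists>\<delta>>0. \<forall>\<^sub>F n in F. \<forall>s\<in>{0..T}. \<bar>s - t\<bar> < \<delta> \<longrightarrow> P n s"
  shows "\<forall>\<^sub>F n in F. \<forall>s\<in>{0..T}. P n s"
proof -
  obtain d where d: "\<And>t. t \<in> {0..T} \<Longrightarrow> d t > 0"
    "\<And>t. t \<in> {0..T} \<Longrightarrow> \<forall>\<^sub>F n in F. \<forall>s\<in>{0..T}. \<bar>s - t\<bar> < d t \<longrightarrow> P n s"
    using loc by metis
  have "{0..T} \<subseteq> (\<Union>t\<in>{0..T}. ball t (d t))" using d(1) by force
  then obtain C where C: "C \<subseteq> {0..T}" "finite C" "{0..T} \<subseteq> (\<Union>t\<in>C. ball t (d t))"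
    by (rule compactE_image[OF compact_Icc open_ball])
  have "\<forall>\<^sub>F n in F. \<forall>t\<in>C. \<forall>s\<in>{0..T}. \<bar>s - t\<bar> < d t \<longrightarrow> P n s"
    using C d(2) by (intro eventually_ball_finite) auto
  then show ?thesis
  proof eventually_elim
    case (elim n)
    show ?case
    proof
      fix s assume s: "s \<in> {0..T}"
      then obtain t where "t \<in> C" "s \<in> ball t (d t)" using C(3) by auto
      then show "P n s" using elim s by (auto simp: dist_real_def abs_minus_commute)
    qed
  qed
qed

lemma cadlag_right:
  assumes "x \<in> cadlag_paths" "t \<ge> 0" "e > 0"
  obtains \<delta> where "\<delta> > 0" "\<And>s. t \<le> s \<Longrightarrow> s < t + \<delta> \<Longrightarrow> \<bar>x s - x t\<bar> < e"
proof -
  have "(x \<longlongrightarrow> x t) (at_right t)"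
    using assms by (auto simp: cadlag_paths_def continuous_within)
  then have "\<forall>\<^sub>F s in at_right t. dist (x s) (x t) < e" using assms(3) by (rule tendstoD)
  then obtain b where b: "b > t" "\<And>s. s > t \<Longrightarrow> s < b \<Longrightarrow> dist (x s) (x t) < e"
    by (auto simp: eventually_at_right_field)
  show ?thesis
  proof (rule that[of "b - t"])
    fix s assume "t \<le> s" "s < t + (b - t)"
    then show "\<bar>x s - x t\<bar> < e" using b(2)[of s] assms(3) by (cases "s = t") (auto simp: dist_real_def)
  qed (use b in auto)
qed

lemma left_limit_tendsto:
  assumes "x \<in> cadlag_paths" "t > 0"
  shows "(x \<longlongrightarrow> left_limit x t) (at_left t)"
proof -
  obtain l where l: "(x \<longlongrightarrow> l) (at_left t)" using assms by (auto simp: cadlag_paths_def)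
  then have "Lim (at_left t) x = l" by (intro tendsto_Lim) (auto simp: trivial_limit_at_left_real)
  then show ?thesis using l assms by (simp add: left_limit_def)
qed

lemma cadlag_left:
  assumes "x \<in> cadlag_paths" "t > 0" "e > 0"
  obtains \<delta> where "\<delta> > 0" "\<delta> \<le> t" "\<And>s. t - \<delta> < s \<Longrightarrow> s < t \<Longrightarrow> \<bar>x s - left_limit x t\<bar> < e"
proof -
  have "\<forall>\<^sub>F s in at_left t. dist (x s) (left_limit x t) < e"
    using left_limit_tendsto[OF assms(1,2)] assms(3) by (rule tendstoD)
  then obtain b where b: "b < t" "\<And>s. s > b \<Longrightarrow> s < t \<Longrightarrow> dist (x s) (left_limit x t) < e"
    by (auto simp: eventually_at_left_field)
  show ?thesis
    by (rule that[of "min t (t - b)"]) (use b assms in \<open>auto simp: dist_real_def\<close>)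
qed

text \<open>The two one-sided neighbourhoods are merged. At time 0 no nonnegative time lies to the
  left, so any width serves on that side.\<close>

lemma cadlag_near:
  assumes "x \<in> cadlag_paths" "t \<ge> 0" "e > 0"
  obtains \<delta> where "\<delta> > 0"
    "\<And>s. s \<ge> 0 \<Longrightarrow> \<bar>s - t\<bar> < \<delta> \<Longrightarrow> \<bar>x s - left_limit x t\<bar> < e \<or> \<bar>x s - x t\<bar> < e"
proof -
  obtain a where a: "a > 0" "\<And>s. t \<le> s \<Longrightarrow> s < t + a \<Longrightarrow> \<bar>x s - x t\<bar> < e"
    using cadlag_right[OF assms] by blast
  obtain b where b: "b > 0" "\<And>s. s \<ge> 0 \<Longrightarrow> t - b < s \<Longrightarrow> s < t \<Longrightarrow> \<bar>x s - left_limit x t\<bar> < e"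
  proof (cases "t = 0")
    case False
    then show ?thesis using cadlag_left[OF assms(1) _ assms(3), of t] assms(2) that
      by (metis less_eq_real_def)
  qed (use that[of 1] in auto)
  show ?thesis
  proof (rule that[of "min a b"])
    fix s assume "s \<ge> 0" "\<bar>s - t\<bar> < min a b"
    then show "\<bar>x s - left_limit x t\<bar> < e \<or> \<bar>x s - x t\<bar> < e"
      using a(2)[of s] b(2)[of s] by (cases "s < t") auto
  qed (use a b in auto)
qed

lemma cadlag_bounded:
  assumes "x \<in> cadlag_paths"
  obtains K where "K > 0" "\<And>s. s \<in> {0..T} \<Longrightarrow> \<bar>x s\<bar> \<le> K"
proof -
  \<comment> \<open>The bound is the index of the sequence, so that boundedness becomes an eventual
    statement to which the compactness lemma applies.\<close>
  have "\<forall>\<^sub>F n in sequentially. \<forall>s\<in>{0..T}. \<bar>x s\<bar> \<le> real n"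
  proof (rule eventually_uniform_Icc)
    fix t assume t: "t \<in> {0..T}"
    obtain \<delta> where \<delta>: "\<delta> > 0" "\<And>s. s \<ge> 0 \<Longrightarrow> \<bar>s - t\<bar> < \<delta> \<Longrightarrow> \<bar>x s - left_limit x t\<bar> < 1 \<or> \<bar>x s - x t\<bar> < 1"
      using cadlag_near[OF assms, of t 1] t by auto
    obtain k where k: "\<bar>left_limit x t\<bar> + \<bar>x t\<bar> + 1 < real k" using reals_Archimedean2 by blast
    have "\<forall>\<^sub>F n in sequentially. \<forall>s\<in>{0..T}. \<bar>s - t\<bar> < \<delta> \<longrightarrow> \<bar>x s\<bar> \<le> real n"
      using eventually_ge_at_top[of k]
    proof eventually_elim
      case (elim n)
      have "real k \<le> real n" using elim by simp
      then show ?case using \<delta>(2) k by fastforce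
    qed
    then show "\<exists>\<delta>>0. \<forall>\<^sub>F n in sequentially. \<forall>s\<in>{0..T}. \<bar>s - t\<bar> < \<delta> \<longrightarrow> \<bar>x s\<bar> \<le> real n"
      using \<delta>(1) by blast
  qed
  then obtain n where "\<forall>s\<in>{0..T}. \<bar>x s\<bar> \<le> real n" by (auto dest: eventually_happens)
  then show ?thesis using that[of "real n + 1"] by fastforce
qed

lemma left_limit_bounds:
  assumes "x \<in> cadlag_paths" "t > 0" "d > 0"
    and "\<And>s. s \<ge> 0 \<Longrightarrow> t - d < s \<Longrightarrow> s < t \<Longrightarrow> x s \<in> {a..b}"
  shows "left_limit x t \<in> {a..b}"
proof -
  have "\<forall>\<^sub>F s in at_left t. x s \<in> {a..b}"
    unfolding eventually_at_left_field
    by (rule exI[of _ "max 0 (t - d)"]) (use assms in auto)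
  moreover have "closed {a..b}" by simp
  ultimately show ?thesis
    using left_limit_tendsto[OF assms(1,2)] by (intro Lim_in_closed_set) auto
qed

lemma isCont_iff_left_limit:
  assumes "x \<in> cadlag_paths" "t > 0"
  shows "isCont x t \<longleftrightarrow> left_limit x t = x t"
proof
  assume "isCont x t"
  then have "(x \<longlongrightarrow> x t) (at_left t)" by (auto simp: isCont_def intro: tendsto_within_subset)
  then show "left_limit x t = x t"
    using left_limit_tendsto[OF assms] tendsto_unique by (metis trivial_limit_at_left_real)
next
  assume *: "left_limit x t = x t"
  show "isCont x t"
    unfolding continuous_at_split
  proof
    show "continuous (at_left t) x"
      using left_limit_tendsto[OF assms] * by (simp add: continuous_within)
    show "continuous (at_right t) x" using assms by (simp add: cadlag_paths_def)
  qed
qed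

lemma jump_eq_0_iff:
  assumes "x \<in> cadlag_paths" "t > 0"
  shows "jump x t = 0 \<longleftrightarrow> isCont x t"
  using isCont_iff_left_limit[OF assms] by (auto simp: jump_def)

lemma cadlag_minus: "x \<in> cadlag_paths \<Longrightarrow> (\<lambda>t. - x t) \<in> cadlag_paths"
  by (auto simp: cadlag_paths_def intro!: continuous_intros) (metis tendsto_minus)

lemma cadlag_add:
  "x \<in> cadlag_paths \<Longrightarrow> y \<in> cadlag_paths \<Longrightarrow> (\<lambda>t. x t + y t) \<in> cadlag_paths"
  by (auto simp: cadlag_paths_def intro!: continuous_intros) (metis tendsto_add)

lemma cadlag_mult:
  "x \<in> cadlag_paths \<Longrightarrow> y \<in> cadlag_paths \<Longrightarrow> (\<lambda>t. x t * y t) \<in> cadlag_paths"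
  by (auto simp: cadlag_paths_def intro!: continuous_intros) (metis tendsto_mult)

lemma cadlag_const: "(\<lambda>t. c) \<in> cadlag_paths"
  by (auto simp: cadlag_paths_def intro: tendsto_const)

lemma cadlag_sum:
  "(\<And>i. i \<in> I \<Longrightarrow> y i \<in> cadlag_paths) \<Longrightarrow> (\<lambda>t. \<Sum>i\<in>I. y i t) \<in> cadlag_paths"
  by (induction I rule: infinite_finite_induct) (auto intro: cadlag_const cadlag_add)

lemma cadlag_of_continuous:
  assumes "continuous_on {0..} x"
  shows "x \<in> cadlag_paths"
proof -
  have c: "continuous (at t within {0..}) x" if "t \<ge> 0" for t
    using assms that by (simp add: continuous_on_eq_continuous_within)
  have "continuous (at_right t) x" if "t \<ge> 0" for t
    using c[OF that] by (rule continuous_within_subset) (use that in auto)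
  moreover have "(x \<longlongrightarrow> x t) (at_left t)" if "t > 0" for t
  proof -
    have "at t within {0..} = at t"
      using that by (intro at_within_interior) (auto simp: interior_Ici)
    then have "isCont x t" using c[of t] that by simp
    then show ?thesis by (auto simp: isCont_def intro: tendsto_within_subset)
  qed
  ultimately show ?thesis by (auto simp: cadlag_paths_def)
qed

lemma left_limit_uminus:
  assumes "x \<in> cadlag_paths" "t \<ge> 0"
  shows "left_limit (\<lambda>t. - x t) t = - left_limit x t"
proof (cases "t > 0")
  case True
  then show ?thesis
    using tendsto_unique[OF trivial_limit_at_left_real
        left_limit_tendsto[OF cadlag_minus[OF assms(1)] True] tendsto_minus[OF left_limit_tendsto[OF assms(1) True]]]
    by simp
qed (simp add: left_limit_def)

text \<open>An upward jump at \<open>t\<close> is marked by three rationals: a level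
  \<open>p\<close> strictly between left limit and value, and the ends \<open>s\<close>,
  \<open>u\<close> of an interval around \<open>t\<close> on which the path is below
  \<open>p\<close> before \<open>t\<close> and above \<open>p\<close> from \<open>t\<close> on. The
  marking is injective. Downward jumps are upward jumps of \<open>- x\<close>.\<close>

lemma cadlag_countable_jumps:
  assumes x: "x \<in> cadlag_paths"
  shows "countable {t. t > 0 \<and> \<not> isCont x t}"
proof -
  have main: "countable {t. t > 0 \<and> left_limit y t < y t}" (is "countable ?J")
    if y: "y \<in> cadlag_paths" for y
  proof -
    define R where "R = (\<lambda>t (p, s, u). real_of_rat s < t \<and> t < real_of_rat u
        \<and> (\<forall>r. real_of_rat s < r \<and> r < t \<longrightarrow> y r < real_of_rat p)
        \<and> (\<forall>r. t \<le> r \<and> r < real_of_rat u \<longrightarrow> real_of_rat p < y r))"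
    have "\<forall>t\<in>?J. \<exists>z. R t z"
    proof
      fix t assume t: "t \<in> ?J"
      obtain p where p: "left_limit y t < real_of_rat p" "real_of_rat p < y t"
        using of_rat_dense[of "left_limit y t" "y t"] t by auto
      obtain a where a: "a > 0" "\<And>s. t \<le> s \<Longrightarrow> s < t + a \<Longrightarrow> \<bar>y s - y t\<bar> < y t - of_rat p"
        by (rule cadlag_right[OF y, of t "y t - of_rat p"]) (use t p in auto)
      obtain b where b: "b > 0" "\<And>s. t - b < s \<Longrightarrow> s < t \<Longrightarrow> \<bar>y s - left_limit y t\<bar> < of_rat p - left_limit y t"
        by (rule cadlag_left[OF y, of t "of_rat p - left_limit y t"]) (use t p in auto)
      obtain u where "t < real_of_rat u" "real_of_rat u < t + a"
        using of_rat_dense[of t "t + a"] a(1) by auto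
      moreover obtain s where "t - b < real_of_rat s" "real_of_rat s < t"
        using of_rat_dense[of "t - b" t] b(1) by auto
      moreover have "y r < of_rat p" if "of_rat s < r" "r < t" for r
        using b(2)[of r] that \<open>t - b < of_rat s\<close> by linarith
      moreover have "of_rat p < y r" if "t \<le> r" "r < of_rat u" for r
        using a(2)[of r] that \<open>of_rat u < t + a\<close> by linarith
      ultimately have "R t (p, s, u)" by (simp add: R_def)
      then show "\<exists>z. R t z" ..
    qed
    then obtain f where f: "\<forall>t\<in>?J. R t (f t)" using bchoice[of ?J R] by blast
    have sep: "\<not> t < t'" if "t \<in> ?J" "t' \<in> ?J" "f t = f t'" for t t'
    proof
      assume tt: "t < t'"
      obtain p s u where fp: "f t = (p, s, u)" by (cases "f t")
      then have R: "R t (p, s, u)" "R t' (p, s, u)" using f that by metis+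
      \<comment> \<open>Between two times with the same mark the path would lie above
        \<open>p\<close>, being after \<open>t\<close>, and below \<open>p\<close>, being before
        \<open>t'\<close>.\<close>
      obtain r where r: "t < r" "r < t'" using dense tt by blast
      then show False using R by (force simp: R_def)
    qed
    have "inj_on f ?J"
    proof (rule inj_onI)
      fix t t' assume "t \<in> ?J" "t' \<in> ?J" "f t = f t'"
      then show "t = t'" using sep[of t t'] sep[of t' t] by (simp add: not_less)
    qed
    then show ?thesis by (rule countableI')
  qed
  have "{t. t > 0 \<and> \<not> isCont x t}
      \<subseteq> {t. t > 0 \<and> left_limit x t < x t} \<union> {t. t > 0 \<and> left_limit (\<lambda>t. - x t) t < - x t}"
    using isCont_iff_left_limit[OF x] left_limit_uminus[OF x] by auto
  then show ?thesis
    using main[OF x] main[OF cadlag_minus[OF x]] by (meson countable_Un countable_subset)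
qed

text \<open>The discontinuities are countable and an interval is not. M2 convergence only speaks of
  horizons at continuity points of the limit, so large ones have to be supplied.\<close>

lemma cadlag_continuity_point:
  assumes x: "x \<in> cadlag_paths"
  obtains T where "T > a" "T > 0" "isCont x T"
proof -
  have "uncountable {max a 0<..<max a 0 + 1}" by (intro uncountable_open_interval[THEN iffD2]) simp
  then have "\<not> {max a 0<..<max a 0 + 1} \<subseteq> {t. t > 0 \<and> \<not> isCont x t}"
    using cadlag_countable_jumps[OF x] countable_subset by blast
  then show ?thesis using that by auto
qed

text \<open>Continuity off a countable set gives Borel measurability; 0 joins the exceptional set
  because the cut-off by the indicator may jump there.\<close>

lemma cadlag_borel:
  assumes x: "x \<in> cadlag_paths"
  shows "set_borel_measurable borel {0..} x"
proof -
  have "countable ({t. t > 0 \<and> \<not> isCont x t} \<union> {0})" using cadlag_countable_jumps[OF x] by simp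
  moreover have "continuous_on (- ({t. t > 0 \<and> \<not> isCont x t} \<union> {0})) (\<lambda>t. indicator {0..} t *\<^sub>R x t)"
  proof -
    have "isCont (\<lambda>t. indicator {0..} t *\<^sub>R x t) t"
      if t: "t \<in> - ({t. t > 0 \<and> \<not> isCont x t} \<union> {0})" for t
    proof (cases "t > 0")
      case True
      then have "\<forall>\<^sub>F s in nhds t. s > 0" by (rule order_tendstoD(1)[OF filterlim_ident])
      then have "\<forall>\<^sub>F s in nhds t. indicator {0..} s *\<^sub>R x s = x s" by eventually_elim simp
      then show ?thesis using t True by (subst isCont_cong) auto
    next
      case False
      then have "t < 0" using t by auto
      then have "\<forall>\<^sub>F s in nhds t. s < 0" by (rule order_tendstoD(2)[OF filterlim_ident])
      then have "\<forall>\<^sub>F s in nhds t. indicator {0..} s *\<^sub>R x s = 0" by eventually_elim simp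
      then show ?thesis by (simp only: isCont_cong continuous_const)
    qed
    then show ?thesis by (simp add: continuous_at_imp_continuous_on)
  qed
  ultimately show ?thesis
    unfolding set_borel_measurable_def by (rule borel_measurable_continuous_countable_exceptions)
qed

section \<open>Graph convergence and the M2 topology\<close>

text \<open>
  Convergence of local suprema, stated without left limits; applied to \<open>x\<close> and \<open>- x\<close> it amounts
  to M2 convergence. Unlike the Hausdorff distance, this form is stable under addition at
  all times at which one of the two summands is continuous.
\<close>

definition hypo_converges :: "(nat \<Rightarrow> real \<Rightarrow> real) \<Rightarrow> (real \<Rightarrow> real) \<Rightarrow> bool" where
  "hypo_converges xs x \<longleftrightarrow>
     (\<forall>t\<ge>0. \<forall>c. \<forall>\<delta>>0. (\<forall>s\<ge>0. \<bar>s - t\<bar> < \<delta> \<longrightarrow> x s \<le> c) \<longrightarrow>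
        (\<forall>e>0. \<exists>\<delta>'>0. \<forall>\<^sub>F n in sequentially. \<forall>s\<ge>0. \<bar>s - t\<bar> < \<delta>' \<longrightarrow> xs n s < c + e)) \<and>
     (\<forall>t\<ge>0. \<forall>e>0. \<forall>\<delta>>0. \<forall>\<^sub>F n in sequentially. \<exists>s\<ge>0. \<bar>s - t\<bar> < \<delta> \<and> xs n s > x t - e)"

definition graph_converges :: "(nat \<Rightarrow> real \<Rightarrow> real) \<Rightarrow> (real \<Rightarrow> real) \<Rightarrow> bool" where
  "graph_converges xs x \<longleftrightarrow>
     hypo_converges xs x \<and> hypo_converges (\<lambda>n t. - xs n t) (\<lambda>t. - x t)"

lemma hypo_convergesD1:
  assumes "hypo_converges xs x" "t \<ge> 0" "\<delta> > 0" "\<And>s. s \<ge> 0 \<Longrightarrow> \<bar>s - t\<bar> < \<delta> \<Longrightarrow> x s \<le> c" "e > 0"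
  obtains \<delta>' where "\<delta>' > 0" "\<forall>\<^sub>F n in sequentially. \<forall>s\<ge>0. \<bar>s - t\<bar> < \<delta>' \<longrightarrow> xs n s < c + e"
  using assms unfolding hypo_converges_def by blast

lemma hypo_convergesD2:
  assumes "hypo_converges xs x" "t \<ge> 0" "\<delta> > 0" "e > 0"
  shows "\<forall>\<^sub>F n in sequentially. \<exists>s\<ge>0. \<bar>s - t\<bar> < \<delta> \<and> xs n s > x t - e"
  using assms unfolding hypo_converges_def by blast

text \<open>Locally \<open>x\<close> leaves the range of the completed jump by at most
  \<open>e / 2\<close>; the supremum clauses for \<open>x\<close> and \<open>- x\<close> carry this
  over to the sequence at the cost of another \<open>e / 2\<close>.\<close>

lemma graph_converges_near:
  assumes g: "graph_converges xs x" and x: "x \<in> cadlag_paths" and t: "t \<ge> 0" and e: "e > 0"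
  obtains \<delta> where "\<delta> > 0" "\<forall>\<^sub>F n in sequentially. \<forall>s\<ge>0. \<bar>s - t\<bar> < \<delta> \<longrightarrow>
      min (left_limit x t) (x t) - e < xs n s \<and> xs n s < max (left_limit x t) (x t) + e"
proof -
  have e2: "e / 2 > 0" using e by simp
  have gP: "hypo_converges xs x" and gN: "hypo_converges (\<lambda>n t. - xs n t) (\<lambda>t. - x t)"
    using g by (auto simp: graph_converges_def)
  obtain d where d: "d > 0" "\<And>s. s \<ge> 0 \<Longrightarrow> \<bar>s - t\<bar> < d \<Longrightarrow> \<bar>x s - left_limit x t\<bar> < e / 2 \<or> \<bar>x s - x t\<bar> < e / 2"
    using cadlag_near[OF x t e2] by blast
  have up: "x s \<le> max (left_limit x t) (x t) + e / 2" if "s \<ge> 0" "\<bar>s - t\<bar> < d" for s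
    using d(2)[OF that] by linarith
  have lo: "- x s \<le> - min (left_limit x t) (x t) + e / 2" if "s \<ge> 0" "\<bar>s - t\<bar> < d" for s
    using d(2)[OF that] by linarith
  obtain d1 where d1: "d1 > 0" "\<forall>\<^sub>F n in sequentially. \<forall>s\<ge>0. \<bar>s - t\<bar> < d1 \<longrightarrow> xs n s < max (left_limit x t) (x t) + e / 2 + e / 2"
    using hypo_convergesD1[OF gP t d(1) up e2] by blast
  obtain d2 where d2: "d2 > 0" "\<forall>\<^sub>F n in sequentially. \<forall>s\<ge>0. \<bar>s - t\<bar> < d2 \<longrightarrow> - xs n s < - min (left_limit x t) (x t) + e / 2 + e / 2"
    using hypo_convergesD1[OF gN t d(1) lo e2] by blast
  show ?thesis
  proof (rule that[of "min d1 d2"])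
    show "\<forall>\<^sub>F n in sequentially. \<forall>s\<ge>0. \<bar>s - t\<bar> < min d1 d2 \<longrightarrow>
      min (left_limit x t) (x t) - e < xs n s \<and> xs n s < max (left_limit x t) (x t) + e"
      using d1(2) d2(2)
    proof eventually_elim
      case (elim n)
      show ?case
      proof (intro allI impI)
        fix s assume s: "0 \<le> s" "\<bar>s - t\<bar> < min d1 d2"
        have "xs n s < max (left_limit x t) (x t) + e / 2 + e / 2"
          "- xs n s < - min (left_limit x t) (x t) + e / 2 + e / 2"
          using elim s by auto
        then show "min (left_limit x t) (x t) - e < xs n s \<and> xs n s < max (left_limit x t) (x t) + e"
          by linarith
      qed
    qed
  qed (use d1 d2 in auto)
qed

lemma hypo_converges_hit_left:
  assumes h: "hypo_converges xs x" and x: "x \<in> cadlag_paths" and t: "t \<ge> 0" and "e > 0" "d > 0"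
  shows "\<forall>\<^sub>F n in sequentially. \<exists>s\<ge>0. \<bar>s - t\<bar> < d \<and> xs n s > left_limit x t - e"
proof (cases "t > 0")
  case False
  then have "left_limit x t = x t" by (simp add: left_limit_def)
  then show ?thesis using hypo_convergesD2[OF h t \<open>d > 0\<close> \<open>e > 0\<close>] by simp
next
  case True
  have e2: "e / 2 > 0" using assms by simp
  obtain a where a: "a > 0" "a \<le> t" "\<And>s. t - a < s \<Longrightarrow> s < t \<Longrightarrow> \<bar>x s - left_limit x t\<bar> < e / 2"
    using cadlag_left[OF x True e2] by blast
  \<comment> \<open>A time just before \<open>t\<close>: within \<open>a\<close>, so that its value
    is close to the left limit, and within \<open>d / 2\<close>, so that its own
    \<open>d / 2\<close> neighbourhood stays within \<open>d\<close> of \<open>t\<close>. As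
    \<open>a \<le> t\<close>, it is nonnegative.\<close>
  define r where "r = t - min a d / 2"
  have r: "r \<ge> 0" "t - a < r" "r < t" "\<bar>r - t\<bar> \<le> d / 2"
    using a(1,2) \<open>d > 0\<close> t by (auto simp: r_def min_def)
  have "\<forall>\<^sub>F n in sequentially. \<exists>s\<ge>0. \<bar>s - r\<bar> < d / 2 \<and> xs n s > x r - e / 2"
    using hypo_convergesD2[OF h r(1), of "d/2"] \<open>d > 0\<close> e2 by simp
  then show ?thesis
  proof eventually_elim
    case (elim n)
    then obtain s where "s \<ge> 0" "\<bar>s - r\<bar> < d / 2" "xs n s > x r - e / 2" by blast
    then show ?case using a(3)[OF r(2,3)] r(4) by (intro exI[of _ s]) linarith
  qed
qed

lemma hypo_converges_hit:
  assumes h: "hypo_converges xs x" and x: "x \<in> cadlag_paths" and t: "t \<ge> 0" and "e > 0" "d > 0"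
  shows "\<forall>\<^sub>F n in sequentially. \<exists>s\<ge>0. \<bar>s - t\<bar> < d \<and> xs n s > max (left_limit x t) (x t) - e"
  using hypo_converges_hit_left[OF assms] hypo_convergesD2[OF h t \<open>d > 0\<close> \<open>e > 0\<close>]
  by (simp add: max_def)

section \<open>Vertical segments and the intermediate value property of completed graphs\<close>

lemma mem_segment_iff: "z \<in> closed_segment (a::real) b \<longleftrightarrow> min a b \<le> z \<and> z \<le> max a b"
  by (auto simp: closed_segment_eq_real_ivl)

lemma closed_segment_nearest:
  assumes "min a b - e \<le> z" "z \<le> max a b + (e::real)" "e \<ge> 0"
  obtains z' where "z' \<in> closed_segment a b" "\<bar>z - z'\<bar> \<le> e"
proof (rule that)
  let ?z = "max (min a b) (min (max a b) z)"
  show "?z \<in> closed_segment a b" by (simp add: mem_segment_iff)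
  show "\<bar>z - ?z\<bar> \<le> e" using assms by linarith
qed

text \<open>Completed graphs have no gaps, although cadlag paths do.\<close>

lemma completed_graph_IVT:
  assumes x: "x \<in> cadlag_paths" and st: "0 \<le> s" "s \<le> t" and z: "x s \<le> z" "z \<le> x t"
  obtains u where "u \<in> {s..t}" "z \<in> closed_segment (left_limit x u) (x u)"
proof -
  define S where "S = {v \<in> {s..t}. x v \<le> z}"
  \<comment> \<open>Right-continuity forces \<open>z \<le> x u\<close>, since all later values
    exceed \<open>z\<close>; members of \<open>S\<close> arbitrarily near \<open>u\<close> force the
    value or the left limit at \<open>u\<close> to be at most \<open>z\<close>.\<close>
  define u where "u = Sup S"
  have sS: "s \<in> S" using st z by (auto simp: S_def)
  have bdd: "bdd_above S" by (rule bdd_aboveI[of _ t]) (auto simp: S_def)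
  have su: "s \<le> u" unfolding u_def by (rule cSup_upper[OF sS bdd])
  have ut: "u \<le> t" unfolding u_def by (rule cSup_least) (use sS in \<open>auto simp: S_def\<close>)
  have gt: "x v > z" if "u < v" "v \<le> t" for v
    using that cSup_upper[OF _ bdd, of v] su unfolding u_def S_def by force
  have hi: "z \<le> x u"
  proof (rule ccontr)
    assume "\<not> z \<le> x u"
    then have lt: "x u < z" by simp
    then have "u < t" using z ut by (cases "u = t") auto
    obtain d where d: "d > 0" "\<And>r. u \<le> r \<Longrightarrow> r < u + d \<Longrightarrow> \<bar>x r - x u\<bar> < z - x u"
      by (rule cadlag_right[OF x, of u "z - x u"]) (use su st lt in auto)
    have "\<bar>x (min t (u + d / 2)) - x u\<bar> < z - x u" using d(1) \<open>u < t\<close> by (intro d(2)) auto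
    moreover have "x (min t (u + d / 2)) > z" using d(1) \<open>u < t\<close> by (intro gt) auto
    ultimately show False by linarith
  qed
  have lo: "x u \<le> z \<or> left_limit x u \<le> z"
  proof (rule ccontr)
    assume "\<not> ?thesis"
    then have n: "x u > z" "left_limit x u > z" by auto
    then have "u \<noteq> s" using z by auto
    then have "u > s" "u > 0" using su st by auto
    obtain d where d: "d > 0" "\<And>r. u - d < r \<Longrightarrow> r < u \<Longrightarrow> \<bar>x r - left_limit x u\<bar> < left_limit x u - z"
      by (rule cadlag_left[OF x \<open>u > 0\<close>, of "left_limit x u - z"]) (use n in auto)
    obtain v where v: "v \<in> S" "u - d < v" using d(1) less_cSupD[of S "u - d"] sS unfolding u_def
      by auto
    have "v \<le> u" unfolding u_def by (rule cSup_upper[OF v(1) bdd])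
    moreover have "v \<noteq> u" using v n by (auto simp: S_def)
    ultimately have "x v > z" using d(2)[of v] v(2) by linarith
    then show False using v by (simp add: S_def)
  qed
  show ?thesis by (rule that[of u]) (use su ut hi lo in \<open>auto simp: mem_segment_iff\<close>)
qed

text \<open>For the reversed order of times the property is applied to \<open>- x\<close>, as
  negation exchanges the lower and the upper end.\<close>

lemma completed_graph_IVT':
  assumes x: "x \<in> cadlag_paths" and "0 \<le> s" "0 \<le> t" and z: "x s \<le> z" "z \<le> x t"
  obtains u where "min s t \<le> u" "u \<le> max s t" "z \<in> closed_segment (left_limit x u) (x u)"
proof (cases "s \<le> t")
  case True
  obtain u where "u \<in> {s..t}" "z \<in> closed_segment (left_limit x u) (x u)"
    using completed_graph_IVT[OF x assms(2) True z] by blast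
  then show ?thesis using that[of u] True by auto
next
  case False
  then have "t \<le> s" by simp
  obtain u where u: "u \<in> {t..s}" "- z \<in> closed_segment (left_limit (\<lambda>t. - x t) u) (- x u)"
    by (rule completed_graph_IVT[OF cadlag_minus[OF x] _ \<open>t \<le> s\<close>, of "- z"]) (use assms in auto)
  then have "z \<in> closed_segment (left_limit x u) (x u)"
    using left_limit_uminus[OF x, of u] assms by (auto simp: mem_segment_iff)
  then show ?thesis using that[of u] u False by auto
qed

lemma left_limit_between:
  assumes x: "x \<in> cadlag_paths" and "t \<ge> 0" "d > 0" "\<And>s. s \<ge> 0 \<Longrightarrow> \<bar>s - t\<bar> < d \<Longrightarrow> a \<le> x s \<and> x s \<le> b"
  shows "a \<le> left_limit x t \<and> left_limit x t \<le> b"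
proof (cases "t > 0")
  case True
  have "left_limit x t \<in> {a..b}"
    by (rule left_limit_bounds[OF x True \<open>d > 0\<close>]) (use assms(4) in auto)
  then show ?thesis by simp
next
  case False
  then show ?thesis using assms by (auto simp: left_limit_def)
qed

lemma completed_graph_nonempty: "T \<ge> 0 \<Longrightarrow> completed_graph T x \<noteq> {}"
  unfolding completed_graph_def using ends_in_segment(2) by fastforce

section \<open>Hausdorff distance of completed graphs\<close>

lemma dist_pair_le: "dist (s::real, a::real) (t, b) \<le> \<bar>s - t\<bar> + \<bar>a - b\<bar>"
  using sqrt_sum_squares_le_sum_abs[of "s - t" "a - b"]
  by (simp add: dist_Pair_Pair dist_real_def)

lemma hausdorff_dist_le:
  assumes "A \<noteq> {}" "B \<noteq> {}" "\<And>a. a \<in> A \<Longrightarrow> infdist a B \<le> e" "\<And>b. b \<in> B \<Longrightarrow> infdist b A \<le> e"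
  shows "hausdorff_dist A B \<le> e"
  unfolding hausdorff_dist_def using assms by (auto intro!: cSUP_least)

lemma hausdorff_dist_nonneg:
  assumes "A \<noteq> {}" "bdd_above ((\<lambda>a. infdist a B) ` A)"
  shows "0 \<le> hausdorff_dist A B"
proof -
  obtain a where "a \<in> A" using assms by blast
  then have "0 \<le> (SUP a\<in>A. infdist a B)"
    by (intro cSUP_upper2[OF assms(2)]) (auto simp: infdist_nonneg)
  then show ?thesis by (simp add: hausdorff_dist_def)
qed

text \<open>The suprema in \<open>hausdorff_dist\<close> are taken in the reals and are informative
  only for sets bounded above; bounded graphs ensure this. The bound of the path is taken up to
  \<open>T + 1\<close> so that left limits can be controlled by values within distance 1.\<close>

lemma completed_graph_bounded:
  assumes "x \<in> cadlag_paths"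
  shows "bounded (completed_graph T x)"
proof -
  obtain K where K: "K > 0" "\<And>s. s \<in> {0..T+1} \<Longrightarrow> \<bar>x s\<bar> \<le> K"
    using cadlag_bounded[OF assms] by blast
  have "\<bar>z\<bar> \<le> K" if "t \<in> {0..T}" "z \<in> closed_segment (left_limit x t) (x t)" for t z
  proof -
    have "- K \<le> left_limit x t \<and> left_limit x t \<le> K"
    proof (rule left_limit_between[OF assms, of t 1])
      fix s assume "0 \<le> s" "\<bar>s - t\<bar> < 1"
      then have "\<bar>x s\<bar> \<le> K" using that by (intro K(2)) auto
      then show "- K \<le> x s \<and> x s \<le> K" by linarith
    qed (use that in auto)
    moreover have "\<bar>x t\<bar> \<le> K" using that by (intro K(2)) auto
    ultimately show ?thesis using that(2) unfolding mem_segment_iff by linarith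
  qed
  then have "completed_graph T x \<subseteq> {0..T} \<times> {-K..K}"
    unfolding completed_graph_def by (force simp: abs_le_iff)
  then show ?thesis
    by (rule bounded_subset[OF bounded_Times[OF bounded_closed_interval bounded_closed_interval]])
qed

lemma infdist_bdd:
  assumes "bounded A" "B \<noteq> {}"
  shows "bdd_above ((\<lambda>a. infdist a B) ` A)"
proof -
  obtain b where b: "b \<in> B" using assms by blast
  obtain K where "\<And>a. a \<in> A \<Longrightarrow> dist b a \<le> K" using assms(1) bounded_any_center[of A b] by auto
  then show ?thesis
    by (intro bdd_aboveI[of _ K]) (auto intro: order_trans[OF infdist_le[OF b]] simp: dist_commute)
qed

lemma M2_dist_nonneg:
  assumes "x \<in> cadlag_paths" "T \<ge> 0"
  shows "0 \<le> M2_dist T x y"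
  unfolding M2_dist_def using assms
  by (intro hausdorff_dist_nonneg infdist_bdd completed_graph_bounded completed_graph_nonempty)

lemma M2_dist_infdist:
  assumes "x \<in> cadlag_paths" "y \<in> cadlag_paths" "T \<ge> 0" "p \<in> completed_graph T x"
  shows "infdist p (completed_graph T y) \<le> M2_dist T x y"
  unfolding M2_dist_def hausdorff_dist_def using assms
  by (intro max.coboundedI1 cSUP_upper infdist_bdd completed_graph_bounded completed_graph_nonempty)

lemma M2_dist_commute: "M2_dist T x y = M2_dist T y x"
  by (simp add: M2_dist_def hausdorff_dist_def max.commute)

text \<open>By compactness the claim is local at \<open>t\<close>. Late graphs near \<open>t\<close>
  lie close to the vertical segment of \<open>x\<close> at \<open>t\<close>. Conversely they
  approximate every height of that segment, since they come close to both of its ends and have no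
  gaps in between.\<close>

theorem graph_converges_M2:
  assumes g: "graph_converges xs x" and x: "x \<in> cadlag_paths" and xs: "\<And>n. xs n \<in> cadlag_paths"
  shows "M2_converges xs x"
  unfolding M2_converges_def
proof (intro allI impI)
  fix T :: real assume T: "T > 0" and cont: "isCont x T"
  have gP: "hypo_converges xs x" and gN: "hypo_converges (\<lambda>n t. - xs n t) (\<lambda>t. - x t)"
    using g by (auto simp: graph_converges_def)
  have main: "\<forall>\<^sub>F n in sequentially. M2_dist T (xs n) x \<le> e" if "e > 0" for e
  proof -
    \<comment> \<open>One quarter for the time shift, one for the height error, and two for the
      distance from the segment to the approximating graph.\<close>
    define \<eta> where "\<eta> = e / 4"
    have \<eta>: "\<eta> > 0" using that by (simp add: \<eta>_def)
    let ?G = "completed_graph T"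
    have "\<forall>\<^sub>F n in sequentially. \<forall>s\<in>{0..T}.
        (\<forall>z\<in>closed_segment (left_limit (xs n) s) (xs n s). infdist (s, z) (?G x) \<le> e) \<and>
        (\<forall>z\<in>closed_segment (left_limit x s) (x s). infdist (s, z) (?G (xs n)) \<le> e)"
    proof (rule eventually_uniform_Icc)
      fix t assume t: "t \<in> {0..T}"
      then have t0: "t \<ge> 0" by simp
      define lo hi where "lo = min (left_limit x t) (x t)" and "hi = max (left_limit x t) (x t)"
      obtain d1 where d1: "d1 > 0" and near: "\<forall>\<^sub>F n in sequentially. \<forall>s\<ge>0. \<bar>s - t\<bar> < d1 \<longrightarrow> lo - \<eta> < xs n s \<and> xs n s < hi + \<eta>"
        using graph_converges_near[OF g x t0 \<eta>] unfolding lo_def hi_def by blast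
      obtain d2 where d2: "d2 > 0" "\<And>s. s \<ge> 0 \<Longrightarrow> \<bar>s - t\<bar> < d2 \<Longrightarrow> \<bar>x s - left_limit x t\<bar> < \<eta> \<or> \<bar>x s - x t\<bar> < \<eta>"
        using cadlag_near[OF x t0 \<eta>] by blast
      have x_near: "lo - \<eta> \<le> x s \<and> x s \<le> hi + \<eta>" if "s \<ge> 0" "\<bar>s - t\<bar> < d2" for s
        using d2(2)[OF that] unfolding lo_def hi_def by linarith
      \<comment> \<open>Halving leaves room for the times around \<open>s\<close> that determine the
        left limit at \<open>s\<close>: they lie within \<open>d + d\<close> of
        \<open>t\<close>.\<close>
      define d where "d = min \<eta> (min d1 d2 / 2)"
      have d: "d > 0" "d \<le> \<eta>" "d + d \<le> d1" "d + d \<le> d2"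
        using \<eta> d1 d2(1) by (auto simp: d_def min_def)
      have hits: "\<forall>\<^sub>F n in sequentially. \<forall>z\<in>closed_segment (left_limit x t) (x t).
          \<exists>p\<in>?G (xs n). dist (t, z) p \<le> 2 * \<eta>"
      \<comment> \<open>At the horizon, the times at which the segment is approached could lie
        beyond \<open>T\<close>. Continuity of \<open>x\<close> at \<open>T\<close> shrinks the
        segment to a point, and the value of the sequence at \<open>T\<close> itself is close to
        it.\<close>
      proof (cases "t = T")
        case True
        then have "left_limit x t = x t" using isCont_iff_left_limit[OF x T] cont by simp
        then show ?thesis using near
        proof (elim eventually_mono, intro ballI)
          fix n z assume *: "\<forall>s\<ge>0. \<bar>s - t\<bar> < d1 \<longrightarrow> lo - \<eta> < xs n s \<and> xs n s < hi + \<eta>"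
            and "left_limit x t = x t" "z \<in> closed_segment (left_limit x t) (x t)"
          then have "z = x t" "lo = x t" "hi = x t" by (auto simp: lo_def hi_def)
          moreover have "lo - \<eta> < xs n t \<and> xs n t < hi + \<eta>" using * t0 d1 by auto
          ultimately have "\<bar>z - xs n t\<bar> \<le> \<eta>" by linarith
          then have "dist (t, z) (t, xs n t) \<le> 2 * \<eta>"
            using dist_pair_le[of t z t "xs n t"] \<eta> by linarith
          moreover have "(t, xs n t) \<in> ?G (xs n)" using t by (auto simp: completed_graph_def)
          ultimately show "\<exists>p\<in>?G (xs n). dist (t, z) p \<le> 2 * \<eta>" by blast
        qed
      next
        case False
        \<comment> \<open>Small enough to keep the approaching times within the horizon.\<close>
        define d3 where "d3 = min \<eta> (T - t)"
        have d3: "d3 > 0" "d3 \<le> \<eta>" "d3 \<le> T - t" using \<eta> t False by (auto simp: d3_def)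
        have h1: "\<forall>\<^sub>F n in sequentially. \<exists>s\<ge>0. \<bar>s - t\<bar> < d3 \<and> xs n s > hi - \<eta>"
          using hypo_converges_hit[OF gP x t0 \<eta> d3(1)] by (simp add: hi_def)
        have "max (left_limit (\<lambda>t. - x t) t) (- x t) = - lo"
          unfolding left_limit_uminus[OF x t0] lo_def by simp
        then have h2: "\<forall>\<^sub>F n in sequentially. \<exists>s\<ge>0. \<bar>s - t\<bar> < d3 \<and> - xs n s > - lo - \<eta>"
          using hypo_converges_hit[OF gN cadlag_minus[OF x] t0 \<eta> d3(1)] by simp
        show ?thesis using h1 h2
        proof eventually_elim
          case (elim n)
          obtain b where b: "b \<ge> 0" "\<bar>b - t\<bar> < d3" "xs n b > hi - \<eta>" using elim(1) by blast
          obtain a where a: "a \<ge> 0" "\<bar>a - t\<bar> < d3" "- xs n a > - lo - \<eta>" using elim(2) by blast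
          have pt: "\<exists>p\<in>?G (xs n). dist (t, z) p \<le> 2 * \<eta>"
            if "u \<ge> 0" "\<bar>u - t\<bar> < d3" "z' \<in> closed_segment (left_limit (xs n) u) (xs n u)" "\<bar>z - z'\<bar> \<le> \<eta>" for u z z'
          proof
            show "(u, z') \<in> ?G (xs n)" using that d3 by (auto simp: completed_graph_def)
            show "dist (t, z) (u, z') \<le> 2 * \<eta>"
              using dist_pair_le[of t z u z'] that d3(2) by linarith
          qed
          show ?case
          proof
            fix z assume "z \<in> closed_segment (left_limit x t) (x t)"
            then have z: "lo \<le> z" "z \<le> hi" by (auto simp: mem_segment_iff lo_def hi_def)
            \<comment> \<open>Heights outside the range between the two values reached are within
              \<open>\<eta>\<close> of one of them; heights inside it are attained exactly.\<close>
            consider "z < xs n a" | "z > xs n b" | "xs n a \<le> z" "z \<le> xs n b" by linarith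
            then show "\<exists>p\<in>?G (xs n). dist (t, z) p \<le> 2 * \<eta>"
            proof cases
              case 1
              then show ?thesis using a z by (intro pt[of a "xs n a"]) auto
            next
              case 2
              then show ?thesis using b z by (intro pt[of b "xs n b"]) auto
            next
              case 3
              obtain u where u: "min a b \<le> u" "u \<le> max a b" "z \<in> closed_segment (left_limit (xs n) u) (xs n u)"
                using completed_graph_IVT'[OF xs a(1) b(1) 3] by blast
              have "u \<ge> 0" using u(1) a(1) b(1) by linarith
              moreover have "\<bar>u - t\<bar> < d3" using u(1,2) a(2) b(2) by linarith
              ultimately show ?thesis using u(3) \<eta> by (intro pt[of u z]) auto
            qed
          qed
        qed
      qed
      have "\<forall>\<^sub>F n in sequentially. \<forall>s\<in>{0..T}. \<bar>s - t\<bar> < d \<longrightarrow>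
        (\<forall>z\<in>closed_segment (left_limit (xs n) s) (xs n s). infdist (s, z) (?G x) \<le> e) \<and>
        (\<forall>z\<in>closed_segment (left_limit x s) (x s). infdist (s, z) (?G (xs n)) \<le> e)"
        using near hits
      proof eventually_elim
        case (elim n)
        show ?case
        proof (intro ballI impI conjI)
          fix s z assume s: "s \<in> {0..T}" "\<bar>s - t\<bar> < d"
            and z: "z \<in> closed_segment (left_limit (xs n) s) (xs n s)"
          have *: "lo - \<eta> \<le> xs n r \<and> xs n r \<le> hi + \<eta>" if "r \<ge> 0" "\<bar>r - s\<bar> < d" for r
          proof -
            have "\<bar>r - t\<bar> < d1" using that s d by linarith
            then show ?thesis using elim(1) that(1) by (auto intro: less_imp_le)
          qed
          have "lo - \<eta> \<le> left_limit (xs n) s \<and> left_limit (xs n) s \<le> hi + \<eta>"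
            using left_limit_between[OF xs _ d(1) *] s by simp
          moreover have "lo - \<eta> \<le> xs n s \<and> xs n s \<le> hi + \<eta>" using *[of s] s d by simp
          ultimately have "lo - \<eta> \<le> z" "z \<le> hi + \<eta>" using z unfolding mem_segment_iff by linarith+
          then obtain z' where z': "z' \<in> closed_segment (left_limit x t) (x t)" "\<bar>z - z'\<bar> \<le> \<eta>"
            using closed_segment_nearest[of "left_limit x t" "x t" \<eta> z] \<eta> unfolding lo_def hi_def by auto
          then have "(t, z') \<in> ?G x" using t by (simp add: completed_graph_def)
          moreover have "dist (s, z) (t, z') \<le> e"
            using dist_pair_le[of s z t z'] s z' d \<eta> unfolding \<eta>_def by linarith
          ultimately show "infdist (s, z) (?G x) \<le> e" by (rule infdist_le2)
        next
          fix s z assume s: "s \<in> {0..T}" "\<bar>s - t\<bar> < d"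
            and z: "z \<in> closed_segment (left_limit x s) (x s)"
          have *: "lo - \<eta> \<le> x r \<and> x r \<le> hi + \<eta>" if "r \<ge> 0" "\<bar>r - s\<bar> < d" for r
            by (rule x_near) (use that s d in linarith)+
          have "lo - \<eta> \<le> left_limit x s \<and> left_limit x s \<le> hi + \<eta>"
            using left_limit_between[OF x _ d(1) *] s by simp
          moreover have "lo - \<eta> \<le> x s \<and> x s \<le> hi + \<eta>" using *[of s] s d by simp
          ultimately have "lo - \<eta> \<le> z" "z \<le> hi + \<eta>" using z unfolding mem_segment_iff by linarith+
          then obtain z' where z': "z' \<in> closed_segment (left_limit x t) (x t)" "\<bar>z - z'\<bar> \<le> \<eta>"
            using closed_segment_nearest[of "left_limit x t" "x t" \<eta> z] \<eta> unfolding lo_def hi_def by auto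
          obtain p where p: "p \<in> ?G (xs n)" "dist (t, z') p \<le> 2 * \<eta>" using elim(2) z'(1) by blast
          have "dist (s, z) p \<le> e"
            using dist_triangle[of "(s, z)" p "(t, z')"] dist_pair_le[of s z t z'] s z' d p(2)
            unfolding \<eta>_def by linarith
          with p(1) show "infdist (s, z) (?G (xs n)) \<le> e" by (rule infdist_le2)
        qed
      qed
      then show "\<exists>\<delta>>0. \<forall>\<^sub>F n in sequentially. \<forall>s\<in>{0..T}. \<bar>s - t\<bar> < \<delta> \<longrightarrow>
        (\<forall>z\<in>closed_segment (left_limit (xs n) s) (xs n s). infdist (s, z) (?G x) \<le> e) \<and>
        (\<forall>z\<in>closed_segment (left_limit x s) (x s). infdist (s, z) (?G (xs n)) \<le> e)"
        using d(1) by blast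
    qed
    then show ?thesis
    proof eventually_elim
      case (elim n)
      show ?case unfolding M2_dist_def
      proof (rule hausdorff_dist_le)
        fix p assume "p \<in> ?G (xs n)"
        then show "infdist p (?G x) \<le> e" using elim by (auto simp: completed_graph_def)
      next
        fix p assume "p \<in> ?G x"
        then show "infdist p (?G (xs n)) \<le> e" using elim by (auto simp: completed_graph_def)
      qed (use T in \<open>auto intro!: completed_graph_nonempty\<close>)
    qed
  qed
  show "(\<lambda>n. M2_dist T (xs n) x) \<longlonglongrightarrow> 0"
  proof (rule tendstoI)
    fix e :: real assume "e > 0"
    then have "\<forall>\<^sub>F n in sequentially. M2_dist T (xs n) x \<le> e / 2" by (intro main) simp
    then show "\<forall>\<^sub>F n in sequentially. dist (M2_dist T (xs n) x) 0 < e"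
    proof eventually_elim
      case (elim n)
      then show ?case using M2_dist_nonneg[OF xs, of T n x] T \<open>e > 0\<close> by simp
    qed
  qed
qed

section \<open>Level functionals and their relation to M2 convergence\<close>

lemma arctan_lipschitz: "\<bar>arctan a - arctan b\<bar> \<le> \<bar>a - b\<bar>"
proof -
  have "norm (arctan a - arctan b) \<le> 1 * norm (a - b)"
  proof (rule field_differentiable_bound[of UNIV arctan "\<lambda>x. inverse (1 + x\<^sup>2)"])
    show "norm (inverse (1 + z\<^sup>2)) \<le> (1::real)" for z :: real
      using inverse_le_1_iff[of "1 + z\<^sup>2"] by simp
  qed (auto intro!: derivative_eq_intros)
  then show ?thesis by simp
qed

text \<open>A trapezoid, equal to 1 within \<open>1 / real (Suc j)\<close> of \<open>q\<close> and
  to 0 from distance \<open>2 / real (Suc j)\<close> on. Its Lipschitz continuity absorbs the time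
  shifts permitted by the Hausdorff distance.\<close>

definition window :: "rat \<Rightarrow> nat \<Rightarrow> real \<Rightarrow> real" where
  "window q j t = max 0 (min 1 (2 - \<bar>t - of_rat q\<bar> * real (Suc j)))"

text \<open>
  Only rational times enter, which makes these functionals measurable on the path space; on cadlag
  paths the supremum over all times is the same. The \<open>arctan\<close> keeps them bounded.
\<close>

definition level :: "rat \<Rightarrow> nat \<Rightarrow> (real \<Rightarrow> real) \<Rightarrow> real" where
  "level q j x = (SUP t\<in>{t. t \<ge> 0 \<and> t \<in> \<rat>}. window q j t * (2 + arctan (x t)) / 4)"

lemma window_bounds: "0 \<le> window q j t" "window q j t \<le> 1"
  by (auto simp: window_def)

lemma window_lipschitz: "\<bar>window q j s - window q j t\<bar> \<le> real (Suc j) * \<bar>s - t\<bar>"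
proof -
  have "\<bar>window q j s - window q j t\<bar> \<le> \<bar>\<bar>s - of_rat q\<bar> * real (Suc j) - \<bar>t - of_rat q\<bar> * real (Suc j)\<bar>"
    unfolding window_def by linarith
  also have "\<dots> = real (Suc j) * \<bar>\<bar>s - of_rat q\<bar> - \<bar>t - of_rat q\<bar>\<bar>"
    by (simp add: abs_mult flip: left_diff_distrib)
  also have "\<dots> \<le> real (Suc j) * \<bar>s - t\<bar>" by (intro mult_left_mono) auto
  finally show ?thesis .
qed

lemma window_tendsto:
  assumes "(f \<longlongrightarrow> t) F"
  shows "((\<lambda>s. window q j (f s)) \<longlongrightarrow> window q j t) F"
  unfolding window_def by (intro tendsto_intros assms)

lemma window_pos_iff: "window q j t > 0 \<longleftrightarrow> \<bar>t - of_rat q\<bar> * real (Suc j) < 2"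
  by (auto simp: window_def)

text \<open>The shift 2 exceeds \<open>pi / 2\<close>, so every term inside a window is positive and
  larger than the zeros outside; division by 4 then brings the supremum into the unit
  interval.\<close>

lemma arctan_shift_bounds: "0 < 2 + arctan y" "2 + arctan y < 4"
  using arctan_bounded[of y] pi_less_4 by linarith+

lemma level_term_bounds: "0 \<le> window q j t * (2 + arctan y) / 4" "window q j t * (2 + arctan y) / 4 \<le> 1"
proof -
  have "window q j t * (2 + arctan y) \<le> 1 * 4"
    using window_bounds[of q j t] arctan_shift_bounds[of y] by (intro mult_mono) auto
  then show "window q j t * (2 + arctan y) / 4 \<le> 1" by simp
  show "0 \<le> window q j t * (2 + arctan y) / 4"
    using window_bounds[of q j t] arctan_shift_bounds[of y] by simp
qed

lemma level_bdd: "bdd_above ((\<lambda>t. window q j t * (2 + arctan (x t)) / 4) ` A)"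
  by (rule bdd_aboveI2[of _ _ 1]) (rule level_term_bounds)

lemma level_index_nonempty: "{t::real. t \<ge> 0 \<and> t \<in> \<rat>} \<noteq> {}"
  using Rats_0 by blast

lemma level_bounds: "0 \<le> level q j x" "level q j x \<le> 1"
proof -
  show "0 \<le> level q j x" unfolding level_def
    by (rule cSUP_upper2[OF level_bdd, of 0]) (use level_term_bounds in auto)
  show "level q j x \<le> 1" unfolding level_def
    by (rule cSUP_least[OF level_index_nonempty level_term_bounds(2)])
qed

lemma level_least:
  assumes "\<And>t. t \<ge> 0 \<Longrightarrow> window q j t * (2 + arctan (x t)) / 4 \<le> c"
  shows "level q j x \<le> c"
  unfolding level_def by (rule cSUP_least[OF level_index_nonempty]) (use assms in auto)

lemma level_gtD:
  assumes "c < level q j x"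
  obtains t where "t \<ge> 0" "c < window q j t * (2 + arctan (x t)) / 4"
  using assms level_least[of q j x c] by force

text \<open>A term exceeding the supremum over rational times would, by right-continuity, bring
  along a rational time just to the right with the same excess.\<close>

lemma level_upper:
  assumes x: "x \<in> cadlag_paths" and t: "t \<ge> 0"
  shows "window q j t * (2 + arctan (x t)) / 4 \<le> level q j x"
proof (rule ccontr)
  let ?g = "\<lambda>t. window q j t * (2 + arctan (x t)) / 4"
  assume "\<not> ?thesis"
  then have lt: "level q j x < ?g t" by simp
  have "(x \<longlongrightarrow> x t) (at_right t)"
    using assms by (auto simp: cadlag_paths_def continuous_within)
  then have "(?g \<longlongrightarrow> ?g t) (at_right t)" by (intro tendsto_intros window_tendsto) auto
  then have "\<forall>\<^sub>F s in at_right t. level q j x < ?g s" using lt by (rule order_tendstoD(1))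
  then obtain b where b: "b > t" "\<And>s. s > t \<Longrightarrow> s < b \<Longrightarrow> level q j x < ?g s"
    by (auto simp: eventually_at_right_field)
  obtain s where s: "s \<in> \<rat>" "t < s" "s < b" using Rats_dense_in_real[OF b(1)] by blast
  have "?g s \<le> level q j x" unfolding level_def
    by (rule cSUP_upper[OF _ level_bdd]) (use s t in auto)
  then show False using b(2)[OF s(2,3)] by simp
qed

text \<open>Limit of the bound at earlier times. Together with \<open>level_upper\<close>, the level
  dominates the terms at both ends of each vertical segment, and so at all points of the completed
  graph, which is where the Hausdorff distance leads.\<close>

lemma level_upper_left:
  assumes x: "x \<in> cadlag_paths" and t: "t \<ge> 0"
  shows "window q j t * (2 + arctan (left_limit x t)) / 4 \<le> level q j x"
proof (cases "t > 0")
  case False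
  then show ?thesis using level_upper[OF assms] by (simp add: left_limit_def)
next
  case True
  let ?g = "\<lambda>t. window q j t * (2 + arctan (x t)) / 4"
  have "(?g \<longlongrightarrow> window q j t * (2 + arctan (left_limit x t)) / 4) (at_left t)"
    by (intro tendsto_intros window_tendsto left_limit_tendsto x True) auto
  moreover have "\<forall>\<^sub>F s in at_left t. ?g s \<le> level q j x"
    unfolding eventually_at_left_field
    by (rule exI[of _ 0]) (use True level_upper[OF x] in auto)
  ultimately show ?thesis
    by (rule tendsto_upperbound) (simp add: trivial_limit_at_left_real)
qed

text \<open>The horizon covers the whole window, whose half-width is at most 2. Moving to a nearby
  graph point changes the window by at most its Lipschitz constant \<open>real (Suc j)\<close> times
  the distance and the \<open>arctan\<close> term by at most the distance, whence the
  factor.\<close>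

lemma level_M2_dist:
  assumes x: "x \<in> cadlag_paths" and y: "y \<in> cadlag_paths" and T: "T > 0" "T \<ge> of_rat q + 2"
    and d: "M2_dist T x y < d"
  shows "level q j x \<le> level q j y + (real (Suc j) + 1) * d"
proof (rule level_least)
  have d0: "d > 0" using M2_dist_nonneg[OF x, of T y] T d by linarith
  fix t :: real assume t: "t \<ge> 0"
  show "window q j t * (2 + arctan (x t)) / 4 \<le> level q j y + (real (Suc j) + 1) * d"
  proof (cases "t \<le> T")
    case False
    then have "2 * 1 \<le> \<bar>t - of_rat q\<bar> * real (Suc j)" using T by (intro mult_mono) auto
    then have "window q j t = 0" by (simp add: window_def)
    then show ?thesis using level_bounds(1)[of q j y] d0 by simp
  next
    case True
    have "(t, x t) \<in> completed_graph T x" using t True by (simp add: completed_graph_def)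
    from M2_dist_infdist[OF x y _ this] have "infdist (t, x t) (completed_graph T y) < d" using T d by simp
    moreover have ne: "completed_graph T y \<noteq> {}" using T by (intro completed_graph_nonempty) simp
    ultimately obtain p where p: "p \<in> completed_graph T y" "dist (t, x t) p < d"
      unfolding infdist_notempty[OF ne] by (subst (asm) cINF_less_iff) (auto intro: bdd_belowI[of _ 0])
    obtain s z where sz: "p = (s, z)" "s \<ge> 0" "z \<in> closed_segment (left_limit y s) (y s)"
      using p(1) by (auto simp: completed_graph_def)
    have ds: "\<bar>t - s\<bar> \<le> d" "\<bar>x t - z\<bar> \<le> d"
      using p(2) dist_fst_le[of "(t, x t)" p] dist_snd_le[of "(t, x t)" p] sz(1)
      by (auto simp: dist_real_def)
    have "window q j s * (2 + arctan z) / 4 \<le> level q j y"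
    \<comment> \<open>A point of the vertical segment lies at or below one of its ends, and
      \<open>arctan\<close> is monotone.\<close>
    proof (cases "z \<le> y s")
      case True
      then have "window q j s * (2 + arctan z) / 4 \<le> window q j s * (2 + arctan (y s)) / 4"
        using window_bounds[of q j s] by (intro divide_right_mono mult_left_mono) (auto simp: arctan_monotone')
      then show ?thesis using level_upper[OF y sz(2), of q j] by linarith
    next
      case False
      then have "z \<le> left_limit y s" using sz(3) unfolding mem_segment_iff by linarith
      then have "window q j s * (2 + arctan z) / 4 \<le> window q j s * (2 + arctan (left_limit y s)) / 4"
        using window_bounds[of q j s] by (intro divide_right_mono mult_left_mono) (auto simp: arctan_monotone')
      then show ?thesis using level_upper_left[OF y sz(2), of q j] by linarith
    qed
    moreover have "window q j t * (2 + arctan (x t)) \<le> window q j s * (2 + arctan z) + 4 * ((real (Suc j) + 1) * d)"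
    proof -
      have "window q j t * (2 + arctan (x t)) - window q j s * (2 + arctan z)
          = (window q j t - window q j s) * (2 + arctan (x t)) + window q j s * (arctan (x t) - arctan z)"
        by (simp add: algebra_simps)
      also have "\<dots> \<le> (real (Suc j) * d) * 4 + 1 * d"
      proof (rule add_mono)
        have "\<bar>window q j t - window q j s\<bar> \<le> real (Suc j) * \<bar>t - s\<bar>" by (rule window_lipschitz)
        also have "\<dots> \<le> real (Suc j) * d" using ds by (intro mult_left_mono) auto
        finally have "window q j t - window q j s \<le> real (Suc j) * d" by linarith
        then have "(window q j t - window q j s) * (2 + arctan (x t)) \<le> (real (Suc j) * d) * (2 + arctan (x t))"
          using arctan_shift_bounds[of "x t"] by (intro mult_right_mono) auto
        also have "\<dots> \<le> (real (Suc j) * d) * 4"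
          using arctan_shift_bounds[of "x t"] d0 by (intro mult_left_mono) auto
        finally show "(window q j t - window q j s) * (2 + arctan (x t)) \<le> (real (Suc j) * d) * 4" .
        have "window q j s * (arctan (x t) - arctan z) \<le> window q j s * d"
          using arctan_lipschitz[of "x t" z] ds window_bounds[of q j s] by (intro mult_left_mono) linarith+
        also have "\<dots> \<le> 1 * d" using window_bounds[of q j s] d0 by (intro mult_right_mono) auto
        finally show "window q j s * (arctan (x t) - arctan z) \<le> 1 * d" .
      qed
      finally show ?thesis using d0 by (simp add: algebra_simps)
    qed
    ultimately show ?thesis by linarith
  qed
qed

lemma level_M2_converges:
  assumes x: "x \<in> cadlag_paths" and xs: "\<And>n. xs n \<in> cadlag_paths" and c: "M2_converges xs x"
  shows "(\<lambda>n. level q j (xs n)) \<longlonglongrightarrow> level q j x"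
proof -
  obtain T where T: "T > of_rat q + 2" "T > 0" "isCont x T" using cadlag_continuity_point[OF x] by blast
  have lim: "(\<lambda>n. M2_dist T (xs n) x) \<longlonglongrightarrow> 0" using c T by (simp add: M2_converges_def)
  show ?thesis
  proof (rule tendstoI)
    fix e :: real assume e: "e > 0"
    define c where "c = real (Suc j) + 1"
    define d where "d = e / (2 * c)"
    have "c > 0" by (simp add: c_def)
    then have d: "d > 0" "c * d < e" using e by (auto simp: d_def)
    have "\<forall>\<^sub>F n in sequentially. M2_dist T (xs n) x < d" using lim d(1) by (rule order_tendstoD(2))
    then show "\<forall>\<^sub>F n in sequentially. dist (level q j (xs n)) (level q j x) < e"
    proof eventually_elim
      case (elim n)
      have "level q j (xs n) \<le> level q j x + c * d"
        unfolding c_def by (rule level_M2_dist[OF xs x _ _ elim]) (use T in auto)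
      moreover have "level q j x \<le> level q j (xs n) + c * d"
        unfolding c_def by (rule level_M2_dist[OF x xs]) (use T elim in \<open>auto simp: M2_dist_commute\<close>)
      ultimately show ?case using d(2) by (simp add: dist_real_def)
    qed
  qed
qed

text \<open>The supremum is read in two ways. If \<open>x \<le> c\<close> on a window, its level is
  below the one belonging to \<open>c + e\<close>, and the values of late paths on the plateau of
  the window inherit this bound. Conversely the level is at least the one belonging to
  \<open>x t\<close>, so late paths come close to this height somewhere in the window.\<close>

lemma hypo_converges_of_levels:
  assumes x: "x \<in> cadlag_paths" and xs: "\<And>n. xs n \<in> cadlag_paths"
    and signed_level: "\<And>q j. (\<lambda>n. level q j (xs n)) \<longlonglongrightarrow> level q j x"
  shows "hypo_converges xs x"
proof -
  \<comment> \<open>With \<open>1/2\<close> the time \<open>t\<close> is well inside the plateau, so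
    that all times within \<open>1 / (2 * real (Suc j))\<close> of \<open>t\<close> still have
    window value 1; the fourth of \<open>\<delta>\<close> keeps the whole support within
    \<open>\<delta>\<close> of \<open>t\<close>.\<close>
  have pick: "\<exists>q j. \<bar>t - of_rat q\<bar> * real (Suc j) < 1/2 \<and> (\<forall>s. window q j s > 0 \<longrightarrow> \<bar>s - t\<bar> < \<delta>)"
    if \<delta>: "\<delta> > 0" for t \<delta> :: real
  proof -
    obtain j where j: "inverse (real (Suc j)) < \<delta> / 4" using reals_Archimedean[of "\<delta> / 4"] \<delta> by auto
    define r where "r = inverse (real (Suc j))"
    have r: "r > 0" "r * real (Suc j) = 1" by (auto simp: r_def)
    obtain q where q: "t < of_rat q" "of_rat q < t + r / 2" using of_rat_dense[of t "t + r / 2"] r by auto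
    have "\<bar>t - of_rat q\<bar> * real (Suc j) < r / 2 * real (Suc j)"
      using q by (intro mult_strict_right_mono) auto
    then have "\<bar>t - of_rat q\<bar> * real (Suc j) < 1 / 2"
      using r(2) by (simp only: times_divide_eq_left)
    moreover have "\<bar>s - t\<bar> < \<delta>" if "window q j s > 0" for s
    proof -
      have "\<bar>s - of_rat q\<bar> * real (Suc j) < (2 * r) * real (Suc j)"
        using that r(2) unfolding window_pos_iff by (simp only: mult.assoc)
      then have "\<bar>s - of_rat q\<bar> < 2 * r" by (rule mult_right_less_imp_less) simp
      then show ?thesis using q j unfolding r_def[symmetric] by linarith
    qed
    ultimately show ?thesis by blast
  qed
  show ?thesis
    unfolding hypo_converges_def
  proof (intro conjI allI impI)
    fix t c \<delta> e :: real
    assume t: "0 \<le> t" and \<delta>: "0 < \<delta>" and e: "0 < e" and up: "\<forall>s\<ge>0. \<bar>s - t\<bar> < \<delta> \<longrightarrow> x s \<le> c"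
    obtain q j where qj: "\<bar>t - of_rat q\<bar> * real (Suc j) < 1/2" "\<forall>s. window q j s > 0 \<longrightarrow> \<bar>s - t\<bar> < \<delta>"
      using pick[OF \<delta>] by blast
    have "level q j x \<le> (2 + arctan c) / 4"
    proof (rule level_least)
      fix s :: real assume s: "s \<ge> 0"
      show "window q j s * (2 + arctan (x s)) / 4 \<le> (2 + arctan c) / 4"
      proof (cases "window q j s > 0")
        case True
        then have "x s \<le> c" using qj(2) up s by blast
        then have "window q j s * (2 + arctan (x s)) \<le> 1 * (2 + arctan c)"
          using window_bounds[of q j s] arctan_shift_bounds[of "x s"]
          by (intro mult_mono) (auto simp: arctan_monotone')
        then show ?thesis by simp
      next
        case False
        then have "window q j s = 0" using window_bounds[of q j s] by linarith
        then show ?thesis using arctan_shift_bounds[of c] by simp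
      qed
    qed
    also have "\<dots> < (2 + arctan (c + e)) / 4" using e by (simp add: arctan_less_iff)
    finally have "\<forall>\<^sub>F n in sequentially. level q j (xs n) < (2 + arctan (c + e)) / 4"
      by (rule order_tendstoD(2)[OF signed_level])
    then have "\<forall>\<^sub>F n in sequentially. \<forall>s\<ge>0. \<bar>s - t\<bar> < inverse (2 * real (Suc j)) \<longrightarrow> xs n s < c + e"
    proof eventually_elim
      case (elim n)
      show ?case
      proof (intro allI impI)
        fix s assume s: "0 \<le> s" "\<bar>s - t\<bar> < inverse (2 * real (Suc j))"
        have "\<bar>s - t\<bar> * real (Suc j) < inverse (2 * real (Suc j)) * real (Suc j)"
          using s by (intro mult_strict_right_mono) auto
        also have "inverse (2 * real (Suc j)) * real (Suc j) = 1/2" by (simp del: of_nat_Suc)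
        finally have "\<bar>s - t\<bar> * real (Suc j) < 1/2" .
        moreover have "\<bar>s - of_rat q\<bar> * real (Suc j) \<le> (\<bar>s - t\<bar> + \<bar>t - of_rat q\<bar>) * real (Suc j)"
          by (intro mult_right_mono) auto
        ultimately have "\<bar>s - of_rat q\<bar> * real (Suc j) < 1"
          using qj(1) unfolding distrib_right by linarith
        then have "window q j s = 1" by (simp add: window_def)
        then have "(2 + arctan (xs n s)) / 4 \<le> level q j (xs n)"
          using level_upper[OF xs s(1), of q j n] by simp
        then have "arctan (xs n s) < arctan (c + e)" using elim by simp
        then show "xs n s < c + e" by (simp add: arctan_less_iff)
      qed
    qed
    then show "\<exists>\<delta>'>0. \<forall>\<^sub>F n in sequentially. \<forall>s\<ge>0. \<bar>s - t\<bar> < \<delta>' \<longrightarrow> xs n s < c + e"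
      by (intro exI[of _ "inverse (2 * real (Suc j))"]) simp
  next
    fix t e \<delta> :: real
    assume t: "0 \<le> t" and e: "0 < e" and \<delta>: "0 < \<delta>"
    obtain q j where qj: "\<bar>t - of_rat q\<bar> * real (Suc j) < 1/2" "\<forall>s. window q j s > 0 \<longrightarrow> \<bar>s - t\<bar> < \<delta>"
      using pick[OF \<delta>] by blast
    have "window q j t = 1" using qj(1) by (simp add: window_def)
    then have "(2 + arctan (x t)) / 4 \<le> level q j x" using level_upper[OF x t, of q j] by simp
    moreover have "(2 + arctan (x t - e)) / 4 < (2 + arctan (x t)) / 4" using e by (simp add: arctan_less_iff)
    ultimately have "(2 + arctan (x t - e)) / 4 < level q j x" by linarith
    then have "\<forall>\<^sub>F n in sequentially. (2 + arctan (x t - e)) / 4 < level q j (xs n)"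
      by (rule order_tendstoD(1)[OF signed_level])
    then show "\<forall>\<^sub>F n in sequentially. \<exists>s\<ge>0. \<bar>s - t\<bar> < \<delta> \<and> x t - e < xs n s"
    proof eventually_elim
      case (elim n)
      then obtain s where s: "s \<ge> 0" "(2 + arctan (x t - e)) / 4 < window q j s * (2 + arctan (xs n s)) / 4"
        by (rule level_gtD)
      have "2 + arctan (x t - e) < window q j s * (2 + arctan (xs n s))" using s(2) by simp
      also have "\<dots> \<le> 1 * (2 + arctan (xs n s))"
        using window_bounds[of q j s] arctan_shift_bounds[of "xs n s"] by (intro mult_right_mono) auto
      finally have "arctan (x t - e) < arctan (xs n s)" by simp
      \<comment> \<open>Where the window vanishes the term is 0, while the term for
        \<open>x t - e\<close> is positive; hence \<open>s\<close> lies in the support and is close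
        to \<open>t\<close>.\<close>
      moreover have "window q j s > 0"
      proof (rule ccontr)
        assume "\<not> window q j s > 0"
        then have "window q j s = 0" using window_bounds[of q j s] by linarith
        then show False using s(2) arctan_shift_bounds[of "x t - e"] by simp
      qed
      ultimately show ?case using s(1) qj(2) by (auto simp: arctan_less_iff)
    qed
  qed
qed

section \<open>Locally uniform convergence and approximation by step paths\<close>

lemma hypo_converges_uniform:
  assumes u: "\<And>T e. e > 0 \<Longrightarrow> \<forall>\<^sub>F n in sequentially. \<forall>s\<in>{0..T}. \<bar>xs n s - x s\<bar> < e"
  shows "hypo_converges xs x"
  unfolding hypo_converges_def
proof (intro conjI allI impI)
  fix t c \<delta> e :: real
  assume t: "0 \<le> t" and \<delta>: "0 < \<delta>" and e: "0 < e" and up: "\<forall>s\<ge>0. \<bar>s - t\<bar> < \<delta> \<longrightarrow> x s \<le> c"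
  have "\<forall>\<^sub>F n in sequentially. \<forall>s\<ge>0. \<bar>s - t\<bar> < \<delta> \<longrightarrow> xs n s < c + e"
    using u[OF e, of "t + \<delta>"]
  proof eventually_elim
    case (elim n)
    show ?case
    proof (intro allI impI)
      fix s assume s: "0 \<le> s" "\<bar>s - t\<bar> < \<delta>"
      then have "\<bar>xs n s - x s\<bar> < e" using elim by auto
      moreover have "x s \<le> c" using up s by blast
      ultimately show "xs n s < c + e" by linarith
    qed
  qed
  then show "\<exists>\<delta>'>0. \<forall>\<^sub>F n in sequentially. \<forall>s\<ge>0. \<bar>s - t\<bar> < \<delta>' \<longrightarrow> xs n s < c + e"
    using \<delta> by blast
next
  fix t e \<delta> :: real
  assume t: "0 \<le> t" and e: "0 < e" and \<delta>: "0 < \<delta>"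
  show "\<forall>\<^sub>F n in sequentially. \<exists>s\<ge>0. \<bar>s - t\<bar> < \<delta> \<and> x t - e < xs n s"
    using u[OF e, of t]
  proof eventually_elim
    case (elim n)
    then have "\<bar>xs n t - x t\<bar> < e" using t by simp
    then show ?case using t \<delta> by (intro exI[of _ t]) auto
  qed
qed

lemma graph_converges_uniform:
  assumes u: "\<And>T e. e > 0 \<Longrightarrow> \<forall>\<^sub>F n in sequentially. \<forall>s\<in>{0..T}. \<bar>xs n s - x s\<bar> < e"
  shows "graph_converges xs x"
  unfolding graph_converges_def
proof
  show "hypo_converges xs x" by (rule hypo_converges_uniform[OF u])
  have "\<forall>\<^sub>F n in sequentially. \<forall>s\<in>{0..T}. \<bar>- xs n s - - x s\<bar> < e" if "e > 0" for T e
    using u[OF that, of T] by (simp add: abs_minus_commute)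
  then show "hypo_converges (\<lambda>n t. - xs n t) (\<lambda>t. - x t)" by (rule hypo_converges_uniform)
qed

text \<open>A cadlag path encoded by a sequence of reals. Composition with it turns a functional on
  paths into a function of countably many real variables.\<close>

definition step_path :: "nat \<Rightarrow> (nat \<Rightarrow> real) \<Rightarrow> real \<Rightarrow> real" where
  "step_path n a t = a (nat \<lfloor>t * real (Suc n)\<rfloor>)"

lemma step_path_cadlag: "step_path n a \<in> cadlag_paths"
proof -
  define N where "N = real (Suc n)"
  have N: "N > 0" by (simp add: N_def)
  have "(step_path n a \<longlongrightarrow> step_path n a t) (at_right t)" for t
  proof (rule tendsto_eventually)
    have "t * N < of_int \<lfloor>t * N\<rfloor> + 1" by linarith
    then have "t < (of_int \<lfloor>t * N\<rfloor> + 1) / N" using N by (simp add: pos_less_divide_eq)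
    moreover have "step_path n a s = step_path n a t" if "s > t" "s < (of_int \<lfloor>t * N\<rfloor> + 1) / N" for s
    proof -
      have "t * N \<le> s * N" "s * N < of_int \<lfloor>t * N\<rfloor> + 1" using that N by (auto simp: field_simps)
      then have "\<lfloor>s * N\<rfloor> = \<lfloor>t * N\<rfloor>" by linarith
      then show ?thesis unfolding step_path_def N_def by simp
    qed
    ultimately show "\<forall>\<^sub>F s in at_right t. step_path n a s = step_path n a t"
      unfolding eventually_at_right_field by blast
  qed
  \<comment> \<open>Just before \<open>t\<close> the index is
    \<open>\<lceil>t * N\<rceil> - 1\<close>; the floor at \<open>t\<close> would be too large by
    one exactly at the grid times.\<close>
  moreover have "(step_path n a \<longlongrightarrow> a (nat (\<lceil>t * N\<rceil> - 1))) (at_left t)" for t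
  proof (rule tendsto_eventually)
    have "of_int \<lceil>t * N\<rceil> - 1 < t * N" by linarith
    then have "(of_int \<lceil>t * N\<rceil> - 1) / N < t" using N by (simp add: pos_divide_less_eq)
    moreover have "step_path n a s = a (nat (\<lceil>t * N\<rceil> - 1))" if "s < t" "(of_int \<lceil>t * N\<rceil> - 1) / N < s" for s
    proof -
      have "s * N < t * N" "of_int \<lceil>t * N\<rceil> - 1 < s * N" using that N by (auto simp: field_simps)
      then have "\<lfloor>s * N\<rfloor> = \<lceil>t * N\<rceil> - 1" by linarith
      then show ?thesis unfolding step_path_def N_def by simp
    qed
    ultimately show "\<forall>\<^sub>F s in at_left t. step_path n a s = a (nat (\<lceil>t * N\<rceil> - 1))"
      unfolding eventually_at_left_field by blast
  qed
  ultimately show ?thesis unfolding cadlag_paths_def continuous_within by auto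
qed

lemma hypo_converges_step_path:
  assumes x: "x \<in> cadlag_paths"
  shows "hypo_converges (\<lambda>n. step_path n (\<lambda>k. x (real k / real (Suc n)))) x"
  unfolding hypo_converges_def
proof (intro conjI allI impI)
  fix t c \<delta> e :: real
  assume t: "0 \<le> t" and \<delta>: "0 < \<delta>" and e: "0 < e" and up: "\<forall>s\<ge>0. \<bar>s - t\<bar> < \<delta> \<longrightarrow> x s \<le> c"
  have "\<forall>\<^sub>F n in sequentially. inverse (real (Suc n)) < \<delta> / 2"
    using LIMSEQ_inverse_real_of_nat by (rule order_tendstoD(2)) (use \<delta> in simp)
  then have "\<forall>\<^sub>F n in sequentially. \<forall>s\<ge>0. \<bar>s - t\<bar> < \<delta> / 2 \<longrightarrow> step_path n (\<lambda>k. x (real k / real (Suc n))) s < c + e"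
  proof eventually_elim
    case (elim n)
    show ?case
    proof (intro allI impI)
      fix s assume s: "0 \<le> s" "\<bar>s - t\<bar> < \<delta> / 2"
      define N where "N = real (Suc n)"
      have N: "N > 0" by (simp add: N_def)
      \<comment> \<open>The grid time sampled at \<open>s\<close>: not later than \<open>s\<close>,
        and earlier by less than one mesh.\<close>
      define g where "g = real (nat \<lfloor>s * N\<rfloor>) / N"
      have "real (nat \<lfloor>s * N\<rfloor>) = of_int \<lfloor>s * N\<rfloor>" using s N by simp
      then have "real (nat \<lfloor>s * N\<rfloor>) \<le> s * N" "s * N < real (nat \<lfloor>s * N\<rfloor>) + 1" by linarith+
      then have "g \<le> s" "s < g + inverse N" using N by (auto simp: g_def field_simps)
      then have "\<bar>g - t\<bar> < \<delta>" using s elim unfolding N_def[symmetric] by linarith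
      moreover have "g \<ge> 0" using N by (simp add: g_def)
      ultimately have "x g \<le> c" using up by blast
      then show "step_path n (\<lambda>k. x (real k / real (Suc n))) s < c + e"
        using e unfolding step_path_def g_def N_def by simp
    qed
  qed
  then show "\<exists>\<delta>'>0. \<forall>\<^sub>F n in sequentially. \<forall>s\<ge>0. \<bar>s - t\<bar> < \<delta>' \<longrightarrow> step_path n (\<lambda>k. x (real k / real (Suc n))) s < c + e"
    using \<delta> half_gt_zero by blast
next
  fix t e \<delta> :: real
  assume t: "0 \<le> t" and e: "0 < e" and \<delta>: "0 < \<delta>"
  obtain b where b: "b > 0" "\<And>s. t \<le> s \<Longrightarrow> s < t + b \<Longrightarrow> \<bar>x s - x t\<bar> < e"
    using cadlag_right[OF x t e] by blast
  have "\<forall>\<^sub>F n in sequentially. inverse (real (Suc n)) < min b \<delta>"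
    using LIMSEQ_inverse_real_of_nat by (rule order_tendstoD(2)) (use \<delta> b in simp)
  then show "\<forall>\<^sub>F n in sequentially. \<exists>s\<ge>0. \<bar>s - t\<bar> < \<delta> \<and> x t - e < step_path n (\<lambda>k. x (real k / real (Suc n))) s"
  proof eventually_elim
    case (elim n)
    define N where "N = real (Suc n)"
    have N: "N > 0" by (simp add: N_def)
    \<comment> \<open>A grid time at or after \<open>t\<close>, where right-continuity controls the
      value. The cell containing \<open>t\<close> is sampled at or before \<open>t\<close>, possibly
      near the left limit.\<close>
    define k where "k = nat \<lceil>t * N\<rceil>"
    have "real k = of_int \<lceil>t * N\<rceil>" using t N by (simp add: k_def)
    then have "t * N \<le> real k" "real k < t * N + 1" by linarith+
    then have g: "t \<le> real k / N" "real k / N < t + inverse N" using N by (auto simp: field_simps)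
    have "step_path n (\<lambda>k. x (real k / real (Suc n))) (real k / N) = x (real k / N)"
      using N unfolding step_path_def N_def[symmetric] by simp
    moreover have "\<bar>x (real k / N) - x t\<bar> < e"
      using g elim unfolding N_def[symmetric] by (intro b(2)) auto
    ultimately show ?case
      using g elim t unfolding N_def[symmetric] by (intro exI[of _ "real k / N"]) auto
  qed
qed

lemma graph_converges_step_path:
  assumes x: "x \<in> cadlag_paths"
  shows "graph_converges (\<lambda>n. step_path n (\<lambda>k. x (real k / real (Suc n)))) x"
  using hypo_converges_step_path[OF x] hypo_converges_step_path[OF cadlag_minus[OF x]]
  unfolding graph_converges_def step_path_def by blast

text \<open>On a bounded interval a step path uses only finitely many entries, so convergence of the
  entries is uniform there.\<close>

lemma graph_converges_step_arg:
  assumes a: "\<And>k. (\<lambda>i. as i k) \<longlonglongrightarrow> a k"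
  shows "graph_converges (\<lambda>i. step_path n (as i)) (step_path n a)"
proof (rule graph_converges_uniform)
  fix T e :: real assume e: "e > 0"
  define K where "K = nat \<lfloor>T * real (Suc n)\<rfloor>"
  have "\<forall>\<^sub>F i in sequentially. \<forall>k\<in>{..K}. \<bar>as i k - a k\<bar> < e"
    using tendstoD[OF a e] by (intro eventually_ball_finite) (auto simp: dist_real_def)
  then show "\<forall>\<^sub>F i in sequentially. \<forall>s\<in>{0..T}. \<bar>step_path n (as i) s - step_path n a s\<bar> < e"
  proof eventually_elim
    case (elim i)
    show ?case
    proof
      fix s assume "s \<in> {0..T}"
      then have "nat \<lfloor>s * real (Suc n)\<rfloor> \<le> K"
        unfolding K_def by (intro nat_mono floor_mono mult_right_mono) auto
      then show "\<bar>step_path n (as i) s - step_path n a s\<bar> < e" using elim by (simp add: step_path_def)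
    qed
  qed
qed

section \<open>Sums and positive multiples under graph convergence\<close>

lemma continuous_within_nonneg:
  fixes x :: "real \<Rightarrow> real"
  assumes "continuous (at t within {0..}) x" "t \<ge> 0" "e > 0"
  obtains \<delta> where "\<delta> > 0" "\<And>s. s \<ge> 0 \<Longrightarrow> \<bar>s - t\<bar> < \<delta> \<Longrightarrow> \<bar>x s - x t\<bar> < e"
proof -
  obtain d where "d > 0" "\<forall>s\<in>{0..}. dist s t < d \<longrightarrow> dist (x s) (x t) < e"
    using assms(1,3) unfolding continuous_within_eps_delta by blast
  then show ?thesis by (intro that[of d]) (auto simp: dist_real_def)
qed

text \<open>Relative to nonnegative times, right-continuity at 0 is continuity, so time 0 never
  counts as a jump. This is the reason for continuity within \<open>{0..}\<close> in the statements
  on sums.\<close>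

lemma cadlag_continuous_at_0:
  assumes "x \<in> cadlag_paths"
  shows "continuous (at 0 within {0..}) x"
proof -
  have "continuous (at_right 0) x" using assms by (auto simp: cadlag_paths_def)
  then show ?thesis by (simp add: continuous_within at_within_Ici_at_right)
qed

lemma graph_converges_continuous_point:
  assumes g: "graph_converges xs x" and c: "continuous (at t within {0..}) x" and t: "t \<ge> 0" and e: "e > 0"
  obtains \<delta> where "\<delta> > 0" "\<forall>\<^sub>F n in sequentially. \<forall>s\<ge>0. \<bar>s - t\<bar> < \<delta> \<longrightarrow> \<bar>xs n s - x t\<bar> < e"
proof -
  have e2: "e / 2 > 0" using e by simp
  have gP: "hypo_converges xs x" and gN: "hypo_converges (\<lambda>n t. - xs n t) (\<lambda>t. - x t)"
    using g by (auto simp: graph_converges_def)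
  obtain d where d: "d > 0" "\<And>s. s \<ge> 0 \<Longrightarrow> \<bar>s - t\<bar> < d \<Longrightarrow> \<bar>x s - x t\<bar> < e / 2"
    using continuous_within_nonneg[OF c t e2] by blast
  have up: "x s \<le> x t + e / 2" and lo: "- x s \<le> - x t + e / 2" if "s \<ge> 0" "\<bar>s - t\<bar> < d" for s
    using d(2)[OF that] by linarith+
  obtain d1 where d1: "d1 > 0" "\<forall>\<^sub>F n in sequentially. \<forall>s\<ge>0. \<bar>s - t\<bar> < d1 \<longrightarrow> xs n s < x t + e / 2 + e / 2"
    using hypo_convergesD1[OF gP t d(1) up e2] by blast
  obtain d2 where d2: "d2 > 0" "\<forall>\<^sub>F n in sequentially. \<forall>s\<ge>0. \<bar>s - t\<bar> < d2 \<longrightarrow> - xs n s < - x t + e / 2 + e / 2"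
    using hypo_convergesD1[OF gN t d(1) lo e2] by blast
  show ?thesis
  proof (rule that[of "min d1 d2"])
    show "\<forall>\<^sub>F n in sequentially. \<forall>s\<ge>0. \<bar>s - t\<bar> < min d1 d2 \<longrightarrow> \<bar>xs n s - x t\<bar> < e"
      using d1(2) d2(2)
    proof eventually_elim
      case (elim n)
      show ?case
      proof (intro allI impI)
        fix s assume s: "0 \<le> s" "\<bar>s - t\<bar> < min d1 d2"
        have "xs n s < x t + e / 2 + e / 2" "- xs n s < - x t + e / 2 + e / 2" using elim s by auto
        then show "\<bar>xs n s - x t\<bar> < e" by linarith
      qed
    qed
  qed (use d1 d2 in auto)
qed

lemma graph_converges_uminus:
  "graph_converges xs x \<Longrightarrow> graph_converges (\<lambda>n t. - xs n t) (\<lambda>t. - x t)"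
  by (simp add: graph_converges_def)

text \<open>Near a continuity point of \<open>y\<close> all late \<open>ys n\<close> are close to
  the constant \<open>y t\<close>, so the sum is locally a vertical shift of \<open>xs n\<close>.
  For \<open>x\<close> one half of graph convergence is enough, while \<open>ys\<close> must be
  controlled from both sides.\<close>

lemma hypo_add_clauses:
  assumes h: "hypo_converges xs x" and g: "graph_converges ys y"
    and c: "continuous (at t within {0..}) y" and t: "t \<ge> 0"
  shows "0 < \<delta> \<Longrightarrow> 0 < e \<Longrightarrow> \<forall>s\<ge>0. \<bar>s - t\<bar> < \<delta> \<longrightarrow> x s + y s \<le> c \<Longrightarrow>
      \<exists>\<delta>'>0. \<forall>\<^sub>F n in sequentially. \<forall>s\<ge>0. \<bar>s - t\<bar> < \<delta>' \<longrightarrow> xs n s + ys n s < c + e"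
    and "0 < \<delta> \<Longrightarrow> 0 < e \<Longrightarrow>
      \<forall>\<^sub>F n in sequentially. \<exists>s\<ge>0. \<bar>s - t\<bar> < \<delta> \<and> x t + y t - e < xs n s + ys n s"
proof -
  assume \<delta>: "0 < \<delta>" and e: "0 < e" and up: "\<forall>s\<ge>0. \<bar>s - t\<bar> < \<delta> \<longrightarrow> x s + y s \<le> c"
  have e3: "e / 3 > 0" using e by simp
  obtain d where d: "d > 0" "\<And>s. s \<ge> 0 \<Longrightarrow> \<bar>s - t\<bar> < d \<Longrightarrow> \<bar>y s - y t\<bar> < e / 3"
    using continuous_within_nonneg[OF assms(3) t e3] by blast
  have xup: "x s \<le> c - y t + e / 3" if s: "s \<ge> 0" "\<bar>s - t\<bar> < min d \<delta>" for s
  proof -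
    have "x s + y s \<le> c" using up s by auto
    moreover have "\<bar>y s - y t\<bar> < e / 3" using d(2) s by auto
    ultimately show ?thesis by linarith
  qed
  have dd: "min d \<delta> > 0" using d \<delta> by simp
  obtain d1 where d1: "d1 > 0" "\<forall>\<^sub>F n in sequentially. \<forall>s\<ge>0. \<bar>s - t\<bar> < d1 \<longrightarrow> xs n s < c - y t + e / 3 + e / 3"
    using hypo_convergesD1[OF h t dd xup e3] by blast
  obtain d2 where d2: "d2 > 0" "\<forall>\<^sub>F n in sequentially. \<forall>s\<ge>0. \<bar>s - t\<bar> < d2 \<longrightarrow> \<bar>ys n s - y t\<bar> < e / 3"
    using graph_converges_continuous_point[OF g assms(3) t e3] by blast
  have "\<forall>\<^sub>F n in sequentially. \<forall>s\<ge>0. \<bar>s - t\<bar> < min d1 d2 \<longrightarrow> xs n s + ys n s < c + e"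
    using d1(2) d2(2)
  proof eventually_elim
    case (elim n)
    show ?case
    proof (intro allI impI)
      fix s assume s: "0 \<le> s" "\<bar>s - t\<bar> < min d1 d2"
      have "xs n s < c - y t + e / 3 + e / 3" "\<bar>ys n s - y t\<bar> < e / 3" using elim s by auto
      then show "xs n s + ys n s < c + e" by linarith
    qed
  qed
  moreover have "min d1 d2 > 0" using d1 d2 by simp
  ultimately show "\<exists>\<delta>'>0. \<forall>\<^sub>F n in sequentially. \<forall>s\<ge>0. \<bar>s - t\<bar> < \<delta>' \<longrightarrow> xs n s + ys n s < c + e"
    by blast
next
  assume \<delta>: "0 < \<delta>" and e: "0 < e"
  have e2: "e / 2 > 0" using e by simp
  obtain d2 where d2: "d2 > 0" "\<forall>\<^sub>F n in sequentially. \<forall>s\<ge>0. \<bar>s - t\<bar> < d2 \<longrightarrow> \<bar>ys n s - y t\<bar> < e / 2"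
    using graph_converges_continuous_point[OF g assms(3) t e2] by blast
  have "min d2 \<delta> > 0" using d2 \<delta> by simp
  from hypo_convergesD2[OF h t this e2] d2(2)
  show "\<forall>\<^sub>F n in sequentially. \<exists>s\<ge>0. \<bar>s - t\<bar> < \<delta> \<and> x t + y t - e < xs n s + ys n s"
  proof eventually_elim
    case (elim n)
    then obtain s where s: "s \<ge> 0" "\<bar>s - t\<bar> < min d2 \<delta>" "xs n s > x t - e / 2" by blast
    moreover have "\<bar>ys n s - y t\<bar> < e / 2" using elim(2) s by auto
    ultimately have "\<bar>s - t\<bar> < \<delta>" "x t + y t - e < xs n s + ys n s" by linarith+
    then show ?case using s(1) by blast
  qed
qed

lemma hypo_converges_add:
  assumes gx: "graph_converges xs x" and gy: "graph_converges ys y"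
    and cont: "\<And>t. t \<ge> 0 \<Longrightarrow> continuous (at t within {0..}) x \<or> continuous (at t within {0..}) y"
  shows "hypo_converges (\<lambda>n t. xs n t + ys n t) (\<lambda>t. x t + y t)"
proof -
  have hx: "hypo_converges xs x" and hy: "hypo_converges ys y" using gx gy by (auto simp: graph_converges_def)
  show ?thesis
    unfolding hypo_converges_def
  proof (intro conjI allI impI)
    fix t c \<delta> e :: real
    assume t: "0 \<le> t" and \<delta>: "0 < \<delta>" and e: "0 < e" and up: "\<forall>s\<ge>0. \<bar>s - t\<bar> < \<delta> \<longrightarrow> x s + y s \<le> c"
    show "\<exists>\<delta>'>0. \<forall>\<^sub>F n in sequentially. \<forall>s\<ge>0. \<bar>s - t\<bar> < \<delta>' \<longrightarrow> xs n s + ys n s < c + e"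
      using cont[OF t]
    proof
      assume "continuous (at t within {0..}) y"
      then show ?thesis using hypo_add_clauses(1)[OF hx gy _ t \<delta> e up] by blast
    next
      assume "continuous (at t within {0..}) x"
      then show ?thesis
        using hypo_add_clauses(1)[OF hy gx _ t \<delta> e, of c] up by (simp add: add.commute)
    qed
  next
    fix t e \<delta> :: real
    assume t: "0 \<le> t" and e: "0 < e" and \<delta>: "0 < \<delta>"
    show "\<forall>\<^sub>F n in sequentially. \<exists>s\<ge>0. \<bar>s - t\<bar> < \<delta> \<and> x t + y t - e < xs n s + ys n s"
      using cont[OF t]
    proof
      assume "continuous (at t within {0..}) y"
      then show ?thesis using hypo_add_clauses(2)[OF hx gy _ t \<delta> e] by blast
    next
      assume "continuous (at t within {0..}) x"
      then show ?thesis
        using hypo_add_clauses(2)[OF hy gx _ t \<delta> e] by (simp add: add.commute)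
    qed
  qed
qed

lemma graph_converges_add:
  assumes gx: "graph_converges xs x" and gy: "graph_converges ys y"
    and cont: "\<And>t. t \<ge> 0 \<Longrightarrow> continuous (at t within {0..}) x \<or> continuous (at t within {0..}) y"
  shows "graph_converges (\<lambda>n t. xs n t + ys n t) (\<lambda>t. x t + y t)"
  unfolding graph_converges_def
proof
  show "hypo_converges (\<lambda>n t. xs n t + ys n t) (\<lambda>t. x t + y t)" by (rule hypo_converges_add[OF assms])
  have "hypo_converges (\<lambda>n t. - xs n t + - ys n t) (\<lambda>t. - x t + - y t)"
    by (rule hypo_converges_add[OF graph_converges_uminus[OF gx] graph_converges_uminus[OF gy]])
      (use cont continuous_minus in blast)
  then show "hypo_converges (\<lambda>n t. - (xs n t + ys n t)) (\<lambda>t. - (x t + y t))" by simp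
qed

text \<open>Pairwise absence of common jumps passes to partial sums: a discontinuity of the partial
  sum is one of some summand.\<close>

lemma graph_converges_sum:
  assumes "finite I" and "\<And>i. i \<in> I \<Longrightarrow> graph_converges (\<lambda>n. ys n i) (y i)"
    and "\<And>t i j. t \<ge> 0 \<Longrightarrow> i \<in> I \<Longrightarrow> j \<in> I \<Longrightarrow> i \<noteq> j \<Longrightarrow>
        continuous (at t within {0..}) (y i) \<or> continuous (at t within {0..}) (y j)"
  shows "graph_converges (\<lambda>n t. \<Sum>i\<in>I. ys n i t) (\<lambda>t. \<Sum>i\<in>I. y i t)"
  using assms
proof (induction I rule: finite_induct)
  case empty
  show ?case by (rule graph_converges_uniform) simp
next
  case (insert j I)
  have "graph_converges (\<lambda>n t. ys n j t + (\<Sum>i\<in>I. ys n i t)) (\<lambda>t. y j t + (\<Sum>i\<in>I. y i t))"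
  proof (rule graph_converges_add)
    show "graph_converges (\<lambda>n. ys n j) (y j)" using insert.prems by simp
    show "graph_converges (\<lambda>n t. \<Sum>i\<in>I. ys n i t) (\<lambda>t. \<Sum>i\<in>I. y i t)"
      using insert.prems by (intro insert.IH) auto
    fix t :: real assume t: "t \<ge> 0"
    show "continuous (at t within {0..}) (y j) \<or> continuous (at t within {0..}) (\<lambda>t. \<Sum>i\<in>I. y i t)"
    proof (rule disjCI)
      assume n: "\<not> continuous (at t within {0..}) (\<lambda>t. \<Sum>i\<in>I. y i t)"
      have "\<not> (\<forall>i\<in>I. continuous (at t within {0..}) (y i))"
        using n by (auto intro: continuous_sum)
      then obtain i where "i \<in> I" "\<not> continuous (at t within {0..}) (y i)" by blast
      then show "continuous (at t within {0..}) (y j)"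
        using insert.prems(2)[OF t, of j i] insert.hyps(2) by auto
    qed
  qed
  then show ?case using insert.hyps by simp
qed

lemma graph_converges_scale:
  assumes "graph_converges xs x" "k > 0"
  shows "graph_converges (\<lambda>n t. k * xs n t) (\<lambda>t. k * x t)"
proof -
  have main: "hypo_converges (\<lambda>n t. k * xs n t) (\<lambda>t. k * x t)" if h: "hypo_converges xs x" for xs x
    unfolding hypo_converges_def
  proof (intro conjI allI impI)
    fix t c \<delta> e :: real
    assume t: "0 \<le> t" and \<delta>: "0 < \<delta>" and e: "0 < e" and up: "\<forall>s\<ge>0. \<bar>s - t\<bar> < \<delta> \<longrightarrow> k * x s \<le> c"
    have "x s \<le> c / k" if "s \<ge> 0" "\<bar>s - t\<bar> < \<delta>" for s
      using up that \<open>k > 0\<close> by (simp add: field_simps)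
    moreover have "e / k > 0" using e \<open>k > 0\<close> by simp
    ultimately obtain d where d: "d > 0" "\<forall>\<^sub>F n in sequentially. \<forall>s\<ge>0. \<bar>s - t\<bar> < d \<longrightarrow> xs n s < c / k + e / k"
      using hypo_convergesD1[OF h t \<delta>] by blast
    have "\<forall>\<^sub>F n in sequentially. \<forall>s\<ge>0. \<bar>s - t\<bar> < d \<longrightarrow> k * xs n s < c + e"
      using d(2) \<open>k > 0\<close> by (simp add: field_simps)
    then show "\<exists>\<delta>'>0. \<forall>\<^sub>F n in sequentially. \<forall>s\<ge>0. \<bar>s - t\<bar> < \<delta>' \<longrightarrow> k * xs n s < c + e"
      using d(1) by blast
  next
    fix t e \<delta> :: real
    assume t: "0 \<le> t" and e: "0 < e" and \<delta>: "0 < \<delta>"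
    have "\<forall>\<^sub>F n in sequentially. \<exists>s\<ge>0. \<bar>s - t\<bar> < \<delta> \<and> xs n s > x t - e / k"
      using e \<open>k > 0\<close> by (intro hypo_convergesD2[OF h t \<delta>]) simp
    then show "\<forall>\<^sub>F n in sequentially. \<exists>s\<ge>0. \<bar>s - t\<bar> < \<delta> \<and> k * x t - e < k * xs n s"
      using \<open>k > 0\<close> by (simp add: field_simps)
  qed
  show ?thesis
    using assms(1) main[of xs x] main[of "\<lambda>n t. - xs n t" "\<lambda>t. - x t"] by (simp add: graph_converges_def)
qed

section \<open>The section variance as a path functional\<close>

text \<open>The family of paths plays the role of the outcome, so that the pathwise functionals are
  instances of the definitions for processes.\<close>

abbreviation pmean :: "nat \<Rightarrow> (nat \<Rightarrow> real \<Rightarrow> real) \<Rightarrow> real \<Rightarrow> real" where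
  "pmean m y \<equiv> section_mean m (\<lambda>i y. y i) y"

abbreviation pvar :: "nat \<Rightarrow> (nat \<Rightarrow> real \<Rightarrow> real) \<Rightarrow> real \<Rightarrow> real" where
  "pvar m y \<equiv> section_variance m (\<lambda>i y. y i) y"

lemma section_mean_path: "section_mean m X \<omega> = pmean m (\<lambda>i. X i \<omega>)"
  by (simp add: section_mean_def fun_eq_iff)

lemma section_variance_path: "section_variance m X \<omega> = pvar m (\<lambda>i. X i \<omega>)"
  by (simp add: section_variance_def section_mean_def fun_eq_iff)

lemma pmean_cong: "(\<And>i. i \<in> {1..m} \<Longrightarrow> y i = y' i) \<Longrightarrow> pmean m y = pmean m y'"
  by (auto simp: section_mean_def fun_eq_iff intro!: sum.cong)

lemma pvar_cong: "(\<And>i. i \<in> {1..m} \<Longrightarrow> y i = y' i) \<Longrightarrow> pvar m y = pvar m y'"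
  using pmean_cong[of m y y'] by (auto simp: section_variance_def fun_eq_iff intro!: sum.cong)

section \<open>Integrals along cadlag paths\<close>

lemma cadlag_set_borel_measurable:
  assumes "x \<in> cadlag_paths"
  shows "set_borel_measurable lborel {0..t} x"
proof -
  have "(\<lambda>s. indicator {0..t} s *\<^sub>R (indicator {0..} s *\<^sub>R x s)) \<in> borel_measurable borel"
    using cadlag_borel[OF assms] unfolding set_borel_measurable_def by measurable
  moreover have "(\<lambda>s. indicator {0..t} s *\<^sub>R (indicator {0..} s *\<^sub>R x s)) = (\<lambda>s. indicator {0..t} s *\<^sub>R x s)"
    by (auto simp: fun_eq_iff indicator_def)
  ultimately show ?thesis by (simp add: set_borel_measurable_def)
qed

lemma set_integrable_const_Icc: "set_integrable lborel {0..t::real} (\<lambda>_. K :: real)"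
  by (rule borel_integrable_atLeastAtMost') simp

lemma cadlag_set_integrable:
  assumes "x \<in> cadlag_paths"
  shows "set_integrable lborel {0..t} x"
proof -
  obtain K where K: "K > 0" "\<And>s. s \<in> {0..t} \<Longrightarrow> \<bar>x s\<bar> \<le> K" using cadlag_bounded[OF assms] by blast
  show ?thesis
  proof (rule set_integrable_bound)
    show "set_integrable lborel {0..t} (\<lambda>_. K)" by (rule set_integrable_const_Icc)
    show "set_borel_measurable lborel {0..t} x" by (rule cadlag_set_borel_measurable[OF assms])
    show "AE s\<in>{0..t} in lborel. norm (x s) \<le> norm K" using K by (auto intro!: AE_I2)
  qed
qed

lemma cadlag_set_integral_bound:
  assumes "x \<in> cadlag_paths" "t \<ge> 0" "\<And>s. s \<in> {0..t} \<Longrightarrow> x s \<le> B"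
  shows "(LINT s:{0..t}|lborel. x s) \<le> t * B"
proof -
  have "(LINT s:{0..t}|lborel. x s) \<le> (LINT s:{0..t}|lborel. B)"
    by (intro set_integral_mono cadlag_set_integrable assms set_integrable_const_Icc) auto
  also have "\<dots> = t * B" using assms(2) by (simp add: set_lebesgue_integral_def)
  finally show ?thesis .
qed

lemma cadlag_set_integral_mono_upper:
  assumes "x \<in> cadlag_paths" "\<And>s. s \<ge> 0 \<Longrightarrow> x s \<ge> 0" "t \<le> u"
  shows "(LINT s:{0..t}|lborel. x s) \<le> (LINT s:{0..u}|lborel. x s)"
  unfolding set_lebesgue_integral_def
proof (rule integral_mono)
  show "integrable lborel (\<lambda>s. indicator {0..t} s *\<^sub>R x s)" "integrable lborel (\<lambda>s. indicator {0..u} s *\<^sub>R x s)"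
    using cadlag_set_integrable[OF assms(1)] by (auto simp: set_integrable_def)
  show "indicator {0..t} s *\<^sub>R x s \<le> indicator {0..u} s *\<^sub>R x s" for s
    using assms(2)[of s] assms(3) by (auto simp: indicator_def)
qed

lemma cadlag_integral_continuous:
  assumes "x \<in> cadlag_paths"
  shows "continuous_on {0..} (\<lambda>t. LINT s:{0..t}|lborel. x s)"
proof -
  have eq: "(LINT s:{0..t}|lborel. x s) = integral {0..t} x" and int: "x integrable_on {0..t}" for t
    using set_borel_integral_eq_integral[OF cadlag_set_integrable[OF assms, of t]] by auto
  have "continuous (at t within {0..}) (\<lambda>t. integral {0..t} x)" if "t \<ge> 0" for t
  proof -
    have "continuous_on {0..t + 1} (\<lambda>t. integral {0..t} x)"
      by (rule indefinite_integral_continuous_1[OF int])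
    then have "continuous (at t within {0..t + 1}) (\<lambda>t. integral {0..t} x)"
      using that by (simp add: continuous_on_eq_continuous_within)
    moreover have "at t within {0..t + 1} = at t within {0..}"
      by (rule at_within_nhd[of t "{..<t+1}"]) (use that in auto)
    ultimately show ?thesis by simp
  qed
  then show ?thesis by (simp add: eq continuous_on_eq_continuous_within)
qed

text \<open>The integral of the absolute difference over all of \<open>[0, T]\<close> dominates
  every partial integral, so dominated convergence at the single horizon \<open>T\<close> is already
  uniform in \<open>t\<close>. Countably many times without convergence form a null set.\<close>

lemma cadlag_integrals_uniform:
  assumes x: "x \<in> cadlag_paths" and xs: "\<And>n. xs n \<in> cadlag_paths" and T: "T \<ge> 0"
    and C: "countable C" and lim: "\<And>s. s \<in> {0..T} \<Longrightarrow> s \<notin> C \<Longrightarrow> (\<lambda>n. xs n s) \<longlonglongrightarrow> x s"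
    and bnd: "\<forall>\<^sub>F n in sequentially. \<forall>s\<in>{0..T}. \<bar>xs n s\<bar> \<le> K"
    and e: "e > 0"
  shows "\<forall>\<^sub>F n in sequentially. \<forall>t\<in>{0..T}. \<bar>(LINT s:{0..t}|lborel. xs n s) - (LINT s:{0..t}|lborel. x s)\<bar> < e"
proof -
  obtain N where N: "\<And>n s. n \<ge> N \<Longrightarrow> s \<in> {0..T} \<Longrightarrow> \<bar>xs n s\<bar> \<le> K"
    using bnd unfolding eventually_sequentially by blast
  obtain L where L: "L > 0" "\<And>s. s \<in> {0..T} \<Longrightarrow> \<bar>x s\<bar> \<le> L" using cadlag_bounded[OF x] by blast
  have ae: "AE s in lborel. s \<notin> C" using C by (intro AE_not_in countable_imp_null_set_lborel)
  let ?D = "\<lambda>n s. indicator {0..T} s *\<^sub>R \<bar>xs n s - x s\<bar>"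
  have dc: "(\<lambda>s. xs n s - x s) \<in> cadlag_paths" for n
    using cadlag_add[OF xs cadlag_minus[OF x]] by simp
  have meas: "?D n \<in> borel_measurable lborel" for n
  proof -
    have "(\<lambda>s. \<bar>indicator {0..T} s *\<^sub>R (xs n s - x s)\<bar>) \<in> borel_measurable lborel"
      using cadlag_set_borel_measurable[OF dc, of T n] unfolding set_borel_measurable_def by measurable
    moreover have "(\<lambda>s. \<bar>indicator {0..T} s *\<^sub>R (xs n s - x s)\<bar>) = ?D n"
      by (auto simp: fun_eq_iff abs_mult)
    ultimately show ?thesis by simp
  qed
  \<comment> \<open>The shift by \<open>N\<close> turns the eventual bound into one for all indices,
    as domination requires.\<close>
  have "(\<lambda>n. integral\<^sup>L lborel (?D (n + N))) \<longlonglongrightarrow> integral\<^sup>L lborel (\<lambda>_ :: real. 0 :: real)"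
  proof (rule integral_dominated_convergence[where w = "\<lambda>s. indicator {0..T} s *\<^sub>R (K + L)"])
    show "integrable lborel (\<lambda>s. indicator {0..T} s *\<^sub>R (K + L))"
      using set_integrable_const_Icc[of T "K + L"] by (simp add: set_integrable_def)
    show "AE s in lborel. (\<lambda>n. ?D (n + N) s) \<longlonglongrightarrow> 0"
      using ae
    proof eventually_elim
      case (elim s)
      show ?case
      proof (cases "s \<in> {0..T}")
        case True
        then have "(\<lambda>n. xs (n + N) s) \<longlonglongrightarrow> x s" using lim[of s] elim by (intro LIMSEQ_ignore_initial_segment) auto
        then have "(\<lambda>n. \<bar>xs (n + N) s - x s\<bar>) \<longlonglongrightarrow> \<bar>x s - x s\<bar>" by (intro tendsto_intros)
        then show ?thesis using True by simp
      qed simp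
    qed
    show "AE s in lborel. norm (?D (n + N) s) \<le> indicator {0..T} s *\<^sub>R (K + L)" for n
    proof (rule AE_I2)
      fix s
      show "norm (?D (n + N) s) \<le> indicator {0..T} s *\<^sub>R (K + L)"
        using N[of "n + N" s] L(2)[of s] by (auto simp: indicator_def)
    qed
  qed (use meas in auto)
  then have "(\<lambda>n. integral\<^sup>L lborel (?D (n + N))) \<longlonglongrightarrow> 0" by simp
  then have "(\<lambda>n. integral\<^sup>L lborel (?D n)) \<longlonglongrightarrow> 0"
    by (rule LIMSEQ_offset[where f = "\<lambda>n. integral\<^sup>L lborel (?D n)"])
  then have "\<forall>\<^sub>F n in sequentially. integral\<^sup>L lborel (?D n) < e" using e by (rule order_tendstoD(2))
  then show ?thesis
  proof eventually_elim
    case (elim n)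
    show ?case
    proof
      fix t assume t: "t \<in> {0..T}"
      have "(LINT s:{0..t}|lborel. xs n s) - (LINT s:{0..t}|lborel. x s) = (LINT s:{0..t}|lborel. xs n s - x s)"
        by (rule set_integral_diff(2)[symmetric]) (intro cadlag_set_integrable xs x)+
      also have "\<bar>\<dots>\<bar> \<le> (LINT s:{0..t}|lborel. \<bar>xs n s - x s\<bar>)"
        unfolding set_lebesgue_integral_def
        by (rule order_trans[OF integral_abs_bound]) (simp add: abs_mult)
      also have "\<dots> \<le> integral\<^sup>L lborel (?D n)"
        unfolding set_lebesgue_integral_def
      proof (rule integral_mono)
        have "set_integrable lborel {0..u} (\<lambda>s. \<bar>xs n s - x s\<bar>)" for u
          using cadlag_set_integrable[OF dc] by (rule set_integrable_abs)
        then show "integrable lborel (\<lambda>s. indicator {0..t} s *\<^sub>R \<bar>xs n s - x s\<bar>)" "integrable lborel (?D n)"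
          by (auto simp: set_integrable_def)
      qed (use t in \<open>auto simp: indicator_def\<close>)
      finally show "\<bar>(LINT s:{0..t}|lborel. xs n s) - (LINT s:{0..t}|lborel. x s)\<bar> < e" using elim by simp
    qed
  qed
qed

section \<open>Bounds, continuity, scaling and growth of mean and variance\<close>

lemma pmean_cadlag:
  assumes "\<And>i. i \<in> {1..m} \<Longrightarrow> y i \<in> cadlag_paths"
  shows "pmean m y \<in> cadlag_paths"
proof -
  have "(\<lambda>t. 1 / real m * (\<Sum>i=1..m. y i t)) \<in> cadlag_paths"
    by (intro cadlag_mult cadlag_const cadlag_sum assms)
  then show ?thesis unfolding section_mean_def[abs_def] by simp
qed

lemma deviation_cadlag:
  assumes "\<And>i. i \<in> {1..m} \<Longrightarrow> y i \<in> cadlag_paths" "i \<in> {1..m}"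
  shows "(\<lambda>s. (y i s - pmean m y s)\<^sup>2) \<in> cadlag_paths"
proof -
  have "(\<lambda>s. y i s + - pmean m y s) \<in> cadlag_paths"
    by (intro cadlag_add cadlag_minus pmean_cadlag assms)
  from cadlag_mult[OF this this] show ?thesis by (simp add: power2_eq_square)
qed

lemma pmean_bound:
  assumes "\<And>i. i \<in> {1..m} \<Longrightarrow> \<bar>y i s\<bar> \<le> B" "B \<ge> 0"
  shows "\<bar>pmean m y s\<bar> \<le> B"
proof (cases "m = 0")
  case False
  have "\<bar>\<Sum>i=1..m. y i s\<bar> \<le> (\<Sum>i=1..m. B)" by (rule sum_abs[THEN order_trans]) (intro sum_mono assms)
  then show ?thesis using False by (simp add: section_mean_def abs_mult field_simps)
qed (use assms in \<open>simp add: section_mean_def\<close>)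

lemma deviation_bound:
  assumes "\<And>i. i \<in> {1..m} \<Longrightarrow> \<bar>y i s\<bar> \<le> B" "B \<ge> 0" "i \<in> {1..m}"
  shows "(y i s - pmean m y s)\<^sup>2 \<le> 4 * B\<^sup>2"
proof -
  have "\<bar>y i s - pmean m y s\<bar> \<le> 2 * B" using assms(1)[OF assms(3)] pmean_bound[of m y s B] assms(1,2) by fastforce
  then have "(y i s - pmean m y s)\<^sup>2 \<le> (2 * B)\<^sup>2" by (intro abs_le_square_iff[THEN iffD1]) linarith
  then show ?thesis by (simp add: power_mult_distrib)
qed

lemma pvar_nonneg: "m \<ge> 1 \<Longrightarrow> pvar m y t \<ge> 0"
  unfolding section_variance_def set_lebesgue_integral_def
  by (auto intro!: sum_nonneg mult_nonneg_nonneg Bochner_Integration.integral_nonneg divide_nonneg_nonneg)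

text \<open>A deviation is at most \<open>2 * B\<close>, which gives 4 per square;
  \<open>real m \<le> 2 * (real m - 1)\<close> for \<open>m \<ge> 2\<close> gives the remaining
  factor 2.\<close>

lemma pvar_bound:
  assumes m: "m \<ge> 2" and y: "\<And>i. i \<in> {1..m} \<Longrightarrow> y i \<in> cadlag_paths" and t: "t \<ge> 0" and B: "B \<ge> 0"
    and bnd: "\<And>i s. i \<in> {1..m} \<Longrightarrow> s \<in> {0..t} \<Longrightarrow> \<bar>y i s\<bar> \<le> B"
  shows "pvar m y t \<le> 8 * B\<^sup>2"
proof (cases "t > 0")
  case True
  have m1: "real m - 1 > 0" "real m \<le> 2 * (real m - 1)" using m by auto
  have "1 / t * (LINT s:{0..t}|lborel. (y i s - pmean m y s)\<^sup>2) \<le> 4 * B\<^sup>2" if "i \<in> {1..m}" for i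
  proof -
    have "(LINT s:{0..t}|lborel. (y i s - pmean m y s)\<^sup>2) \<le> t * (4 * B\<^sup>2)"
      by (intro cadlag_set_integral_bound deviation_cadlag deviation_bound y t bnd B that)
    then show ?thesis using True by (simp add: field_simps)
  qed
  then have "(\<Sum>i=1..m. 1 / t * (LINT s:{0..t}|lborel. (y i s - pmean m y s)\<^sup>2)) \<le> (\<Sum>i=1..m. 4 * B\<^sup>2)"
    by (intro sum_mono)
  also have "\<dots> = real m * (4 * B\<^sup>2)" by simp
  also have "\<dots> \<le> (2 * (real m - 1)) * (4 * B\<^sup>2)" using m1 by (intro mult_right_mono) auto
  finally show ?thesis using True m1 by (simp add: section_variance_def pos_divide_le_eq algebra_simps)
qed (simp add: section_variance_def)

text \<open>At positive times the variance is built from continuous integrals divided by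
  \<open>t\<close>; at 0 it is squeezed by the bound on paths that are small near their
  start.\<close>

lemma pvar_continuous:
  assumes m: "m \<ge> 2" and y: "\<And>i. i \<in> {1..m} \<Longrightarrow> y i \<in> cadlag_paths" and y0: "\<And>i. i \<in> {1..m} \<Longrightarrow> y i 0 = 0"
  shows "continuous_on {0..} (pvar m y)"
proof -
  have "continuous (at t within {0..}) (pvar m y)" if t: "t \<ge> 0" for t
  proof (cases "t > 0")
    case True
    let ?f = "\<lambda>t. 1 / (real m - 1) * (\<Sum>i=1..m. 1 / t * (LINT s:{0..t}|lborel. (y i s - pmean m y s)\<^sup>2))"
    have "continuous_on {0<..} ?f"
      by (intro continuous_intros continuous_on_subset[OF cadlag_integral_continuous] deviation_cadlag y) auto
    then have "continuous_on {0<..} (pvar m y)"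
      by (rule continuous_on_cong[THEN iffD1, rotated 2]) (auto simp: section_variance_def)
    then have "isCont (pvar m y) t" using True by (simp add: continuous_on_eq_continuous_at)
    then show ?thesis by (rule continuous_at_imp_continuous_at_within)
  next
    case False
    then have t0: "t = 0" using t by simp
    show ?thesis unfolding t0 continuous_within_eps_delta
    proof (intro allI impI)
      fix e :: real assume e: "e > 0"
      \<comment> \<open>Then \<open>8 * B\<^sup>2\<close> equals \<open>e / 2\<close>.\<close>
      define B where "B = sqrt (e / 16)"
      have B: "B > 0" "8 * B\<^sup>2 < e" using e by (auto simp: B_def)
      have "\<exists>d>0. \<forall>s\<ge>0. s < d \<longrightarrow> \<bar>y i s\<bar> < B" if i: "i \<in> {1..m}" for i
      proof -
        obtain d where "d > 0" "\<And>s. 0 \<le> s \<Longrightarrow> s < 0 + d \<Longrightarrow> \<bar>y i s - y i 0\<bar> < B"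
          using cadlag_right[OF y[OF i] order_refl B(1)] by blast
        then show ?thesis using y0[OF i] by (intro exI[of _ d]) auto
      qed
      then have "\<forall>i\<in>{1..m}. \<exists>d. d > 0 \<and> (\<forall>s\<ge>0. s < d \<longrightarrow> \<bar>y i s\<bar> < B)" by blast
      from bchoice[OF this] obtain d where d: "\<forall>i\<in>{1..m}. d i > 0 \<and> (\<forall>s\<ge>0. s < d i \<longrightarrow> \<bar>y i s\<bar> < B)" by blast
      define D where "D = Min (d ` {1..m})"
      have D: "D > 0" "\<And>i. i \<in> {1..m} \<Longrightarrow> D \<le> d i" using m d by (auto simp: D_def)
      show "\<exists>d>0. \<forall>s\<in>{0..}. dist s 0 < d \<longrightarrow> dist (pvar m y s) (pvar m y 0) < e"
      proof (intro exI conjI ballI impI)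
        fix t :: real assume t: "t \<in> {0..}" "dist t 0 < D"
        have "\<bar>y i s\<bar> \<le> B" if "i \<in> {1..m}" "s \<in> {0..t}" for i s
          using d D(2)[OF that(1)] that t by (force intro: less_imp_le)
        then have "pvar m y t \<le> 8 * B\<^sup>2" using t B(1) by (intro pvar_bound m y) auto
        then show "dist (pvar m y t) (pvar m y 0) < e"
          using B(2) pvar_nonneg[of m y t] m by (simp add: section_variance_def dist_real_def)
      qed (use D in auto)
    qed
  qed
  then show ?thesis by (simp add: continuous_on_eq_continuous_within)
qed

text \<open>Deviations from the mean cancel the common drift \<open>b\<close>, the factor comes out
  squared, and the substitution of \<open>a * s\<close> turns one time average into another. It
  serves the scaling limit, self-similarity and the removal of the drift.\<close>

lemma pvar_affine:
  assumes m: "m \<ge> 1" and a: "a > 0"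
  shows "pvar m (\<lambda>i s. k * y i (a * s) + b s) t = k\<^sup>2 * pvar m y (a * t)"
proof (cases "t > 0")
  case True
  let ?w = "\<lambda>i s. k * y i (a * s) + b s"
  have mean: "pmean m ?w s = k * pmean m y (a * s) + b s" for s
    using m by (simp add: section_mean_def sum.distrib sum_distrib_left[symmetric] field_simps)
  have "(LINT s:{0..t}|lborel. (?w i s - pmean m ?w s)\<^sup>2)
      = k\<^sup>2 / a * (LINT s:{0..a * t}|lborel. (y i s - pmean m y s)\<^sup>2)" for i
  proof -
    have "(LINT s:{0..a * t}|lborel. (y i s - pmean m y s)\<^sup>2)
        = \<bar>a\<bar> *\<^sub>R (LBINT s. indicator {0..a * t} (0 + a * s) *\<^sub>R (y i (0 + a * s) - pmean m y (0 + a * s))\<^sup>2)"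
      unfolding set_lebesgue_integral_def using a by (intro lborel_integral_real_affine) simp
    also have "(LBINT s. indicator {0..a * t} (0 + a * s) *\<^sub>R (y i (0 + a * s) - pmean m y (0 + a * s))\<^sup>2)
        = (LINT s:{0..t}|lborel. (y i (a * s) - pmean m y (a * s))\<^sup>2)"
      unfolding set_lebesgue_integral_def using a
      by (intro Bochner_Integration.integral_cong) (auto simp: indicator_def zero_le_mult_iff)
    finally have 1: "(LINT s:{0..a * t}|lborel. (y i s - pmean m y s)\<^sup>2)
        = a * (LINT s:{0..t}|lborel. (y i (a * s) - pmean m y (a * s))\<^sup>2)" using a by simp
    have "(LINT s:{0..t}|lborel. (?w i s - pmean m ?w s)\<^sup>2)
        = (LINT s:{0..t}|lborel. k\<^sup>2 * (y i (a * s) - pmean m y (a * s))\<^sup>2)"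
      unfolding mean by (simp add: power_mult_distrib[symmetric] right_diff_distrib)
    also have "\<dots> = k\<^sup>2 * (LINT s:{0..t}|lborel. (y i (a * s) - pmean m y (a * s))\<^sup>2)" by simp
    finally show ?thesis using 1 a by simp
  qed
  then have avg: "1 / t * (LINT s:{0..t}|lborel. (?w i s - pmean m ?w s)\<^sup>2)
      = k\<^sup>2 * (1 / (a * t) * (LINT s:{0..a * t}|lborel. (y i s - pmean m y s)\<^sup>2))" for i
    using True a by (simp add: field_simps)
  have at: "a * t > 0" using True a by simp
  show ?thesis
    unfolding section_variance_def using True at
    by (simp only: if_True avg) (simp only: sum_distrib_left[symmetric] mult.left_commute)
qed (use a in \<open>simp add: section_variance_def zero_less_mult_iff\<close>)

lemma pvar_positive_mono:
  assumes m: "m \<ge> 2" and y: "\<And>i. i \<in> {1..m} \<Longrightarrow> y i \<in> cadlag_paths"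
    and "0 < s" "s \<le> t" "pvar m y s > 0"
  shows "pvar m y t > 0"
proof -
  let ?I = "\<lambda>t i. LINT s:{0..t}|lborel. (y i s - pmean m y s)\<^sup>2"
  have p: "pvar m y r = (\<Sum>i=1..m. ?I r i) / ((real m - 1) * r)" if "r > 0" for r
    using that by (simp add: section_variance_def sum_divide_distrib mult.commute)
  have m1: "real m - 1 > 0" using m by simp
  have "0 < (\<Sum>i=1..m. ?I s i)" using assms(5) m1 assms(3) unfolding p[OF assms(3)] by (simp add: zero_less_divide_iff mult_less_0_iff)
  also have "\<dots> \<le> (\<Sum>i=1..m. ?I t i)"
    by (intro sum_mono cadlag_set_integral_mono_upper deviation_cadlag y assms) auto
  finally show ?thesis using p[of t] assms m1 by simp
qed

text \<open>Removing the common drift leaves the variance unchanged and makes the paths of smaller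
  order than \<open>t\<close>. Up to a large time \<open>t\<close> they are at most
  \<open>2 * \<delta> * t\<close>: early values are bounded by a constant, later ones by
  \<open>\<delta> * s\<close>.\<close>

lemma pvar_growth:
  assumes m: "m \<ge> 2" and y: "\<And>i. i \<in> {1..m} \<Longrightarrow> y i \<in> cadlag_paths"
    and lim: "\<And>i. i \<in> {1..m} \<Longrightarrow> ((\<lambda>t. (y i t - \<mu> * t) / t) \<longlongrightarrow> 0) at_top"
  shows "((\<lambda>t. pvar m y t / t\<^sup>2) \<longlongrightarrow> 0) at_top"
proof -
  \<comment> \<open>The factors 1 make this an instance of the affine rule.\<close>
  define w where "w = (\<lambda>i s. 1 * y i (1 * s) + - \<mu> * s)"
  have w_eq: "w i s = y i s - \<mu> * s" for i s by (simp add: w_def)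
  have pw: "pvar m w t = pvar m y t" for t
    unfolding w_def using m by (subst pvar_affine) auto
  have wc: "w i \<in> cadlag_paths" if "i \<in> {1..m}" for i
  proof -
    have "(\<lambda>s. - \<mu> * s) \<in> cadlag_paths" by (intro cadlag_of_continuous continuous_intros)
    from cadlag_add[OF y[OF that] this] show ?thesis by (simp add: w_def)
  qed
  show ?thesis
  proof (rule tendstoI)
    fix e :: real assume e: "e > 0"
    \<comment> \<open>Then \<open>8 * (2 * \<delta>)\<^sup>2\<close> equals
      \<open>e / 2\<close>.\<close>
    define \<delta> where "\<delta> = sqrt (e / 64)"
    have \<delta>: "\<delta> > 0" "8 * (2 * \<delta>)\<^sup>2 < e" using e by (auto simp: \<delta>_def power_mult_distrib)
    have "\<forall>\<^sub>F t in at_top. \<forall>i\<in>{1..m}. \<bar>w i t / t\<bar> < \<delta>"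
      using tendstoD[OF lim \<delta>(1)] by (intro eventually_ball_finite) (auto simp: w_eq)
    then obtain S where S: "\<And>t i. t \<ge> S \<Longrightarrow> i \<in> {1..m} \<Longrightarrow> \<bar>w i t / t\<bar> < \<delta>"
      unfolding eventually_at_top_linorder by blast
    have "\<forall>i\<in>{1..m}. \<exists>K. K > 0 \<and> (\<forall>s\<in>{0..max S 1}. \<bar>w i s\<bar> \<le> K)"
      using cadlag_bounded[OF wc] by metis
    from bchoice[OF this] obtain K where K: "\<forall>i\<in>{1..m}. K i > 0 \<and> (\<forall>s\<in>{0..max S 1}. \<bar>w i s\<bar> \<le> K i)" by blast
    define L where "L = (\<Sum>i=1..m. K i)"
    have L0: "L \<ge> 0" unfolding L_def using K by (intro sum_nonneg) (auto intro: less_imp_le)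
    have KL: "K i \<le> L" if "i \<in> {1..m}" for i
      unfolding L_def using K that by (intro member_le_sum) (auto intro: less_imp_le)
    have "\<forall>\<^sub>F t in at_top. t \<ge> max 1 (L / \<delta>)" by (rule eventually_ge_at_top)
    then show "\<forall>\<^sub>F t in at_top. dist (pvar m y t / t\<^sup>2) 0 < e"
    proof eventually_elim
      case (elim t)
      then have t: "t > 0" "L \<le> \<delta> * t" using \<delta> by (auto simp: field_simps)
      have "\<bar>w i s\<bar> \<le> 2 * \<delta> * t" if i: "i \<in> {1..m}" and s: "s \<in> {0..t}" for i s
      proof (cases "s \<le> max S 1")
        case True
        then have "\<bar>w i s\<bar> \<le> K i" using K i s by auto
        moreover have "0 \<le> \<delta> * t" using \<delta> t by simp
        ultimately show ?thesis using KL[OF i] t(2) by linarith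
      next
        case False
        then have "\<bar>w i s / s\<bar> < \<delta>" "s > 0" by (auto intro!: S i simp del: abs_divide)
        then have "\<bar>w i s\<bar> \<le> \<delta> * s" by (simp add: field_simps)
        also have "\<dots> \<le> \<delta> * t" using s \<delta> by (intro mult_left_mono) auto
        finally show ?thesis using \<delta> t by simp
      qed
      then have "pvar m w t \<le> 8 * (2 * \<delta> * t)\<^sup>2"
        using \<delta> t by (intro pvar_bound m wc) auto
      then have "pvar m y t / t\<^sup>2 \<le> 8 * (2 * \<delta>)\<^sup>2" using t by (simp add: pw field_simps power_mult_distrib)
      then show ?case using \<delta>(2) pvar_nonneg[of m y t] m by simp
    qed
  qed
qed

section \<open>Continuity of mean and variance under graph convergence\<close>

lemma graph_converges_bounded:
  assumes g: "graph_converges xs x" and x: "x \<in> cadlag_paths"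
  obtains K where "K > 0" "\<forall>\<^sub>F n in sequentially. \<forall>s\<in>{0..T}. \<bar>xs n s\<bar> \<le> K"
proof -
  obtain K where K: "K > 0" "\<And>s. s \<in> {0..T + 1} \<Longrightarrow> \<bar>x s\<bar> \<le> K" using cadlag_bounded[OF x] by blast
  have "\<forall>\<^sub>F n in sequentially. \<forall>s\<in>{0..T}. \<bar>xs n s\<bar> \<le> K + 1"
  proof (rule eventually_uniform_Icc)
    fix t assume t: "t \<in> {0..T}"
    then have t0: "t \<ge> 0" by simp
    have b: "- K \<le> x s \<and> x s \<le> K" if "s \<ge> 0" "\<bar>s - t\<bar> < 1" for s
    proof -
      have "s \<in> {0..T + 1}" using that t by auto
      from K(2)[OF this] show ?thesis by linarith
    qed
    have "- K \<le> left_limit x t \<and> left_limit x t \<le> K" by (rule left_limit_between[OF x t0 zero_less_one b])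
    moreover have "- K \<le> x t \<and> x t \<le> K" using b[of t] t0 by simp
    ultimately have l: "- K \<le> min (left_limit x t) (x t)" "max (left_limit x t) (x t) \<le> K" by auto
    obtain d where d: "d > 0" "\<forall>\<^sub>F n in sequentially. \<forall>s\<ge>0. \<bar>s - t\<bar> < d \<longrightarrow>
        min (left_limit x t) (x t) - 1 < xs n s \<and> xs n s < max (left_limit x t) (x t) + 1"
      using graph_converges_near[OF g x t0 zero_less_one] by blast
    have "\<forall>\<^sub>F n in sequentially. \<forall>s\<in>{0..T}. \<bar>s - t\<bar> < d \<longrightarrow> \<bar>xs n s\<bar> \<le> K + 1"
      using d(2)
    proof eventually_elim
      case (elim n)
      show ?case
      proof (intro ballI impI)
        fix s assume "s \<in> {0..T}" "\<bar>s - t\<bar> < d"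
        then have "min (left_limit x t) (x t) - 1 < xs n s \<and> xs n s < max (left_limit x t) (x t) + 1"
          using elim by simp
        then show "\<bar>xs n s\<bar> \<le> K + 1" using l by linarith
      qed
    qed
    then show "\<exists>\<delta>>0. \<forall>\<^sub>F n in sequentially. \<forall>s\<in>{0..T}. \<bar>s - t\<bar> < \<delta> \<longrightarrow> \<bar>xs n s\<bar> \<le> K + 1"
      using d(1) by blast
  qed
  then show ?thesis using that[of "K + 1"] K(1) by simp
qed

lemma graph_converges_pointwise:
  assumes g: "graph_converges xs x" and "isCont x t" "t \<ge> 0"
  shows "(\<lambda>n. xs n t) \<longlonglongrightarrow> x t"
proof (rule tendstoI)
  fix e :: real assume e: "e > 0"
  have "continuous (at t within {0..}) x" using assms(2) by (rule continuous_at_imp_continuous_at_within)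
  from graph_converges_continuous_point[OF g this assms(3) e]
  obtain d where d: "d > 0" "\<forall>\<^sub>F n in sequentially. \<forall>s\<ge>0. \<bar>s - t\<bar> < d \<longrightarrow> \<bar>xs n s - x t\<bar> < e" by blast
  show "\<forall>\<^sub>F n in sequentially. dist (xs n t) (x t) < e"
    using d(2) by eventually_elim (use d(1) assms(3) in \<open>auto simp: dist_real_def\<close>)
qed

text \<open>Downward closure of the condition in \<open>d\<close> is carried through the induction,
  so that a minimum of finitely many radii suits every \<open>i\<close>.\<close>

lemma uniform_pos_choice:
  assumes "finite I" "\<And>i. i \<in> I \<Longrightarrow> \<exists>d>0. \<forall>d'. 0 < d' \<and> d' \<le> d \<longrightarrow> P i d'"
  shows "\<exists>d>0::real. \<forall>i\<in>I. P i d"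
proof -
  have "\<exists>d>0::real. \<forall>d'. 0 < d' \<and> d' \<le> d \<longrightarrow> (\<forall>i\<in>I. P i d')"
    using assms
  proof (induction I rule: finite_induct)
    case empty
    show ?case by (rule exI[of _ 1]) simp
  next
    case (insert j I)
    obtain d1 where "d1 > 0" "\<forall>d'. 0 < d' \<and> d' \<le> d1 \<longrightarrow> (\<forall>i\<in>I. P i d')"
      using insert.IH insert.prems by blast
    moreover obtain d2 where "d2 > 0" "\<forall>d'. 0 < d' \<and> d' \<le> d2 \<longrightarrow> P j d'"
      using insert.prems by blast
    ultimately show ?case by (intro exI[of _ "min d1 d2"]) auto
  qed
  then show ?thesis by blast
qed

text \<open>Division by \<open>t\<close> is not uniform near 0, so the interval is split at some
  \<open>\<delta>\<close>. Below it both variances are small, since the limits start at 0 and late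
  paths are near them; above it the integrals converge uniformly and \<open>1 / t\<close> is
  bounded.\<close>

lemma pvar_uniform:
  assumes m: "m \<ge> 2"
    and ys: "\<And>n i. i \<in> {1..m} \<Longrightarrow> ys n i \<in> cadlag_paths"
    and y: "\<And>i. i \<in> {1..m} \<Longrightarrow> y i \<in> cadlag_paths" "\<And>i. i \<in> {1..m} \<Longrightarrow> y i 0 = 0"
    and g: "\<And>i. i \<in> {1..m} \<Longrightarrow> graph_converges (\<lambda>n. ys n i) (y i)"
    and e: "e > 0"
  shows "\<forall>\<^sub>F n in sequentially. \<forall>t\<in>{0..T}. \<bar>pvar m (ys n) t - pvar m y t\<bar> < e"
proof (cases "T \<ge> 0")
  case T: True
  define B where "B = sqrt (e / 16)"
  have B: "B > 0" "8 * B\<^sup>2 < e" using e by (auto simp: B_def)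
  have "\<exists>d>0. \<forall>i\<in>{1..m}. (\<forall>\<^sub>F n in sequentially. \<forall>s\<ge>0. s < d \<longrightarrow> \<bar>ys n i s\<bar> < B) \<and> (\<forall>s\<ge>0. s < d \<longrightarrow> \<bar>y i s\<bar> < B)"
  proof (rule uniform_pos_choice)
    fix i assume i: "i \<in> {1..m}"
    have c: "continuous (at 0 within {0..}) (y i)" by (rule cadlag_continuous_at_0[OF y(1)[OF i]])
    obtain d1 where d1: "d1 > 0" "\<forall>\<^sub>F n in sequentially. \<forall>s\<ge>0. \<bar>s - 0\<bar> < d1 \<longrightarrow> \<bar>ys n i s - y i 0\<bar> < B"
      using graph_converges_continuous_point[OF g[OF i] c order_refl B(1)] by blast
    obtain d2 where d2: "d2 > 0" "\<And>s. s \<ge> 0 \<Longrightarrow> \<bar>s - 0\<bar> < d2 \<Longrightarrow> \<bar>y i s - y i 0\<bar> < B"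
      using continuous_within_nonneg[OF c order_refl B(1)] by blast
    have *: "(\<forall>\<^sub>F n in sequentially. \<forall>s\<ge>0. s < d' \<longrightarrow> \<bar>ys n i s\<bar> < B) \<and> (\<forall>s\<ge>0. s < d' \<longrightarrow> \<bar>y i s\<bar> < B)"
      if "d' \<le> min d1 d2" for d'
      using d1(2) d2(2) y(2)[OF i] that by (auto elim!: eventually_mono)
    have "min d1 d2 > 0" using d1(1) d2(1) by simp
    then show "\<exists>d>0. \<forall>d'. 0 < d' \<and> d' \<le> d \<longrightarrow>
        (\<forall>\<^sub>F n in sequentially. \<forall>s\<ge>0. s < d' \<longrightarrow> \<bar>ys n i s\<bar> < B) \<and> (\<forall>s\<ge>0. s < d' \<longrightarrow> \<bar>y i s\<bar> < B)"
      using * by blast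
  qed simp
  then obtain \<delta> where \<delta>: "\<delta> > 0" "\<And>i. i \<in> {1..m} \<Longrightarrow> \<forall>\<^sub>F n in sequentially. \<forall>s\<ge>0. s < \<delta> \<longrightarrow> \<bar>ys n i s\<bar> < B"
    "\<And>i s. i \<in> {1..m} \<Longrightarrow> s \<ge> 0 \<Longrightarrow> s < \<delta> \<Longrightarrow> \<bar>y i s\<bar> < B" by blast
  have near0: "\<forall>\<^sub>F n in sequentially. \<forall>i\<in>{1..m}. \<forall>s\<ge>0. s < \<delta> \<longrightarrow> \<bar>ys n i s\<bar> < B"
    using \<delta>(2) by (intro eventually_ball_finite) auto
  \<comment> \<open>Time 0 is added because \<open>isCont\<close> at 0 would also involve negative
    times.\<close>
  define C where "C = (\<Union>i\<in>{1..m}. {t. t > 0 \<and> \<not> isCont (y i) t}) \<union> {0}"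
  have C: "countable C" unfolding C_def
    by (intro countable_Un countable_UN cadlag_countable_jumps y) auto
  have "\<exists>K>0. \<forall>\<^sub>F n in sequentially. \<forall>i\<in>{1..m}. \<forall>s\<in>{0..T}. \<bar>ys n i s\<bar> \<le> K"
  proof -
    have "\<forall>i\<in>{1..m}. \<exists>K. K > 0 \<and> (\<forall>\<^sub>F n in sequentially. \<forall>s\<in>{0..T}. \<bar>ys n i s\<bar> \<le> K)"
    proof
      fix i assume i: "i \<in> {1..m}"
      show "\<exists>K. K > 0 \<and> (\<forall>\<^sub>F n in sequentially. \<forall>s\<in>{0..T}. \<bar>ys n i s\<bar> \<le> K)"
        using graph_converges_bounded[OF g[OF i] y(1)[OF i], of T] by blast
    qed
    from bchoice[OF this] obtain K where
      K: "\<forall>i\<in>{1..m}. K i > 0 \<and> (\<forall>\<^sub>F n in sequentially. \<forall>s\<in>{0..T}. \<bar>ys n i s\<bar> \<le> K i)" by blast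
    have KL: "K i \<le> (\<Sum>i=1..m. K i)" if "i \<in> {1..m}" for i
      using K that by (intro member_le_sum) (auto intro: less_imp_le)
    have "\<forall>\<^sub>F n in sequentially. \<forall>i\<in>{1..m}. \<forall>s\<in>{0..T}. \<bar>ys n i s\<bar> \<le> (\<Sum>i=1..m. K i)"
    proof (rule eventually_ball_finite, simp, rule ballI)
      fix i assume i: "i \<in> {1..m}"
      then have "\<forall>\<^sub>F n in sequentially. \<forall>s\<in>{0..T}. \<bar>ys n i s\<bar> \<le> K i" using K by blast
      then show "\<forall>\<^sub>F n in sequentially. \<forall>s\<in>{0..T}. \<bar>ys n i s\<bar> \<le> (\<Sum>i=1..m. K i)"
        by eventually_elim (use KL[OF i] in \<open>auto intro: order_trans\<close>)
    qed
    moreover have "0 < (\<Sum>i=1..m. K i)" using K m by (intro sum_pos) auto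
    ultimately show ?thesis by blast
  qed
  then obtain K where K: "K > 0" "\<forall>\<^sub>F n in sequentially. \<forall>i\<in>{1..m}. \<forall>s\<in>{0..T}. \<bar>ys n i s\<bar> \<le> K" by blast
  let ?q = "\<lambda>y i s. (y i s - pmean m y s)\<^sup>2"
  let ?I = "\<lambda>y i t. LINT s:{0..t}|lborel. ?q y i s"
  have ptw: "(\<lambda>n. ys n i s) \<longlonglongrightarrow> y i s" if "i \<in> {1..m}" "s \<in> {0..T}" "s \<notin> C" for i s
    using that by (intro graph_converges_pointwise g) (auto simp: C_def)
  have ptq: "(\<lambda>n. ?q (ys n) i s) \<longlonglongrightarrow> ?q y i s" if "i \<in> {1..m}" "s \<in> {0..T}" "s \<notin> C" for i s
    unfolding section_mean_def using that by (intro tendsto_intros ptw) auto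
  \<comment> \<open>For \<open>t \<ge> \<delta>\<close> the factor \<open>1 / t\<close> is at most
    \<open>1 / \<delta>\<close>, and \<open>real m / (real m - 1)\<close> is at most 2; with this
    accuracy of the integrals the variances differ by at most \<open>e / 2\<close>.\<close>
  have "e * \<delta> / 4 > 0" using e \<delta> by simp
  then have "\<forall>\<^sub>F n in sequentially. \<forall>t\<in>{0..T}. \<bar>?I (ys n) i t - ?I y i t\<bar> < e * \<delta> / 4" if i: "i \<in> {1..m}" for i
  proof (intro cadlag_integrals_uniform[OF _ _ T C])
    show "\<forall>\<^sub>F n in sequentially. \<forall>s\<in>{0..T}. \<bar>?q (ys n) i s\<bar> \<le> 4 * K\<^sup>2"
      using K(2)
    proof eventually_elim
      case (elim n)
      show ?case
      proof
        fix s assume "s \<in> {0..T}"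
        then have "?q (ys n) i s \<le> 4 * K\<^sup>2"
          using elim K(1) i by (intro deviation_bound) auto
        then show "\<bar>?q (ys n) i s\<bar> \<le> 4 * K\<^sup>2" by simp
      qed
    qed
  qed (use ptq i ys y in \<open>auto intro!: deviation_cadlag\<close>)
  then have "\<forall>\<^sub>F n in sequentially. \<forall>i\<in>{1..m}. \<forall>t\<in>{0..T}. \<bar>?I (ys n) i t - ?I y i t\<bar> < e * \<delta> / 4"
    by (intro eventually_ball_finite[OF finite_atLeastAtMost] ballI)
  then show ?thesis using near0
  proof eventually_elim
    case (elim n)
    show ?case
    proof
      fix t assume t: "t \<in> {0..T}"
      show "\<bar>pvar m (ys n) t - pvar m y t\<bar> < e"
      proof (cases "t < \<delta>")
        case True
        have "pvar m (ys n) t \<le> 8 * B\<^sup>2"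
        proof (rule pvar_bound[OF m])
          fix i s assume "i \<in> {1..m}" "s \<in> {0..t}"
          then show "\<bar>ys n i s\<bar> \<le> B" using elim(2) True by (auto intro!: less_imp_le)
        qed (use t B ys in auto)
        moreover have "pvar m y t \<le> 8 * B\<^sup>2"
        proof (rule pvar_bound[OF m])
          fix i s assume "i \<in> {1..m}" "s \<in> {0..t}"
          then show "\<bar>y i s\<bar> \<le> B" using \<delta>(3)[of i s] True by auto
        qed (use t B y in auto)
        moreover have "pvar m (ys n) t \<ge> 0" "pvar m y t \<ge> 0" using m by (auto intro!: pvar_nonneg)
        ultimately show ?thesis using B(2) by linarith
      next
        case False
        then have tp: "t > 0" "\<delta> \<le> t" using \<delta> by auto
        have m1: "real m - 1 > 0" "real m \<le> 2 * (real m - 1)" using m by auto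
        have p: "pvar m z t = (\<Sum>i=1..m. ?I z i t) / ((real m - 1) * t)" for z
          using tp by (simp add: section_variance_def sum_divide_distrib mult.commute)
        have "\<bar>(\<Sum>i=1..m. ?I (ys n) i t) - (\<Sum>i=1..m. ?I y i t)\<bar> \<le> (\<Sum>i=1..m. \<bar>?I (ys n) i t - ?I y i t\<bar>)"
          unfolding sum_subtractf[symmetric] by (rule sum_abs)
        also have "\<dots> \<le> (\<Sum>i=1..m. e * \<delta> / 4)"
          using elim(1) t by (intro sum_mono) (auto intro: less_imp_le)
        also have "\<dots> = real m * (e * \<delta> / 4)" by simp
        also have "\<dots> \<le> (2 * (real m - 1)) * (e * t / 4)"
          using m1 e \<delta>(1) tp by (intro mult_mono) auto
        also have "\<dots> = (e / 2) * ((real m - 1) * t)" by simp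
        finally have *: "\<bar>(\<Sum>i=1..m. ?I (ys n) i t) - (\<Sum>i=1..m. ?I y i t)\<bar> \<le> (e / 2) * ((real m - 1) * t)" .
        have "\<bar>pvar m (ys n) t - pvar m y t\<bar>
            = \<bar>(\<Sum>i=1..m. ?I (ys n) i t) - (\<Sum>i=1..m. ?I y i t)\<bar> / ((real m - 1) * t)"
          unfolding p diff_divide_distrib[symmetric] abs_divide using m1 tp by (simp add: abs_mult)
        also have "\<dots> \<le> e / 2" using * m1 tp by (simp add: pos_divide_le_eq)
        finally show ?thesis using e by simp
      qed
    qed
  qed
qed simp

text \<open>Subadditivity of the root. This modulus of continuity is uniform down to 0, where the
  derivative is unbounded and the variance starts.\<close>

lemma sqrt_diff_le: "a \<ge> 0 \<Longrightarrow> b \<ge> 0 \<Longrightarrow> \<bar>sqrt a - sqrt b\<bar> \<le> sqrt \<bar>a - b\<bar>"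
proof -
  have main: "sqrt a - sqrt b \<le> sqrt (a - b)" if "0 \<le> b" "b \<le> a" for a b :: real
    using sqrt_add_le_add_sqrt[of "a - b" b] that by simp
  assume "a \<ge> 0" "b \<ge> 0"
  then show ?thesis using main[of b a] main[of a b] by (cases "b \<le> a") auto
qed

lemma graph_converges_sqrt_pvar:
  assumes m: "m \<ge> 2"
    and ys: "\<And>n i. i \<in> {1..m} \<Longrightarrow> ys n i \<in> cadlag_paths"
    and y: "\<And>i. i \<in> {1..m} \<Longrightarrow> y i \<in> cadlag_paths" "\<And>i. i \<in> {1..m} \<Longrightarrow> y i 0 = 0"
    and g: "\<And>i. i \<in> {1..m} \<Longrightarrow> graph_converges (\<lambda>n. ys n i) (y i)"
  shows "graph_converges (\<lambda>n t. sqrt (pvar m (ys n) t)) (\<lambda>t. sqrt (pvar m y t))"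
proof (rule graph_converges_uniform)
  fix T e :: real assume e: "e > 0"
  then have "e\<^sup>2 > 0" by simp
  then have "\<forall>\<^sub>F n in sequentially. \<forall>t\<in>{0..T}. \<bar>pvar m (ys n) t - pvar m y t\<bar> < e\<^sup>2"
    by (intro pvar_uniform m ys y g)
  then show "\<forall>\<^sub>F n in sequentially. \<forall>t\<in>{0..T}. \<bar>sqrt (pvar m (ys n) t) - sqrt (pvar m y t)\<bar> < e"
  proof eventually_elim
    case (elim n)
    show ?case
    proof
      fix t assume "t \<in> {0..T}"
      then have "\<bar>pvar m (ys n) t - pvar m y t\<bar> < e\<^sup>2" using elim by blast
      then have "sqrt \<bar>pvar m (ys n) t - pvar m y t\<bar> < e" using e by (simp add: real_less_lsqrt)
      moreover have "pvar m (ys n) t \<ge> 0" "pvar m y t \<ge> 0" using m by (auto intro!: pvar_nonneg)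
      ultimately show "\<bar>sqrt (pvar m (ys n) t) - sqrt (pvar m y t)\<bar> < e"
        using sqrt_diff_le by (metis order_le_less_trans)
    qed
  qed
qed

lemma graph_converges_pmean:
  assumes m: "m \<ge> 1"
    and g: "\<And>i. i \<in> {1..m} \<Longrightarrow> graph_converges (\<lambda>n. ys n i) (y i)"
    and cont: "\<And>t i j. t > 0 \<Longrightarrow> i \<in> {1..m} \<Longrightarrow> j \<in> {1..m} \<Longrightarrow> i \<noteq> j \<Longrightarrow> isCont (y i) t \<or> isCont (y j) t"
    and y: "\<And>i. i \<in> {1..m} \<Longrightarrow> y i \<in> cadlag_paths"
  shows "graph_converges (\<lambda>n. pmean m (ys n)) (pmean m y)"
proof -
  have "graph_converges (\<lambda>n t. 1 / real m * (\<Sum>i=1..m. ys n i t)) (\<lambda>t. 1 / real m * (\<Sum>i=1..m. y i t))"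
  proof (intro graph_converges_scale graph_converges_sum g)
    fix t :: real and i j assume *: "t \<ge> 0" "i \<in> {1..m}" "j \<in> {1..m}" "i \<noteq> j"
    show "continuous (at t within {0..}) (y i) \<or> continuous (at t within {0..}) (y j)"
    proof (cases "t = 0")
      case True
      then show ?thesis using cadlag_continuous_at_0[OF y[OF *(2)]] by simp
    next
      case False
      then show ?thesis using cont[of t i j] * continuous_at_imp_continuous_at_within
        by (metis order_le_less)
    qed
  qed (use m in auto)
  then show ?thesis by (simp add: section_mean_def[abs_def])
qed

section \<open>Measurability\<close>

text \<open>The topology is given by sequences: the preimage of an open set is sequentially open,
  which here is openness.\<close>

lemma continuous_map_M2I:
  assumes "\<And>x xs. x \<in> cadlag_paths \<Longrightarrow> (\<And>n. xs n \<in> cadlag_paths) \<Longrightarrow> M2_converges xs x \<Longrightarrow> (\<lambda>n. g (xs n)) \<longlonglongrightarrow> (g x :: real)"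
  shows "continuous_map M2_topology euclideanreal g"
  unfolding continuous_map_def
proof (intro conjI allI impI)
  fix U :: "real set" assume "openin euclideanreal U"
  then have U: "open U" by simp
  show "openin M2_topology {x \<in> topspace M2_topology. g x \<in> U}"
    unfolding openin_M2_topology
  proof (intro conjI ballI allI impI)
    fix x xs assume x: "x \<in> {x \<in> topspace M2_topology. g x \<in> U}"
      and xs: "range xs \<subseteq> cadlag_paths \<and> M2_converges xs x"
    then have "(\<lambda>n. g (xs n)) \<longlonglongrightarrow> g x" by (intro assms) auto
    then have "\<forall>\<^sub>F n in sequentially. g (xs n) \<in> U" using U x by (intro topological_tendstoD) auto
    then show "\<forall>\<^sub>F n in sequentially. xs n \<in> {x \<in> topspace M2_topology. g x \<in> U}"
      by (rule eventually_mono) (use xs in auto)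
  qed auto
qed auto

text \<open>An open rectangle around the limit lies in the preimage, and each of its sides, being
  sequentially open, is eventually entered by its coordinate sequence.\<close>

lemma continuous_map_WM2_tendsto:
  assumes f: "continuous_map WM2_topology euclideanreal f"
    and u: "u \<in> cadlag_paths" "\<And>n. us n \<in> cadlag_paths" "M2_converges us u"
    and v: "v \<in> cadlag_paths" "\<And>n. vs n \<in> cadlag_paths" "M2_converges vs v"
  shows "(\<lambda>n. f (us n, vs n)) \<longlonglongrightarrow> f (u, v)"
proof (rule topological_tendstoI)
  fix V :: "real set" assume V: "open V" "f (u, v) \<in> V"
  define W where "W = {p \<in> topspace WM2_topology. f p \<in> V}"
  have "openin WM2_topology W" using f V(1) unfolding continuous_map_def W_def by auto
  then have nbhd: "\<forall>a b. (a, b) \<in> W \<longrightarrow>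
      (\<exists>A B. openin M2_topology A \<and> openin M2_topology B \<and> a \<in> A \<and> b \<in> B \<and> A \<times> B \<subseteq> W)"
    unfolding WM2_topology_def openin_prod_topology_alt .
  have "(u, v) \<in> W" using V u v by (simp add: W_def WM2_topology_def)
  from nbhd[rule_format, OF this] obtain A B where AB: "openin M2_topology A" "openin M2_topology B" "u \<in> A" "v \<in> B" "A \<times> B \<subseteq> W"
    by (elim exE conjE) (rule that)
  have "\<forall>\<^sub>F n in sequentially. us n \<in> A"
    using AB(1,3) u unfolding openin_M2_topology by blast
  moreover have "\<forall>\<^sub>F n in sequentially. vs n \<in> B"
    using AB(2,4) v unfolding openin_M2_topology by blast
  ultimately show "\<forall>\<^sub>F n in sequentially. f (us n, vs n) \<in> V"
    by eventually_elim (use AB(5) in \<open>auto simp: W_def\<close>)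
qed

lemma borel_measurable_completion_AE:
  fixes f g :: "'a \<Rightarrow> real"
  assumes f: "f \<in> borel_measurable (completion M)" and eq: "AE \<omega> in M. f \<omega> = g \<omega>"
  shows "g \<in> borel_measurable (completion M)"
proof (rule measurableI)
  fix B :: "real set" assume B: "B \<in> sets borel"
  show "g -` B \<inter> space (completion M) \<in> sets (completion M)"
  proof (rule completion.in_sets_AE)
    show "f -` B \<inter> space (completion M) \<in> sets (completion M)" using f B by (rule measurable_sets)
    show "AE x in completion M. (x \<in> f -` B \<inter> space (completion M)) = (x \<in> g -` B \<inter> space (completion M))"
      using AE_completion[OF eq] by eventually_elim auto
  qed simp
qed simp

lemma processD:
  assumes "process M D X"
  shows "t \<ge> 0 \<Longrightarrow> (\<lambda>\<omega>. X \<omega> t) \<in> borel_measurable (completion M)" "AE \<omega> in M. X \<omega> \<in> D"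
  using assms by (auto simp: process_def)

lemma tendsto_fun_coordinate:
  assumes "(as \<longlongrightarrow> (a :: nat \<Rightarrow> real)) F"
  shows "((\<lambda>i. as i k) \<longlongrightarrow> a k) F"
  using continuous_on_tendsto_compose[OF continuous_on_product_coordinates assms, of k] by simp

text \<open>
  Borel sets of the M2 topology are not obviously generated by the coordinates; a sequentially
  continuous functional is, however, a limit of continuous functions of countably many path values.
\<close>

lemma continuous_functional_measurable:
  assumes f: "\<And>u us v vs. u \<in> cadlag_paths \<Longrightarrow> (\<And>n. us n \<in> cadlag_paths) \<Longrightarrow> graph_converges us u \<Longrightarrow>
      v \<in> cadlag_paths \<Longrightarrow> (\<And>n. vs n \<in> cadlag_paths) \<Longrightarrow> graph_converges vs v \<Longrightarrow>
      (\<lambda>n. f (us n, vs n)) \<longlonglongrightarrow> (f (u, v) :: real)"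
    and U: "process M cadlag_paths U" and V: "process M cadlag_paths V"
  shows "(\<lambda>\<omega>. f (U \<omega>, V \<omega>)) \<in> borel_measurable (completion M)"
proof -
  define h where "h = (\<lambda>n (p :: (nat \<Rightarrow> real) \<times> (nat \<Rightarrow> real)). f (step_path n (fst p), step_path n (snd p)))"
  define P where "P = (\<lambda>n \<omega>. ((\<lambda>k. U \<omega> (real k / real (Suc n))), (\<lambda>k. V \<omega> (real k / real (Suc n)))))"
  have "h n \<in> borel_measurable borel" for n
  proof (rule borel_measurable_continuous_onI)
    show "continuous_on UNIV (h n)"
    \<comment> \<open>Convergent samples give graph-convergent step paths of the same mesh, to which
      the assumed continuity of \<open>f\<close> applies.\<close>
    proof (rule continuous_on_sequentiallyI)
      fix ps p assume "ps \<longlonglongrightarrow> (p :: (nat \<Rightarrow> real) \<times> (nat \<Rightarrow> real))"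
      then have "(\<lambda>i. fst (ps i)) \<longlonglongrightarrow> fst p" "(\<lambda>i. snd (ps i)) \<longlonglongrightarrow> snd p"
        by (auto intro: tendsto_fst tendsto_snd)
      then show "(\<lambda>i. h n (ps i)) \<longlonglongrightarrow> h n p"
        unfolding h_def by (intro f step_path_cadlag graph_converges_step_arg tendsto_fun_coordinate)
    qed
  qed
  moreover have "P n \<in> completion M \<rightarrow>\<^sub>M borel" for n
  proof -
    have "P n \<in> completion M \<rightarrow>\<^sub>M borel \<Otimes>\<^sub>M borel" unfolding P_def
      by (intro measurable_Pair measurable_coordinatewise_then_product processD(1)[OF U] processD(1)[OF V]) auto
    then show ?thesis by (simp only: borel_prod)
  qed
  ultimately have hP: "(\<lambda>\<omega>. h n (P n \<omega>)) \<in> borel_measurable (completion M)" for n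
    using measurable_compose by blast
  \<comment> \<open>\<open>lim\<close> is total, so measurability holds for all outcomes; agreement
    with the functional is claimed only where both paths are cadlag, and the completion absorbs the
    rest.\<close>
  then have "(\<lambda>\<omega>. lim (\<lambda>n. h n (P n \<omega>))) \<in> borel_measurable (completion M)"
    by (rule borel_measurable_lim_metric)
  moreover have "AE \<omega> in M. lim (\<lambda>n. h n (P n \<omega>)) = f (U \<omega>, V \<omega>)"
    using processD(2)[OF U] processD(2)[OF V]
  proof eventually_elim
    case (elim \<omega>)
    have "(\<lambda>n. h n (P n \<omega>)) \<longlonglongrightarrow> f (U \<omega>, V \<omega>)"
      unfolding h_def P_def fst_conv snd_conv
      by (intro f step_path_cadlag graph_converges_step_path elim)
    then show ?case by (rule limI)
  qed
  ultimately show ?thesis by (rule borel_measurable_completion_AE)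
qed

text \<open>Approximation of \<open>r \<in> [0, u]\<close> from the right by countably many values within \<open>[0, u]\<close>.\<close>

definition sample :: "real \<Rightarrow> nat \<Rightarrow> real \<Rightarrow> real" where
  "sample u n r = max 0 (min u ((of_int \<lfloor>r * real (Suc n)\<rfloor> + 1) / real (Suc n)))"

text \<open>Agrees with a cadlag path on \<open>[0, u]\<close>, but makes sense for arbitrary
  functions and reads them only at countably many times up to \<open>u\<close>. Joint measurability
  and adaptedness of the variance rest on this.\<close>

definition path_upto :: "real \<Rightarrow> (real \<Rightarrow> real) \<Rightarrow> real \<Rightarrow> real" where
  "path_upto u x r = lim (\<lambda>n. x (sample u n r))"

lemma path_upto_eq:
  assumes x: "x \<in> cadlag_paths" and r: "0 \<le> r" "r \<le> u"
  shows "path_upto u x r = x r"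
proof -
  have "(\<lambda>n. x (sample u n r)) \<longlonglongrightarrow> x r"
  proof (rule tendstoI)
    fix e :: real assume "e > 0"
    then obtain d where d: "d > 0" "\<And>s. r \<le> s \<Longrightarrow> s < r + d \<Longrightarrow> \<bar>x s - x r\<bar> < e"
      using cadlag_right[OF x r(1)] by blast
    have "\<forall>\<^sub>F n in sequentially. inverse (real (Suc n)) < d"
      using LIMSEQ_inverse_real_of_nat by (rule order_tendstoD(2)) (use d in simp)
    then show "\<forall>\<^sub>F n in sequentially. dist (x (sample u n r)) (x r) < e"
    proof eventually_elim
      case (elim n)
      define N where "N = real (Suc n)"
      have N: "N > 0" by (simp add: N_def)
      define g where "g = (of_int \<lfloor>r * N\<rfloor> + 1) / N"
      have "of_int \<lfloor>r * N\<rfloor> \<le> r * N" "r * N < of_int \<lfloor>r * N\<rfloor> + 1" by linarith+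
      then have "r < g" "g \<le> r + inverse N" using N by (auto simp: g_def field_simps)
      moreover have "sample u n r = max 0 (min u g)" by (simp only: sample_def g_def N_def)
      ultimately have "r \<le> sample u n r" "sample u n r < r + d" using r elim d(1) unfolding N_def by auto
      then show ?case using d(2) by (simp add: dist_real_def)
    qed
  qed
  then show ?thesis unfolding path_upto_def by (rule limI)
qed

lemma pvar_path_upto:
  assumes y: "\<And>i. i \<in> {1..m} \<Longrightarrow> y i \<in> cadlag_paths"
  shows "pvar m (\<lambda>i. path_upto u (y i)) u = pvar m y u"
proof -
  have "(path_upto u (y i) s - pmean m (\<lambda>i. path_upto u (y i)) s)\<^sup>2 = (y i s - pmean m y s)\<^sup>2"
    if "i \<in> {1..m}" "s \<in> {0..u}" for i s
    using that path_upto_eq[OF y] by (simp add: section_mean_def)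
  then have "(LINT s:{0..u}|lborel. (path_upto u (y i) s - pmean m (\<lambda>i. path_upto u (y i)) s)\<^sup>2)
      = (LINT s:{0..u}|lborel. (y i s - pmean m y s)\<^sup>2)" if "i \<in> {1..m}" for i
    using that by (intro set_lebesgue_integral_cong) auto
  then show ?thesis by (simp add: section_variance_def)
qed

text \<open>For fixed \<open>n\<close> the sampling time takes countably many values, all within
  \<open>[0, u]\<close>, so each approximation is pieced together from single coordinates; the limit
  over \<open>n\<close> keeps joint measurability.\<close>

lemma path_upto_pair_measurable:
  assumes "u \<ge> 0" "\<And>v. v \<in> {0..u} \<Longrightarrow> (\<lambda>\<omega>. X \<omega> v) \<in> borel_measurable G"
  shows "(\<lambda>(\<omega>, r). path_upto u (X \<omega>) r) \<in> borel_measurable (G \<Otimes>\<^sub>M lborel)"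
proof -
  have "(\<lambda>p. X (fst p) (sample u n (snd p))) \<in> borel_measurable (G \<Otimes>\<^sub>M lborel)" for n
  proof -
    have "(\<lambda>p. X (fst p) (max 0 (min u ((of_int \<lfloor>snd p * real (Suc n)\<rfloor> + 1) / real (Suc n)))))
        \<in> borel_measurable (G \<Otimes>\<^sub>M lborel)"
    proof (rule measurable_compose_countable[where g = "\<lambda>p. \<lfloor>snd p * real (Suc n)\<rfloor>"
          and f = "\<lambda>k p. X (fst p) (max 0 (min u ((of_int k + 1) / real (Suc n))))"])
      show "(\<lambda>p. X (fst p) (max 0 (min u ((of_int k + 1) / real (Suc n))))) \<in> borel_measurable (G \<Otimes>\<^sub>M lborel)" for k
        by (rule measurable_compose[OF measurable_fst assms(2)]) (use assms(1) in auto)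
      show "(\<lambda>p. \<lfloor>snd p * real (Suc n)\<rfloor>) \<in> G \<Otimes>\<^sub>M lborel \<rightarrow>\<^sub>M count_space UNIV"
        using measurable_snd[of G "lborel :: real measure"]
        by (intro measurable_compose[OF _ measurable_real_floor] borel_measurable_times borel_measurable_const) simp
    qed
    then show ?thesis by (simp add: sample_def)
  qed
  then have "(\<lambda>p. lim (\<lambda>n. X (fst p) (sample u n (snd p)))) \<in> borel_measurable (G \<Otimes>\<^sub>M lborel)"
    by (rule borel_measurable_lim_metric)
  then show ?thesis by (simp add: path_upto_def case_prod_beta')
qed

text \<open>Measurability of integrals with a parameter. The space \<open>G\<close> is left open
  because three are used: the completed probability space, the product of the path spaces, and the
  sigma-algebra generated by the paths up to a time.\<close>

lemma pvar_path_upto_measurable: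
  assumes "u \<ge> 0" and Y: "\<And>i v. i \<in> {1..m} \<Longrightarrow> v \<in> {0..u} \<Longrightarrow> (\<lambda>\<omega>. Y i \<omega> v) \<in> borel_measurable G"
  shows "(\<lambda>\<omega>. pvar m (\<lambda>i. path_upto u (Y i \<omega>)) u) \<in> borel_measurable G"
proof -
  have pm: "(\<lambda>p. path_upto u (Y i (fst p)) (snd p)) \<in> borel_measurable (G \<Otimes>\<^sub>M lborel)" if "i \<in> {1..m}" for i
    using path_upto_pair_measurable[of u "Y i" G] assms that by (simp add: case_prod_beta')
  have ind: "(\<lambda>p. indicator {0..u} (snd p) :: real) \<in> borel_measurable (G \<Otimes>\<^sub>M lborel)"
    by (rule measurable_compose[OF measurable_snd]) simp
  have "(\<lambda>\<omega>. LINT s:{0..u}|lborel. (path_upto u (Y i \<omega>) s - pmean m (\<lambda>i. path_upto u (Y i \<omega>)) s)\<^sup>2)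
      \<in> borel_measurable G" if "i \<in> {1..m}" for i
    unfolding set_lebesgue_integral_def section_mean_def
    by (rule lborel.borel_measurable_lebesgue_integral)
      (unfold case_prod_beta',
        intro borel_measurable_scaleR borel_measurable_power borel_measurable_diff borel_measurable_times
          borel_measurable_sum borel_measurable_const pm ind that)
  then show ?thesis
    unfolding section_variance_def
    by (cases "u > 0") (auto intro!: borel_measurable_sum borel_measurable_times)
qed

lemma section_variance_measurable:
  assumes "u \<ge> 0" and Y: "\<And>i. i \<in> {1..m} \<Longrightarrow> process M cadlag_paths (Y i)"
  shows "(\<lambda>\<omega>. section_variance m Y \<omega> u) \<in> borel_measurable (completion M)"
proof (rule borel_measurable_completion_AE)
  show "(\<lambda>\<omega>. pvar m (\<lambda>i. path_upto u (Y i \<omega>)) u) \<in> borel_measurable (completion M)"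
    using assms(1) processD(1)[OF Y] by (intro pvar_path_upto_measurable) auto
  have "AE \<omega> in M. \<forall>i\<in>{1..m}. Y i \<omega> \<in> cadlag_paths"
    using processD(2)[OF Y] by (intro AE_finite_allI) auto
  then show "AE \<omega> in M. pvar m (\<lambda>i. path_upto u (Y i \<omega>)) u = section_variance m Y \<omega> u"
    by eventually_elim (unfold section_variance_path[of m Y], rule pvar_path_upto, blast)
qed

lemma section_mean_measurable:
  assumes "u \<ge> 0" and Y: "\<And>i. i \<in> {1..m} \<Longrightarrow> process M cadlag_paths (Y i)"
  shows "(\<lambda>\<omega>. section_mean m Y \<omega> u) \<in> borel_measurable (completion M)"
  unfolding section_mean_def using assms
  by (intro borel_measurable_times borel_measurable_sum borel_measurable_const processD(1)[OF Y])

section \<open>Weak convergence of independent vectors\<close>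

text \<open>The hat function of half-width \<open>1 / real N\<close> at the grid point
  \<open>real a / real N\<close>; those with \<open>a \<le> N\<close> form a partition of unity on
  the unit interval.\<close>

definition tent :: "nat \<Rightarrow> nat \<Rightarrow> real \<Rightarrow> real" where
  "tent N a u = max 0 (1 - \<bar>real N * u - real a\<bar>)"

lemma tent_bounds: "0 \<le> tent N a u" "tent N a u \<le> 1"
  by (auto simp: tent_def)

lemma tent_continuous: "continuous_on UNIV (tent N a)"
  unfolding tent_def[abs_def] by (intro continuous_intros)

lemma tent_measurable [measurable]: "tent N a \<in> borel_measurable borel"
  by (rule borel_measurable_continuous_onI[OF tent_continuous])

lemma tent_sum:
  assumes u: "0 \<le> u" "u \<le> 1"
  shows "(\<Sum>a\<le>N. tent N a u) = 1"
proof -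
  define v where "v = real N * u"
  have v: "0 \<le> v" "v \<le> real N" using u by (auto simp: v_def mult_left_le)
  define j where "j = nat \<lfloor>v\<rfloor>"
  have j: "real j \<le> v" "v < real j + 1" using v unfolding j_def by linarith+
  have jN: "j \<le> N" using j v by linarith
  \<comment> \<open>The extra index contributes nothing and makes room for the neighbour
    \<open>Suc j\<close> in the case \<open>j = N\<close>.\<close>
  have "tent N (Suc N) u = 0" using v by (simp add: tent_def v_def[symmetric])
  then have "(\<Sum>a\<le>N. tent N a u) = (\<Sum>a\<le>Suc N. tent N a u)" by simp
  also have "\<dots> = (\<Sum>a\<in>{j, Suc j}. tent N a u)"
  proof (rule sum.mono_neutral_right)
    show "\<forall>a\<in>{..Suc N} - {j, Suc j}. tent N a u = 0"
    proof
      fix a assume "a \<in> {..Suc N} - {j, Suc j}"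
      then have "a + 1 \<le> j \<or> j + 2 \<le> a" by auto
      then have "real a + 1 \<le> real j \<or> real j + 2 \<le> real a" by linarith
      then show "tent N a u = 0" using j unfolding tent_def v_def[symmetric] by linarith
    qed
  qed (use jN in auto)
  also have "\<dots> = 1" using j unfolding tent_def v_def[symmetric] by simp
  finally show ?thesis .
qed

text \<open>Multilinear interpolation of \<open>H\<close> on a grid of mesh
  \<open>1 / real N\<close>. The weights are products of tents; they sum to 1, and a weight is
  nonzero only if its grid point is within one mesh of \<open>v\<close> in every coordinate, where
  the Lipschitz bound applies.\<close>

lemma tensor_approximation:
  fixes H :: "('i \<Rightarrow> real) \<Rightarrow> real"
  assumes A: "finite A" and N: "N \<ge> 1" and L: "L \<ge> 0"
    and lip: "\<And>v w. (\<forall>i\<in>A. v i \<in> {0..1}) \<Longrightarrow> (\<forall>i\<in>A. w i \<in> {0..1}) \<Longrightarrow> \<bar>H v - H w\<bar> \<le> L * (\<Sum>i\<in>A. \<bar>v i - w i\<bar>)"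
    and v: "\<forall>i\<in>A. v i \<in> {0..1}"
  shows "\<bar>H v - (\<Sum>a\<in>PiE A (\<lambda>_. {..N}). H (\<lambda>i. real (a i) / real N) * (\<Prod>i\<in>A. tent N (a i) (v i)))\<bar>
      \<le> L * real (card A) / real N"
proof -
  let ?J = "PiE A (\<lambda>_. {..N})" and ?p = "\<lambda>a. \<Prod>i\<in>A. tent N (a i) (v i)"
  let ?h = "\<lambda>a. H (\<lambda>i. real (a i) / real N)"
  have one: "(\<Sum>a\<in>?J. ?p a) = 1"
  proof -
    have "(\<Sum>a\<in>?J. ?p a) = (\<Prod>i\<in>A. \<Sum>a\<le>N. tent N a (v i))"
      by (rule prod_sum_PiE[symmetric]) (use A in auto)
    also have "\<dots> = 1" using v by (intro prod.neutral ballI tent_sum) auto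
    finally show ?thesis .
  qed
  have p0: "?p a \<ge> 0" for a by (intro prod_nonneg) (simp add: tent_bounds)
  have "H v - (\<Sum>a\<in>?J. ?h a * ?p a) = (\<Sum>a\<in>?J. (H v - ?h a) * ?p a)"
    using one by (simp add: left_diff_distrib sum_subtractf flip: sum_distrib_left)
  also have "\<bar>\<dots>\<bar> \<le> (\<Sum>a\<in>?J. \<bar>(H v - ?h a) * ?p a\<bar>)" by (rule sum_abs)
  also have "\<dots> \<le> (\<Sum>a\<in>?J. (L * real (card A) / real N) * ?p a)"
  proof (rule sum_mono)
    fix a assume a: "a \<in> ?J"
    show "\<bar>(H v - ?h a) * ?p a\<bar> \<le> (L * real (card A) / real N) * ?p a"
    proof (cases "?p a = 0")
      case False
      have near: "\<bar>v i - real (a i) / real N\<bar> \<le> 1 / real N" if i: "i \<in> A" for i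
      proof -
        have "tent N (a i) (v i) \<noteq> 0" using False A i by auto
        then have "\<bar>real N * v i - real (a i)\<bar> \<le> 1" unfolding tent_def by linarith
        moreover have "real N * v i - real (a i) = real N * (v i - real (a i) / real N)"
          using N by (simp add: field_simps)
        ultimately have "real N * \<bar>v i - real (a i) / real N\<bar> \<le> 1" by (simp only: abs_mult abs_of_nat)
        then show ?thesis using N by (simp add: field_simps)
      qed
      have "\<bar>H v - ?h a\<bar> \<le> L * (\<Sum>i\<in>A. \<bar>v i - real (a i) / real N\<bar>)"
        using v a N by (intro lip) (auto simp: PiE_iff)
      also have "\<dots> \<le> L * (\<Sum>i\<in>A. 1 / real N)"
        using near L by (intro mult_left_mono sum_mono) auto
      finally have "\<bar>H v - ?h a\<bar> \<le> L * real (card A) / real N" by simp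
      then show ?thesis
        unfolding abs_mult abs_of_nonneg[OF p0] by (rule mult_right_mono[OF _ p0])
    qed simp
  qed
  also have "\<dots> = L * real (card A) / real N" by (simp only: sum_distrib_left[symmetric] one mult_1_right)
  finally show ?thesis .
qed

lemma tensor_approximation_tendsto:
  fixes H :: "('i \<Rightarrow> real) \<Rightarrow> real"
  assumes A: "finite A" and L: "L \<ge> 0"
    and lip: "\<And>v w. (\<forall>i\<in>A. v i \<in> {0..1}) \<Longrightarrow> (\<forall>i\<in>A. w i \<in> {0..1}) \<Longrightarrow> \<bar>H v - H w\<bar> \<le> L * (\<Sum>i\<in>A. \<bar>v i - w i\<bar>)"
    and v: "\<forall>i\<in>A. v i \<in> {0..1}"
  shows "(\<lambda>N. \<Sum>a\<in>PiE A (\<lambda>_. {..Suc N}). H (\<lambda>i. real (a i) / real (Suc N)) * (\<Prod>i\<in>A. tent (Suc N) (a i) (v i)))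
      \<longlonglongrightarrow> H v"
proof (rule Lim_null[THEN iffD2], rule tendsto_rabs_zero_cancel)
  let ?S = "\<lambda>N. \<Sum>a\<in>PiE A (\<lambda>_. {..Suc N}). H (\<lambda>i. real (a i) / real (Suc N)) * (\<Prod>i\<in>A. tent (Suc N) (a i) (v i))"
  show "(\<lambda>N. \<bar>?S N - H v\<bar>) \<longlonglongrightarrow> 0"
  proof (rule tendsto_sandwich[where f = "\<lambda>_. 0" and h = "\<lambda>N. (L * real (card A)) * inverse (real (Suc N))"])
    show "\<forall>\<^sub>F N in sequentially. \<bar>?S N - H v\<bar> \<le> (L * real (card A)) * inverse (real (Suc N))"
      using tensor_approximation[OF A _ L lip v, of "Suc _"]
      by (intro always_eventually allI) (simp add: abs_minus_commute divide_inverse del: of_nat_Suc)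
    show "(\<lambda>N. (L * real (card A)) * inverse (real (Suc N))) \<longlonglongrightarrow> 0"
      by (rule tendsto_mult_right_zero[OF LIMSEQ_inverse_real_of_nat])
  qed auto
qed

text \<open>
  Expectations of products of tents determine the limits of the expectations of all Lipschitz
  functions of finitely many coordinates in the unit interval.
\<close>

lemma lipschitz_expectation_tendsto:
  fixes H :: "('i \<Rightarrow> real) \<Rightarrow> real" and s :: "'e \<Rightarrow> 'c \<Rightarrow> 'i \<Rightarrow> real" and t :: "'d \<Rightarrow> 'i \<Rightarrow> real"
  assumes P: "prob_space P" and Q: "prob_space Q" and A: "finite A" and L: "L \<ge> 0"
    and lip: "\<And>v w. (\<forall>i\<in>A. v i \<in> {0..1}) \<Longrightarrow> (\<forall>i\<in>A. w i \<in> {0..1}) \<Longrightarrow> \<bar>H v - H w\<bar> \<le> L * (\<Sum>i\<in>A. \<bar>v i - w i\<bar>)"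
    and s: "\<And>\<epsilon> \<omega> i. s \<epsilon> \<omega> i \<in> {0..1}" "\<forall>\<^sub>F \<epsilon> in F. \<forall>i\<in>A. (\<lambda>\<omega>. s \<epsilon> \<omega> i) \<in> borel_measurable P"
    and t: "\<And>\<omega> i. t \<omega> i \<in> {0..1}" "\<And>i. i \<in> A \<Longrightarrow> (\<lambda>\<omega>. t \<omega> i) \<in> borel_measurable Q"
    and tents: "\<And>N a. ((\<lambda>\<epsilon>. LINT \<omega>|P. (\<Prod>i\<in>A. tent N (a i) (s \<epsilon> \<omega> i))) \<longlongrightarrow> (LINT \<omega>|Q. (\<Prod>i\<in>A. tent N (a i) (t \<omega> i)))) F"
  shows "((\<lambda>\<epsilon>. LINT \<omega>|P. H (s \<epsilon> \<omega>)) \<longlongrightarrow> (LINT \<omega>|Q. H (t \<omega>))) F"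
    and "\<forall>\<^sub>F \<epsilon> in F. integrable P (\<lambda>\<omega>. H (s \<epsilon> \<omega>))" and "integrable Q (\<lambda>\<omega>. H (t \<omega>))"
proof -
  let ?S = "\<lambda>N v. \<Sum>a\<in>PiE A (\<lambda>_. {..Suc N}). H (\<lambda>i. real (a i) / real (Suc N)) * (\<Prod>i\<in>A. tent (Suc N) (a i) (v i))"
  have int_prod: "integrable R (\<lambda>\<omega>. \<Prod>i\<in>A. tent N (a i) (r \<omega> i))"
    if "prob_space R" "\<forall>i\<in>A. (\<lambda>\<omega>. r \<omega> i) \<in> borel_measurable R" for R :: "'x measure" and r N a
  proof -
    interpret R: prob_space R by fact
    show ?thesis
    proof (rule R.integrable_const_bound[where B = 1])
      show "AE \<omega> in R. norm (\<Prod>i\<in>A. tent N (a i) (r \<omega> i)) \<le> 1"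
        by (intro AE_I2) (auto simp: abs_prod tent_bounds intro!: prod_le_1)
      show "(\<lambda>\<omega>. \<Prod>i\<in>A. tent N (a i) (r \<omega> i)) \<in> borel_measurable R"
        using that(2) by (intro borel_measurable_prod measurable_compose[OF _ tent_measurable]) auto
    qed
  qed
  have int_H: "integrable R (\<lambda>\<omega>. H (r \<omega>))"
    if "prob_space R" "\<forall>i\<in>A. (\<lambda>\<omega>. r \<omega> i) \<in> borel_measurable R" "\<And>\<omega> i. r \<omega> i \<in> {0..1}"
    for R :: "'x measure" and r
  proof -
    interpret R: prob_space R by fact
    \<comment> \<open>Measurability is inherited from the interpolants, of which \<open>H\<close>
      along \<open>r\<close> is the pointwise limit.\<close>
    have "(\<lambda>\<omega>. H (r \<omega>)) \<in> borel_measurable R"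
    proof (rule borel_measurable_LIMSEQ_real)
      show "(\<lambda>\<omega>. ?S N (r \<omega>)) \<in> borel_measurable R" for N
        using int_prod[OF that(1,2)] by (intro borel_measurable_sum borel_measurable_times borel_measurable_const borel_measurable_integrable)
      show "(\<lambda>N. ?S N (r \<omega>)) \<longlonglongrightarrow> H (r \<omega>)" for \<omega>
        using that(3) by (intro tensor_approximation_tendsto[OF A L lip]) auto
    qed
    moreover have "\<bar>H (r \<omega>)\<bar> \<le> \<bar>H (\<lambda>_. 0)\<bar> + L * real (card A)" for \<omega>
    proof -
      have "\<bar>H (r \<omega>) - H (\<lambda>_. 0)\<bar> \<le> L * (\<Sum>i\<in>A. \<bar>r \<omega> i - 0\<bar>)" using that(3) by (intro lip) auto
      also have "\<dots> \<le> L * (\<Sum>i\<in>A. 1)" using that(3) L by (intro mult_left_mono sum_mono) auto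
      finally show ?thesis by simp
    qed
    ultimately show ?thesis
      by (intro R.integrable_const_bound[where B = "\<bar>H (\<lambda>_. 0)\<bar> + L * real (card A)"]) auto
  qed
  show intQ: "integrable Q (\<lambda>\<omega>. H (t \<omega>))" using t by (intro int_H[OF Q]) auto
  show intP: "\<forall>\<^sub>F \<epsilon> in F. integrable P (\<lambda>\<omega>. H (s \<epsilon> \<omega>))"
    using s(2) by eventually_elim (use s(1) in \<open>intro int_H[OF P]\<close>)
  have approx: "\<bar>(LINT \<omega>|R. H (r \<omega>)) - (\<Sum>a\<in>PiE A (\<lambda>_. {..Suc N}). H (\<lambda>i. real (a i) / real (Suc N)) * (LINT \<omega>|R. (\<Prod>i\<in>A. tent (Suc N) (a i) (r \<omega> i))))\<bar>
      \<le> L * real (card A) / real (Suc N)"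
    if R: "prob_space R" "\<forall>i\<in>A. (\<lambda>\<omega>. r \<omega> i) \<in> borel_measurable R" "\<And>\<omega> i. r \<omega> i \<in> {0..1}"
    for R :: "'x measure" and r N
  proof -
    interpret R: prob_space R by fact
    have iS: "integrable R (\<lambda>\<omega>. ?S N (r \<omega>))"
      by (intro Bochner_Integration.integrable_sum integrable_mult_right int_prod R)
    have "(LINT \<omega>|R. ?S N (r \<omega>)) = (\<Sum>a\<in>PiE A (\<lambda>_. {..Suc N}). H (\<lambda>i. real (a i) / real (Suc N)) * (LINT \<omega>|R. (\<Prod>i\<in>A. tent (Suc N) (a i) (r \<omega> i))))"
      by (subst Bochner_Integration.integral_sum) (auto intro!: integrable_mult_right int_prod R simp del: of_nat_Suc)
    then have "(LINT \<omega>|R. H (r \<omega>)) - (\<Sum>a\<in>PiE A (\<lambda>_. {..Suc N}). H (\<lambda>i. real (a i) / real (Suc N)) * (LINT \<omega>|R. (\<Prod>i\<in>A. tent (Suc N) (a i) (r \<omega> i))))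
        = (LINT \<omega>|R. H (r \<omega>) - ?S N (r \<omega>))"
      using int_H[OF R] iS by simp
    also have "\<bar>\<dots>\<bar> \<le> (LINT \<omega>|R. \<bar>H (r \<omega>) - ?S N (r \<omega>)\<bar>)" by (rule integral_abs_bound)
    also have "\<dots> \<le> (LINT \<omega>|R. L * real (card A) / real (Suc N))"
    proof (rule integral_mono)
      show "integrable R (\<lambda>\<omega>. \<bar>H (r \<omega>) - ?S N (r \<omega>)\<bar>)"
        using int_H[OF R] iS by (intro Bochner_Integration.integrable_abs Bochner_Integration.integrable_diff)
      show "\<bar>H (r \<omega>) - ?S N (r \<omega>)\<bar> \<le> L * real (card A) / real (Suc N)" for \<omega>
        using R(3) by (intro tensor_approximation[OF A _ L lip]) auto
    qed simp
    finally show ?thesis by (simp add: R.prob_space)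
  qed
  show "((\<lambda>\<epsilon>. LINT \<omega>|P. H (s \<epsilon> \<omega>)) \<longlongrightarrow> (LINT \<omega>|Q. H (t \<omega>))) F"
  proof (rule tendstoI)
    fix e :: real assume e: "e > 0"
    \<comment> \<open>The interpolation error enters twice, once on each probability space; the
      remaining third is for the finite sum of tent expectations.\<close>
    obtain N where N: "L * real (card A) / real (Suc N) < e / 3"
    proof -
      have "(\<lambda>N. (L * real (card A)) * inverse (real (Suc N))) \<longlonglongrightarrow> 0"
        by (rule tendsto_mult_right_zero[OF LIMSEQ_inverse_real_of_nat])
      then have "\<forall>\<^sub>F N in sequentially. (L * real (card A)) * inverse (real (Suc N)) < e / 3"
        by (rule order_tendstoD(2)) (use e in simp)
      then obtain N where "(L * real (card A)) * inverse (real (Suc N)) < e / 3" by (auto dest: eventually_happens)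
      then show ?thesis by (intro that[of N]) (simp only: divide_inverse)
    qed
    let ?T = "\<lambda>g. \<Sum>a\<in>PiE A (\<lambda>_. {..Suc N}). H (\<lambda>i. real (a i) / real (Suc N)) * g a"
    have "((\<lambda>\<epsilon>. ?T (\<lambda>a. LINT \<omega>|P. (\<Prod>i\<in>A. tent (Suc N) (a i) (s \<epsilon> \<omega> i))))
        \<longlongrightarrow> ?T (\<lambda>a. LINT \<omega>|Q. (\<Prod>i\<in>A. tent (Suc N) (a i) (t \<omega> i)))) F"
      by (intro tendsto_intros tents)
    then have "\<forall>\<^sub>F \<epsilon> in F. dist (?T (\<lambda>a. LINT \<omega>|P. (\<Prod>i\<in>A. tent (Suc N) (a i) (s \<epsilon> \<omega> i))))
        (?T (\<lambda>a. LINT \<omega>|Q. (\<Prod>i\<in>A. tent (Suc N) (a i) (t \<omega> i)))) < e / 3"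
      by (rule tendstoD) (use e in simp)
    then show "\<forall>\<^sub>F \<epsilon> in F. dist (LINT \<omega>|P. H (s \<epsilon> \<omega>)) (LINT \<omega>|Q. H (t \<omega>)) < e"
      using s(2)
    proof eventually_elim
      case (elim \<epsilon>)
      have "\<bar>(LINT \<omega>|P. H (s \<epsilon> \<omega>)) - ?T (\<lambda>a. LINT \<omega>|P. (\<Prod>i\<in>A. tent (Suc N) (a i) (s \<epsilon> \<omega> i)))\<bar> \<le> L * real (card A) / real (Suc N)"
        by (rule approx[OF P elim(2) s(1)])
      moreover have "\<bar>(LINT \<omega>|Q. H (t \<omega>)) - ?T (\<lambda>a. LINT \<omega>|Q. (\<Prod>i\<in>A. tent (Suc N) (a i) (t \<omega> i)))\<bar> \<le> L * real (card A) / real (Suc N)"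
        by (rule approx[OF Q _ t(1)]) (use t(2) in blast)
      ultimately show ?case using elim(1) N unfolding dist_real_def by linarith
    qed
  qed
qed

text \<open>
  The infimal convolutions \<open>H k\<close> of \<open>F\<close> depend on finitely many coordinates, are Lipschitz,
  and increase to \<open>F\<close> at its points of continuity. Applied to \<open>F\<close> and \<open>- F\<close>, the bound yields
  convergence of the expectations.
\<close>

lemma weak_lower_bound:
  fixes F :: "'y \<Rightarrow> real" and G :: "'y \<Rightarrow> nat \<times> nat \<Rightarrow> real" and X :: "'e \<Rightarrow> 'c \<Rightarrow> 'y" and Y :: "'d \<Rightarrow> 'y"
  assumes P: "prob_space P" and Q: "prob_space Q" and I: "finite I" and B: "\<And>y. y \<in> \<D> \<Longrightarrow> \<bar>F y\<bar> \<le> B"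
    and G01: "\<And>y p. G y p \<in> {0..1}"
    and XD: "\<forall>\<^sub>F \<epsilon> in \<F>. AE \<omega> in P. X \<epsilon> \<omega> \<in> \<D>" and YD: "AE \<omega> in Q. Y \<omega> \<in> \<D>"
    and XF: "\<forall>\<^sub>F \<epsilon> in \<F>. (\<lambda>\<omega>. F (X \<epsilon> \<omega>)) \<in> borel_measurable P" and YF: "(\<lambda>\<omega>. F (Y \<omega>)) \<in> borel_measurable Q"
    and XG: "\<forall>\<^sub>F \<epsilon> in \<F>. \<forall>p. (\<lambda>\<omega>. G (X \<epsilon> \<omega>) p) \<in> borel_measurable P"
    and YG: "\<And>p. (\<lambda>\<omega>. G (Y \<omega>) p) \<in> borel_measurable Q"
    and cont: "AE \<omega> in Q. \<forall>ys. (\<forall>n. ys n \<in> \<D>) \<longrightarrow> (\<forall>p\<in>I \<times> UNIV. (\<lambda>n. G (ys n) p) \<longlonglongrightarrow> G (Y \<omega>) p) \<longrightarrow>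
        (\<lambda>n. F (ys n)) \<longlonglongrightarrow> F (Y \<omega>)"
    and tents: "\<And>K N a. ((\<lambda>\<epsilon>. LINT \<omega>|P. (\<Prod>p\<in>I \<times> {..<K}. tent N (a p) (G (X \<epsilon> \<omega>) p)))
        \<longlongrightarrow> (LINT \<omega>|Q. (\<Prod>p\<in>I \<times> {..<K}. tent N (a p) (G (Y \<omega>) p)))) \<F>"
    and e: "e > 0"
  shows "\<forall>\<^sub>F \<epsilon> in \<F>. (LINT \<omega>|Q. F (Y \<omega>)) - e < (LINT \<omega>|P. F (X \<epsilon> \<omega>))"
proof -
  interpret P: prob_space P by (rule P)
  interpret Q: prob_space Q by (rule Q)
  obtain y0 where y0: "y0 \<in> \<D>"
    using YD by (cases "\<D> = {}") auto
  then have B0: "B \<ge> 0" using B[OF y0] by linarith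
  \<comment> \<open>The sum of absolute differences over the first \<open>k\<close> functionals of
    each component. In \<open>H\<close> it carries the factor \<open>k\<close>, so both the number
    of coordinates seen and the penalty grow with \<open>k\<close>.\<close>
  define d where "d = (\<lambda>k v w. \<Sum>p\<in>I \<times> {..<k :: nat}. \<bar>v p - w p :: real\<bar>)"
  define H where "H = (\<lambda>k v. INF y\<in>\<D>. F y + real k * d k v (G y))"
  have d0: "d k v w \<ge> 0" for k v w unfolding d_def by (intro sum_nonneg) auto
  have dtri: "d k v w \<le> d k v u + d k u w" for k v w u
    unfolding d_def sum.distrib[symmetric] by (intro sum_mono) linarith
  have bdd: "bdd_below ((\<lambda>y. F y + real k * d k v (G y)) ` \<D>)" for k v
  proof (rule bdd_belowI2)
    fix y assume "y \<in> \<D>"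
    moreover have "real k * d k v (G y) \<ge> 0" using d0 by simp
    ultimately show "- B \<le> F y + real k * d k v (G y)" using B[of y] by linarith
  qed
  have H_low: "- B \<le> H k v" for k v
    unfolding H_def
  proof (rule cINF_greatest)
    fix y assume "y \<in> \<D>"
    moreover have "real k * d k v (G y) \<ge> 0" using d0 by simp
    ultimately show "- B \<le> F y + real k * d k v (G y)" using B[of y] by linarith
  qed (use y0 in auto)
  have H_le: "H k v \<le> F y + real k * d k v (G y)" if "y \<in> \<D>" for k v y
    unfolding H_def by (rule cINF_lower[OF bdd that])
  have H_le_F: "H k (G y) \<le> F y" if "y \<in> \<D>" for k y
    using H_le[OF that, of k "G y"] by (simp add: d_def)
  have H_lip1: "H k v \<le> H k w + real k * d k v w" for k v w
  proof -
    have "H k v - real k * d k v w \<le> F y + real k * d k w (G y)" if "y \<in> \<D>" for y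
    proof -
      have "real k * d k v (G y) \<le> real k * (d k v w + d k w (G y))"
        by (intro mult_left_mono dtri) simp
      then show ?thesis using H_le[OF that, of k v] by (simp add: distrib_left)
    qed
    then have "H k v - real k * d k v w \<le> H k w"
      unfolding H_def by (intro cINF_greatest) (use y0 in \<open>auto simp: H_def\<close>)
    then show ?thesis by simp
  qed
  have dsym: "d k v w = d k w v" for k v w unfolding d_def by (intro sum.cong) (auto simp: abs_minus_commute)
  have H_lip: "\<bar>H k v - H k w\<bar> \<le> real k * (\<Sum>p\<in>I \<times> {..<k}. \<bar>v p - w p\<bar>)" for k v w
    using H_lip1[of k v w] H_lip1[of k w v] dsym[of k v w] unfolding d_def by (simp add: abs_le_iff)
  have H_conv: "AE \<omega> in Q. (\<lambda>k. H k (G (Y \<omega>))) \<longlonglongrightarrow> F (Y \<omega>)"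
    using cont YD
  proof eventually_elim
    case (elim \<omega>)
    \<comment> \<open>Near-minimisers of the infimum at \<open>G (Y \<omega>)\<close>. Their bounded
      penalties force their coordinates towards those of \<open>Y \<omega>\<close>, and the
      continuity assumption then determines the limit of their \<open>F\<close> values.\<close>
    have "\<exists>y\<in>\<D>. F y + real k * d k (G (Y \<omega>)) (G y) < H k (G (Y \<omega>)) + inverse (real (Suc k))" for k
    proof (rule cINF_less_iff[THEN iffD1])
      show "(INF y\<in>\<D>. F y + real k * d k (G (Y \<omega>)) (G y)) < H k (G (Y \<omega>)) + inverse (real (Suc k))"
        unfolding H_def by simp
    qed (use y0 bdd in auto)
    then obtain ys where ys: "\<And>k. ys k \<in> \<D>"
      "\<And>k. F (ys k) + real k * d k (G (Y \<omega>)) (G (ys k)) < H k (G (Y \<omega>)) + inverse (real (Suc k))" by metis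
    have small: "real k * d k (G (Y \<omega>)) (G (ys k)) \<le> 2 * B + 1" for k
    proof -
      have "inverse (real (Suc k)) \<le> 1" by (simp add: field_simps)
      \<comment> \<open>\<open>2 * B\<close> bounds what can be gained in \<open>F\<close>, and 1
        bounds the slack of the near-minimiser.\<close>
      then show ?thesis using ys(2)[of k] H_le_F[OF elim(2), of k] B[OF elim(2)] B[OF ys(1)[of k]] by linarith
    qed
    have "(\<lambda>n. G (ys n) p) \<longlonglongrightarrow> G (Y \<omega>) p" if p: "p \<in> I \<times> UNIV" for p
    proof (rule Lim_null[THEN iffD2], rule tendsto_rabs_zero_cancel,
        rule tendsto_sandwich[where f = "\<lambda>_. 0" and h = "\<lambda>n. (2 * B + 1) / real n"])
      show "\<forall>\<^sub>F n in sequentially. \<bar>G (ys n) p - G (Y \<omega>) p\<bar> \<le> (2 * B + 1) / real n"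
        \<comment> \<open>From then on the coordinate \<open>p\<close> is among those measured by
          \<open>d n\<close>.\<close>
        using eventually_gt_at_top[of "snd p"]
      proof eventually_elim
        case (elim n)
        have "\<bar>G (Y \<omega>) p - G (ys n) p\<bar> \<le> d n (G (Y \<omega>)) (G (ys n))"
          unfolding d_def using p elim I by (intro member_le_sum) auto
        also have "\<dots> \<le> (2 * B + 1) / real n" using small[of n] elim by (simp add: field_simps)
        finally show ?case by (simp add: abs_minus_commute)
      qed
      show "(\<lambda>n. (2 * B + 1) / real n) \<longlonglongrightarrow> 0" by (rule lim_const_over_n)
    qed auto
    then have Fys: "(\<lambda>n. F (ys n)) \<longlonglongrightarrow> F (Y \<omega>)" using elim(1) ys(1) by blast
    show ?case
    proof (rule tendsto_sandwich)
      show "\<forall>\<^sub>F k in sequentially. F (ys k) - inverse (real (Suc k)) \<le> H k (G (Y \<omega>))"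
      proof (intro always_eventually allI)
        fix k
        have "real k * d k (G (Y \<omega>)) (G (ys k)) \<ge> 0" using d0 by simp
        then show "F (ys k) - inverse (real (Suc k)) \<le> H k (G (Y \<omega>))" using ys(2)[of k] by linarith
      qed
      show "\<forall>\<^sub>F k in sequentially. H k (G (Y \<omega>)) \<le> F (Y \<omega>)" using H_le_F[OF elim(2)] by simp
      show "(\<lambda>k. F (ys k) - inverse (real (Suc k))) \<longlonglongrightarrow> F (Y \<omega>)"
        using tendsto_diff[OF Fys LIMSEQ_inverse_real_of_nat] by simp
    qed simp
  qed
  have fin: "finite (I \<times> {..<k})" for k :: nat using I by simp
  note lipH = lipschitz_expectation_tendsto[OF P Q fin of_nat_0_le_iff H_lip, where s = "\<lambda>\<epsilon> \<omega>. G (X \<epsilon> \<omega>)" and t = "\<lambda>\<omega>. G (Y \<omega>)" and F = \<F>]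
  have XG': "\<forall>\<^sub>F \<epsilon> in \<F>. \<forall>i\<in>I \<times> {..<k}. (\<lambda>\<omega>. G (X \<epsilon> \<omega>) i) \<in> borel_measurable P" for k
    using XG by eventually_elim blast
  have H_lim: "((\<lambda>\<epsilon>. LINT \<omega>|P. H k (G (X \<epsilon> \<omega>))) \<longlongrightarrow> (LINT \<omega>|Q. H k (G (Y \<omega>)))) \<F>"
    and H_intP: "\<forall>\<^sub>F \<epsilon> in \<F>. integrable P (\<lambda>\<omega>. H k (G (X \<epsilon> \<omega>)))"
    and H_intQ: "integrable Q (\<lambda>\<omega>. H k (G (Y \<omega>)))" for k
  proof -
    show "((\<lambda>\<epsilon>. LINT \<omega>|P. H k (G (X \<epsilon> \<omega>))) \<longlongrightarrow> (LINT \<omega>|Q. H k (G (Y \<omega>)))) \<F>"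
      by (rule lipH(1)) (rule G01 XG' YG tents)+
    show "\<forall>\<^sub>F \<epsilon> in \<F>. integrable P (\<lambda>\<omega>. H k (G (X \<epsilon> \<omega>)))"
      by (rule lipH(2)) (rule G01 XG' YG tents)+
    show "integrable Q (\<lambda>\<omega>. H k (G (Y \<omega>)))"
      by (rule lipH(3)) (rule G01 XG' YG tents)+
  qed
  have "(\<lambda>k. LINT \<omega>|Q. H k (G (Y \<omega>))) \<longlonglongrightarrow> (LINT \<omega>|Q. F (Y \<omega>))"
  proof (rule integral_dominated_convergence[where w = "\<lambda>_. B"])
    show "AE \<omega> in Q. norm (H k (G (Y \<omega>))) \<le> B" for k
      using YD
    proof eventually_elim
      case (elim \<omega>)
      then show ?case using H_low[of k "G (Y \<omega>)"] H_le_F[OF elim, of k] B[OF elim] by simp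
    qed
  qed (use H_conv H_intQ YF in auto)
  then have "\<forall>\<^sub>F k in sequentially. (LINT \<omega>|Q. F (Y \<omega>)) - e / 2 < (LINT \<omega>|Q. H k (G (Y \<omega>)))"
    by (rule order_tendstoD(1)) (use e in simp)
  then obtain k where k: "(LINT \<omega>|Q. F (Y \<omega>)) - e / 2 < (LINT \<omega>|Q. H k (G (Y \<omega>)))"
    by (auto dest: eventually_happens)
  have "\<forall>\<^sub>F \<epsilon> in \<F>. (LINT \<omega>|Q. H k (G (Y \<omega>))) - e / 2 < (LINT \<omega>|P. H k (G (X \<epsilon> \<omega>)))"
    by (rule order_tendstoD(1)[OF H_lim]) (use e in simp)
  then show ?thesis using H_intP[of k] XD XF
  proof eventually_elim
    case (elim \<epsilon>)
    have "(LINT \<omega>|P. H k (G (X \<epsilon> \<omega>))) \<le> (LINT \<omega>|P. F (X \<epsilon> \<omega>))"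
    proof (rule integral_mono_AE[OF elim(2)])
      show "integrable P (\<lambda>\<omega>. F (X \<epsilon> \<omega>))"
        by (rule P.integrable_const_bound[where B = B]) (use elim(3,4) B in \<open>auto elim!: eventually_mono\<close>)
      show "AE \<omega> in P. H k (G (X \<epsilon> \<omega>)) \<le> F (X \<epsilon> \<omega>)"
        using elim(3) by eventually_elim (rule H_le_F)
    qed
    then show ?case using k elim(1) by linarith
  qed
qed

section \<open>Reflection of paths and the signed level functionals\<close>

lemma hausdorff_dist_isometry:
  assumes "\<And>p q. dist (\<phi> p) (\<phi> q) = dist p q"
  shows "hausdorff_dist (\<phi> ` A) (\<phi> ` B) = hausdorff_dist A B"
proof -
  have "infdist (\<phi> p) (\<phi> ` C) = infdist p C" for p C
    by (simp add: infdist_def image_image assms)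
  then show ?thesis by (simp add: hausdorff_dist_def image_image)
qed

lemma completed_graph_uminus:
  assumes "x \<in> cadlag_paths"
  shows "completed_graph T (\<lambda>s. - x s) = (\<lambda>p. (fst p, - snd p)) ` completed_graph T x"
proof -
  have *: "(s, z) \<in> completed_graph T (\<lambda>s. - x s) \<longleftrightarrow> (s, - z) \<in> completed_graph T x" for s z
    using left_limit_uminus[OF assms(1), of s] by (auto simp: completed_graph_def mem_segment_iff)
  show ?thesis
  proof (intro set_eqI iffI)
    fix p assume "p \<in> completed_graph T (\<lambda>s. - x s)"
    then have "(fst p, - snd p) \<in> completed_graph T x" using *[of "fst p" "snd p"] by simp
    then show "p \<in> (\<lambda>p. (fst p, - snd p)) ` completed_graph T x" by (rule rev_image_eqI) simp
  next
    fix p assume "p \<in> (\<lambda>p. (fst p, - snd p)) ` completed_graph T x"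
    then show "p \<in> completed_graph T (\<lambda>s. - x s)" using * by auto
  qed
qed

lemma isCont_uminus_iff: "isCont (\<lambda>t. - x t :: real) T \<longleftrightarrow> isCont x T"
  using isCont_minus[of T x] isCont_minus[of T "\<lambda>t. - x t"] by auto

text \<open>Reflection of the values is an isometry of the plane that maps completed graphs to
  completed graphs, and it preserves the continuity points.\<close>

lemma M2_converges_uminus:
  assumes "x \<in> cadlag_paths" "\<And>n. xs n \<in> cadlag_paths" "M2_converges xs x"
  shows "M2_converges (\<lambda>n t. - xs n t) (\<lambda>t. - x t)"
proof -
  have "M2_dist T (\<lambda>t. - xs n t) (\<lambda>t. - x t) = M2_dist T (xs n) x" for T n
    unfolding M2_dist_def completed_graph_uminus[OF assms(1)] completed_graph_uminus[OF assms(2)]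
    by (rule hausdorff_dist_isometry) (simp add: dist_prod_def dist_minus)
  then show ?thesis using assms(3) by (simp add: M2_converges_def isCont_uminus_iff)
qed

text \<open>
  Countably many bounded functionals whose convergence is equivalent to M2 convergence: they embed
  the path space into a cube, whose total boundedness replaces tightness arguments below.
\<close>

definition signed_level :: "nat \<Rightarrow> (real \<Rightarrow> real) \<Rightarrow> real" where
  "signed_level k x = (case from_nat k of (q, j, b) \<Rightarrow> level q j (if b then x else (\<lambda>t. - x t)))"

lemma signed_level_bounds: "signed_level k x \<in> {0..1}"
  by (cases "from_nat k :: rat \<times> nat \<times> bool") (auto simp: signed_level_def level_bounds)

lemma signed_level_M2_converges:
  assumes "x \<in> cadlag_paths" "\<And>n. xs n \<in> cadlag_paths" "M2_converges xs x"
  shows "(\<lambda>n. signed_level k (xs n)) \<longlonglongrightarrow> signed_level k x"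
proof -
  obtain q j b where k: "(from_nat k :: rat \<times> nat \<times> bool) = (q, j, b)" by (metis prod_cases3)
  show ?thesis
    using level_M2_converges[OF assms, of q j]
      level_M2_converges[OF cadlag_minus[OF assms(1)] cadlag_minus[OF assms(2)] M2_converges_uminus[OF assms], of q j]
    by (cases b) (auto simp: signed_level_def k)
qed

text \<open>The flag coded in \<open>k\<close> selects \<open>x\<close> or \<open>- x\<close>; its
  two values yield the two halves of graph convergence.\<close>

lemma graph_converges_of_signed_levels:
  assumes x: "x \<in> cadlag_paths" and xs: "\<And>n. xs n \<in> cadlag_paths"
    and signed_level: "\<And>k. (\<lambda>n. signed_level k (xs n)) \<longlonglongrightarrow> signed_level k x"
  shows "graph_converges xs x"
  unfolding graph_converges_def
proof
  show "hypo_converges xs x"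
    by (rule hypo_converges_of_levels[OF x xs])
      (use signed_level[of "to_nat (_ :: rat, _ :: nat, True)"] in \<open>simp add: signed_level_def\<close>)
  show "hypo_converges (\<lambda>n t. - xs n t) (\<lambda>t. - x t)"
    by (rule hypo_converges_of_levels[OF cadlag_minus[OF x] cadlag_minus[OF xs]])
      (use signed_level[of "to_nat (_ :: rat, _ :: nat, False)"] in \<open>simp add: signed_level_def\<close>)
qed

lemma level_cong: "(\<And>t. t \<ge> 0 \<Longrightarrow> x t = y t) \<Longrightarrow> level q j x = level q j y"
  unfolding level_def by (intro SUP_cong) auto

lemma signed_level_cong:
  assumes "\<And>t. t \<ge> 0 \<Longrightarrow> x t = y t"
  shows "signed_level k x = signed_level k y"
  unfolding signed_level_def by (auto split: prod.split intro!: level_cong assms)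

lemma signed_level_measurable:
  assumes X: "\<And>t. t \<ge> 0 \<Longrightarrow> (\<lambda>\<omega>. X \<omega> t) \<in> borel_measurable G"
  shows "(\<lambda>\<omega>. signed_level k (X \<omega>)) \<in> borel_measurable G"
proof -
  obtain q j b where k: "(from_nat k :: rat \<times> nat \<times> bool) = (q, j, b)" by (metis prod_cases3)
  have main: "(\<lambda>\<omega>. level q j (W \<omega>)) \<in> borel_measurable G"
    if W: "\<And>t. t \<ge> 0 \<Longrightarrow> (\<lambda>\<omega>. W \<omega> t) \<in> borel_measurable G" for W
    unfolding level_def
  proof (rule borel_measurable_cSUP)
    show "countable {t::real. t \<ge> 0 \<and> t \<in> \<rat>}"
      by (rule countable_subset[OF _ countable_rat]) auto
    fix t :: real assume "t \<in> {t. t \<ge> 0 \<and> t \<in> \<rat>}"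
    then have [measurable]: "(\<lambda>\<omega>. W \<omega> t) \<in> borel_measurable G" using W by auto
    show "(\<lambda>\<omega>. window q j t * (2 + arctan (W \<omega> t)) / 4) \<in> borel_measurable G" by measurable
  qed (rule level_bdd)
  show ?thesis
    using main[OF X] main[of "\<lambda>\<omega> t. - X \<omega> t"] X by (cases b) (auto simp: signed_level_def k)
qed

section \<open>Scaled and sectioned processes\<close>

lemma cadlag_time_scale:
  assumes x: "x \<in> cadlag_paths" and a: "a > 0"
  shows "(\<lambda>t. x (a * t)) \<in> cadlag_paths"
proof -
  have "continuous (at_right t) (\<lambda>t. x (a * t))" if "t \<ge> 0" for t
  proof -
    have "(x \<longlongrightarrow> x (a * t)) (at_right (a * t))"
      using x that a by (auto simp: cadlag_paths_def continuous_within)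
    moreover have "LIM s at_right t. a * s :> at_right (a * t)"
      unfolding filterlim_at using a
      by (auto intro!: tendsto_intros simp: eventually_at_filter)
    ultimately have "((\<lambda>t. x (a * t)) \<longlongrightarrow> x (a * t)) (at_right t)" by (rule filterlim_compose)
    then show ?thesis by (simp add: continuous_within)
  qed
  moreover have "\<exists>l. ((\<lambda>t. x (a * t)) \<longlongrightarrow> l) (at_left t)" if "t > 0" for t
  proof -
    have "(x \<longlongrightarrow> left_limit x (a * t)) (at_left (a * t))" using x a that by (intro left_limit_tendsto) auto
    moreover have "LIM s at_left t. a * s :> at_left (a * t)"
      unfolding filterlim_at using a
      by (auto intro!: tendsto_intros simp: eventually_at_filter)
    ultimately show ?thesis using filterlim_compose by blast
  qed
  ultimately show ?thesis by (auto simp: cadlag_paths_def)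
qed

lemma centred_scaling_cadlag:
  assumes x: "Z \<omega> \<in> cadlag_paths" and e: "\<epsilon> > 0"
  shows "centred_scaling \<mu> h l Z \<epsilon> \<omega> \<in> cadlag_paths"
proof -
  have "(\<lambda>t. \<epsilon> powr h * l (1 / \<epsilon>) * (Z \<omega> (1 / \<epsilon> * t) + (- \<mu> / \<epsilon>) * t)) \<in> cadlag_paths"
    using e by (intro cadlag_mult cadlag_const cadlag_add cadlag_time_scale[OF x] cadlag_of_continuous) (auto intro: continuous_intros)
  then show ?thesis by (simp add: centred_scaling_def mult.commute)
qed

lemma process_centred_scaling:
  assumes Z: "process M cadlag_paths Z" and e: "\<epsilon> > 0"
  shows "process M cadlag_paths (centred_scaling \<mu> h l Z \<epsilon>)"
  unfolding process_def
proof (intro conjI allI impI)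
  fix t :: real assume "t \<ge> 0"
  then have [measurable]: "(\<lambda>\<omega>. Z \<omega> (t / \<epsilon>)) \<in> borel_measurable (completion M)"
    using e by (intro processD(1)[OF Z]) auto
  show "(\<lambda>\<omega>. centred_scaling \<mu> h l Z \<epsilon> \<omega> t) \<in> borel_measurable (completion M)"
    unfolding centred_scaling_def by measurable
next
  show "AE \<omega> in M. centred_scaling \<mu> h l Z \<epsilon> \<omega> \<in> cadlag_paths"
    using processD(2)[OF Z] by eventually_elim (rule centred_scaling_cadlag[OF _ e])
qed

lemma AE_all_cadlag:
  assumes "\<And>i. i \<in> {1..m} \<Longrightarrow> process M cadlag_paths (X i)"
  shows "AE \<omega> in M. \<forall>i\<in>{1..m :: nat}. X i \<omega> \<in> cadlag_paths"
  using processD(2)[OF assms] by (intro AE_finite_allI) auto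

lemma process_section_mean:
  assumes X: "\<And>i. i \<in> {1..m} \<Longrightarrow> process M cadlag_paths (X i)"
  shows "process M cadlag_paths (section_mean m X)"
  unfolding process_def
proof (intro conjI allI impI)
  have "AE \<omega> in M. \<forall>i\<in>{1..m}. X i \<omega> \<in> cadlag_paths" using X by (rule AE_all_cadlag)
  then show "AE \<omega> in M. section_mean m X \<omega> \<in> cadlag_paths"
    by eventually_elim (unfold section_mean_path[of m X], rule pmean_cadlag, blast)
qed (rule section_mean_measurable[OF _ X])

lemma section_variance_continuous:
  assumes m: "m \<ge> 2" and X: "\<And>i. i \<in> {1..m} \<Longrightarrow> process M cadlag_paths (X i)"
    and X0: "\<And>i. i \<in> {1..m} \<Longrightarrow> AE \<omega> in M. X i \<omega> 0 = 0"
  shows "AE \<omega> in M. continuous_on {0..} (section_variance m X \<omega>)"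
proof -
  have "AE \<omega> in M. \<forall>i\<in>{1..m}. X i \<omega> \<in> cadlag_paths" using X by (rule AE_all_cadlag)
  moreover have "AE \<omega> in M. \<forall>i\<in>{1..m}. X i \<omega> 0 = 0" using X0 by (intro AE_finite_allI) auto
  ultimately show ?thesis
    by eventually_elim (unfold section_variance_path[of m X], rule pvar_continuous[OF m], blast+)
qed

lemma process_section_variance:
  assumes m: "m \<ge> 2" and X: "\<And>i. i \<in> {1..m} \<Longrightarrow> process M cadlag_paths (X i)"
    and X0: "\<And>i. i \<in> {1..m} \<Longrightarrow> AE \<omega> in M. X i \<omega> 0 = 0"
  shows "process M cadlag_paths_nonneg (section_variance m X)"
    and "process M cadlag_paths (\<lambda>\<omega> t. sqrt (section_variance m X \<omega> t))"
proof -
  have cont: "AE \<omega> in M. continuous_on {0..} (section_variance m X \<omega>)"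
    using assms by (rule section_variance_continuous)
  have nn: "section_variance m X \<omega> t \<ge> 0" for \<omega> t
    unfolding section_variance_path[of m X] using m by (intro pvar_nonneg) simp
  show "process M cadlag_paths_nonneg (section_variance m X)"
    unfolding process_def
  proof (intro conjI allI impI)
    show "AE \<omega> in M. section_variance m X \<omega> \<in> cadlag_paths_nonneg"
      using cont
      by eventually_elim (simp add: cadlag_paths_nonneg_def cadlag_of_continuous nn)
  qed (rule section_variance_measurable[OF _ X])
  show "process M cadlag_paths (\<lambda>\<omega> t. sqrt (section_variance m X \<omega> t))"
    unfolding process_def
  proof (intro conjI allI impI)
    show "AE \<omega> in M. (\<lambda>t. sqrt (section_variance m X \<omega> t)) \<in> cadlag_paths"
      using cont
      by eventually_elim (intro cadlag_of_continuous continuous_intros)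
    fix t :: real assume "t \<ge> 0"
    then have [measurable]: "(\<lambda>\<omega>. section_variance m X \<omega> t) \<in> borel_measurable (completion M)"
      using X by (rule section_variance_measurable)
    show "(\<lambda>\<omega>. sqrt (section_variance m X \<omega> t)) \<in> borel_measurable (completion M)" by measurable
  qed
qed

section \<open>Path laws and expectations of independent products\<close>

lemma restrict_path_measurable:
  assumes X: "process M D X"
  shows "(\<lambda>\<omega>. restrict (X \<omega>) {0..}) \<in> completion M \<rightarrow>\<^sub>M path_algebra"
  using processD(1)[OF X] by (intro measurable_restrict) auto

text \<open>The law lives on functions restricted to nonnegative times; a functional that ignores
  negative times has the same value on the full path.\<close>

lemma path_law_integral:
  fixes g :: "(real \<Rightarrow> real) \<Rightarrow> real"
  assumes X: "process M D X" and g: "g \<in> borel_measurable path_algebra" and r: "\<And>x. g (restrict x {0..}) = g x"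
  shows "(LINT \<omega>|completion M. g (X \<omega>)) = (LINT z|path_law M X. g z)"
  unfolding path_law_def by (subst integral_distr[OF restrict_path_measurable[OF X] g]) (simp add: r)

text \<open>The vehicle for moving almost sure properties between probability spaces: once two laws
  agree, the property is read off on one side and asserted on the other.\<close>

lemma path_law_AE:
  assumes X: "process M D X" and g: "Measurable.pred path_algebra P" and r: "\<And>x. P (restrict x {0..}) = P x"
  shows "(AE \<omega> in M. P (X \<omega>)) \<longleftrightarrow> (AE z in path_law M X. P z)"
proof -
  have "(AE z in path_law M X. P z) \<longleftrightarrow> (AE \<omega> in completion M. P (restrict (X \<omega>) {0..}))"
    unfolding path_law_def
    by (rule AE_distr_iff[OF restrict_path_measurable[OF X]]) (use g in \<open>simp add: pred_def\<close>)
  then show ?thesis by (simp add: r AE_completion_iff)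
qed

lemma path_component_measurable: "t \<ge> 0 \<Longrightarrow> (\<lambda>z. z t) \<in> borel_measurable path_algebra"
  by (rule measurable_component_singleton) simp

text \<open>Independence concerns the restricted paths, hence the insensitivity \<open>r\<close> to
  negative times. The bound by 1 makes every factor integrable, and equality of laws replaces each
  factor by an expectation over the original space.\<close>

lemma indep_path_product:
  fixes \<psi> :: "'i \<Rightarrow> (real \<Rightarrow> real) \<Rightarrow> real"
  assumes M: "prob_space M" and ind: "independent_copies M0 X0 M X I" and I: "finite I" and X0: "process M0 cadlag_paths X0"
    and g: "\<And>i. i \<in> I \<Longrightarrow> \<psi> i \<in> borel_measurable path_algebra"
    and r: "\<And>i x. i \<in> I \<Longrightarrow> \<psi> i (restrict x {0..}) = \<psi> i x"
    and b: "\<And>i x. i \<in> I \<Longrightarrow> \<bar>\<psi> i x\<bar> \<le> 1"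
  shows "(LINT \<omega>|completion M. (\<Prod>i\<in>I. \<psi> i (X i \<omega>))) = (\<Prod>i\<in>I. LINT \<omega>|completion M0. \<psi> i (X0 \<omega>))"
proof -
  interpret C: prob_space "completion M" by (rule prob_space.prob_space_completion[OF M])
  have X: "process M cadlag_paths (X i)" and law: "path_law M (X i) = path_law M0 X0" if "i \<in> I" for i
    using ind that by (auto simp: independent_copies_def)
  have iv: "C.indep_vars (\<lambda>_. path_algebra) (\<lambda>i \<omega>. restrict (X i \<omega>) {0..}) I"
    using ind by (simp add: independent_copies_def)
  have iv2: "C.indep_vars (\<lambda>_. borel) (\<lambda>i \<omega>. \<psi> i (restrict (X i \<omega>) {0..})) I"
    by (rule C.indep_vars_compose2[OF iv]) (rule g)
  have int: "integrable (completion M) (\<lambda>\<omega>. \<psi> i (restrict (X i \<omega>) {0..}))" if i: "i \<in> I" for i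
    by (rule C.integrable_const_bound[where B = 1])
      (use b[OF i] measurable_compose[OF restrict_path_measurable[OF X[OF i]] g[OF i]] in auto)
  have "(LINT \<omega>|completion M. (\<Prod>i\<in>I. \<psi> i (X i \<omega>))) = (LINT \<omega>|completion M. (\<Prod>i\<in>I. \<psi> i (restrict (X i \<omega>) {0..})))"
    by (simp add: r)
  also have "\<dots> = (\<Prod>i\<in>I. LINT \<omega>|completion M. \<psi> i (restrict (X i \<omega>) {0..}))"
    by (rule C.indep_vars_lebesgue_integral[OF I iv2 int])
  also have "\<dots> = (\<Prod>i\<in>I. LINT \<omega>|completion M0. \<psi> i (X0 \<omega>))"
  proof (rule prod.cong[OF refl])
    fix i assume i: "i \<in> I"
    have "(LINT \<omega>|completion M. \<psi> i (restrict (X i \<omega>) {0..})) = (LINT z|path_law M (X i). \<psi> i z)"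
      using path_law_integral[OF X[OF i] g[OF i] r[OF i]] by (simp add: r[OF i])
    also have "\<dots> = (LINT \<omega>|completion M0. \<psi> i (X0 \<omega>))"
      unfolding law[OF i] by (rule path_law_integral[OF X0 g[OF i] r[OF i], symmetric])
    finally show "(LINT \<omega>|completion M. \<psi> i (restrict (X i \<omega>) {0..})) = (LINT \<omega>|completion M0. \<psi> i (X0 \<omega>))" .
  qed
  finally show ?thesis .
qed

lemma signed_level_product_continuous_map:
  "continuous_map M2_topology euclideanreal (\<lambda>x. \<Prod>k<K. tent N (a k) (signed_level k x))"
proof (rule continuous_map_M2I)
  fix x xs assume *: "x \<in> cadlag_paths" "\<And>n. xs n \<in> cadlag_paths" "M2_converges xs x"
  show "(\<lambda>n. \<Prod>k<K. tent N (a k) (signed_level k (xs n))) \<longlonglongrightarrow> (\<Prod>k<K. tent N (a k) (signed_level k x))"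
    by (intro tendsto_prod continuous_on_tendsto_compose[OF tent_continuous] signed_level_M2_converges[OF *]) auto
qed

lemma signed_level_product_bound: "\<bar>\<Prod>k<K. tent N (a k) (signed_level k x)\<bar> \<le> 1"
  by (auto simp: abs_prod tent_bounds intro!: prod_le_1)

lemma signed_level_product_measurable:
  assumes "\<And>t. t \<ge> 0 \<Longrightarrow> (\<lambda>\<omega>. X \<omega> t) \<in> borel_measurable G"
  shows "(\<lambda>\<omega>. \<Prod>k<K. tent N (a k) (signed_level k (X \<omega>))) \<in> borel_measurable G"
  using assms by (intro borel_measurable_prod measurable_compose[OF _ tent_measurable] signed_level_measurable)

text \<open>\<open>S\<close> is the identity for the limits and the centred scaling for the original
  processes, so that one factorisation serves both.\<close>

lemma expectation_signed_level_product:
  assumes M: "prob_space M" and ind: "independent_copies M0 X0 M X I" and I: "finite I" and X0: "process M0 cadlag_paths X0"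
    and S: "\<And>t. t \<ge> 0 \<Longrightarrow> (\<lambda>z. S z t) \<in> borel_measurable path_algebra"
    and S_restrict: "\<And>x t. t \<ge> 0 \<Longrightarrow> S (restrict x {0..}) t = S x t"
  shows "(LINT \<omega>|completion M. (\<Prod>p\<in>I \<times> {..<K}. tent N (a p) (signed_level (snd p) (S (X (fst p) \<omega>)))))
      = (\<Prod>i\<in>I. LINT \<omega>|completion M0. (\<Prod>k<K. tent N (a (i, k)) (signed_level k (S (X0 \<omega>)))))"
proof -
  have "(\<Prod>p\<in>I \<times> {..<K}. tent N (a p) (signed_level (snd p) (S (X (fst p) \<omega>))))
      = (\<Prod>i\<in>I. \<Prod>k<K. tent N (a (i, k)) (signed_level k (S (X i \<omega>))))" for \<omega>
    by (simp add: prod.cartesian_product case_prod_beta')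
  moreover have "(LINT \<omega>|completion M. (\<Prod>i\<in>I. \<Prod>k<K. tent N (a (i, k)) (signed_level k (S (X i \<omega>)))))
      = (\<Prod>i\<in>I. LINT \<omega>|completion M0. (\<Prod>k<K. tent N (a (i, k)) (signed_level k (S (X0 \<omega>)))))"
  proof (rule indep_path_product[OF M ind I X0, of "\<lambda>i x. \<Prod>k<K. tent N (a (i, k)) (signed_level k (S x))"])
    fix i and x :: "real \<Rightarrow> real"
    show "(\<lambda>x. \<Prod>k<K. tent N (a (i, k)) (signed_level k (S x))) \<in> borel_measurable path_algebra"
      by (rule signed_level_product_measurable[OF S])
    have "signed_level k (S (restrict x {0..})) = signed_level k (S x)" for k by (rule signed_level_cong[OF S_restrict])
    then show "(\<Prod>k<K. tent N (a (i, k)) (signed_level k (S (restrict x {0..})))) = (\<Prod>k<K. tent N (a (i, k)) (signed_level k (S x)))"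
      by simp
    show "\<bar>\<Prod>k<K. tent N (a (i, k)) (signed_level k (S x))\<bar> \<le> 1" by (rule signed_level_product_bound)
  qed
  ultimately show ?thesis by simp
qed

text \<open>Scaling commutes with both section functionals: the drift passes through the mean and
  cancels in the variance. The sign condition \<open>c\<close> lets the constant pass through the
  root as itself instead of its absolute value.\<close>

lemma section_scaling:
  assumes m: "m \<ge> 1" and e: "\<epsilon> > 0" and c: "\<epsilon> powr h * l (1 / \<epsilon>) \<ge> 0"
  shows "centred_scaling \<mu> h l (section_mean m Z) \<epsilon> \<omega> = pmean m (\<lambda>i. centred_scaling \<mu> h l (Z i) \<epsilon> \<omega>)"
    and "sqrt_scaling h l (section_variance m Z) \<epsilon> \<omega> = (\<lambda>t. sqrt (pvar m (\<lambda>i. centred_scaling \<mu> h l (Z i) \<epsilon> \<omega>) t))"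
proof -
  define k where "k = \<epsilon> powr h * l (1 / \<epsilon>)"
  show "centred_scaling \<mu> h l (section_mean m Z) \<epsilon> \<omega> = pmean m (\<lambda>i. centred_scaling \<mu> h l (Z i) \<epsilon> \<omega>)"
  proof
    fix t
    have "k * (1 / real m * (\<Sum>i=1..m. Z i \<omega> (t / \<epsilon>)) - t / \<epsilon> * \<mu>)
        = 1 / real m * (\<Sum>i=1..m. k * (Z i \<omega> (t / \<epsilon>) - t / \<epsilon> * \<mu>))"
      using m by (simp add: sum_subtractf right_diff_distrib flip: sum_distrib_left)
    then show "centred_scaling \<mu> h l (section_mean m Z) \<epsilon> \<omega> t = pmean m (\<lambda>i. centred_scaling \<mu> h l (Z i) \<epsilon> \<omega>) t"
      by (simp only: centred_scaling_def section_mean_def k_def)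
  qed
  show "sqrt_scaling h l (section_variance m Z) \<epsilon> \<omega> = (\<lambda>t. sqrt (pvar m (\<lambda>i. centred_scaling \<mu> h l (Z i) \<epsilon> \<omega>) t))"
  proof
    fix t
    \<comment> \<open>The centring appears as a drift common to all sections, the form that the
      affine rule for the variance expects.\<close>
    have "(\<lambda>i. centred_scaling \<mu> h l (Z i) \<epsilon> \<omega>) = (\<lambda>i s. k * Z i \<omega> (inverse \<epsilon> * s) + (- k * \<mu> * inverse \<epsilon>) * s)"
      by (simp add: centred_scaling_def k_def fun_eq_iff field_simps)
    then have "pvar m (\<lambda>i. centred_scaling \<mu> h l (Z i) \<epsilon> \<omega>) t = k\<^sup>2 * pvar m (\<lambda>i. Z i \<omega>) (inverse \<epsilon> * t)"
      using pvar_affine[OF m, of "inverse \<epsilon>" k "\<lambda>i. Z i \<omega>" "\<lambda>s. (- k * \<mu> * inverse \<epsilon>) * s" t] e by simp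
    then show "sqrt_scaling h l (section_variance m Z) \<epsilon> \<omega> t = sqrt (pvar m (\<lambda>i. centred_scaling \<mu> h l (Z i) \<epsilon> \<omega>) t)"
      using c by (simp add: sqrt_scaling_def section_variance_path[of m Z] k_def real_sqrt_mult divide_inverse mult.commute)
  qed
qed

section \<open>Weak convergence of the pair of mean and root of the variance\<close>

theorem joint_scaling_limit_of_sections:
  assumes M0: "prob_space M0" and N0: "prob_space N0" and M: "prob_space M" and N: "prob_space N"
    and m: "m \<ge> 2"
    and Z1: "process M0 cadlag_paths Z1" and Y1: "process N0 cadlag_paths Y1"
    and l: "\<forall>\<^sub>F x in at_top. l x > 0"
    and conv: "converges_weakly M2_topology M0 (centred_scaling \<mu> h l Z1) N0 Y1 (at_right 0)"
    and indZ: "independent_copies M0 Z1 M Z {1..m}" and indY: "independent_copies N0 Y1 N Y {1..m}"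
    and Z0: "\<And>i. i \<in> {1..m} \<Longrightarrow> AE \<omega> in M. Z i \<omega> 0 = 0"
    and Y0: "\<And>i. i \<in> {1..m} \<Longrightarrow> AE \<omega> in N. Y i \<omega> 0 = 0"
    and jumps: "AE \<omega> in N. \<forall>i\<in>{1..m}. \<forall>j\<in>{1..m}. i \<noteq> j \<longrightarrow> (\<forall>t>0. isCont (Y i \<omega>) t \<or> isCont (Y j \<omega>) t)"
  shows "joint_scaling_limit M (section_mean m Z) (section_variance m Z) \<mu> h l
           N (section_mean m Y) (section_variance m Y)"
proof -
  have Zp: "process M cadlag_paths (Z i)" and Yp: "process N cadlag_paths (Y i)" if "i \<in> {1..m}" for i
    using indZ indY that by (auto simp: independent_copies_def)
  have P: "prob_space (completion M)" and Q: "prob_space (completion N)"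
    using M N by (auto intro: prob_space.prob_space_completion)
  \<comment> \<open>Families of paths starting at 0, on which \<open>\<Phi>\<close> takes values in
    pairs of cadlag paths; both sides of the limit belong to it almost surely.\<close>
  define \<D> where "\<D> = {y :: nat \<Rightarrow> real \<Rightarrow> real. \<forall>i\<in>{1..m}. y i \<in> cadlag_paths \<and> y i 0 = 0}"
  define G where "G = (\<lambda>(y :: nat \<Rightarrow> real \<Rightarrow> real) p. signed_level (snd p) (y (fst p)))"
  \<comment> \<open>The zero path outside the index range makes every coordinate of \<open>G\<close>
    measurable, as the bound for expectations asks for all of them.\<close>
  define X where "X = (\<lambda>\<epsilon> \<omega> i. if i \<in> {1..m} then centred_scaling \<mu> h l (Z i) \<epsilon> \<omega> else (\<lambda>_. 0))"
  define W where "W = (\<lambda>\<omega> i. if i \<in> {1..m} then Y i \<omega> else (\<lambda>_. 0))"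
  define \<Phi> where "\<Phi> = (\<lambda>y. (pmean m y, (\<lambda>t. sqrt (pvar m y t))))"
  have \<Phi>D: "fst (\<Phi> y) \<in> cadlag_paths" "snd (\<Phi> y) \<in> cadlag_paths" if "y \<in> \<D>" for y
  proof -
    show "fst (\<Phi> y) \<in> cadlag_paths" using that unfolding \<Phi>_def \<D>_def by (auto intro: pmean_cadlag)
    have "continuous_on {0..} (pvar m y)" using that by (intro pvar_continuous m) (auto simp: \<D>_def)
    then show "snd (\<Phi> y) \<in> cadlag_paths" unfolding \<Phi>_def snd_conv
      by (intro cadlag_of_continuous continuous_intros)
  qed
  \<comment> \<open>The scaling constant is known to be nonnegative only for small
    \<open>\<epsilon>\<close>, because \<open>l\<close> is only eventually positive; the statements
    before the limit are eventual for this reason.\<close>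
  have pos: "\<forall>\<^sub>F \<epsilon> in at_right (0::real). \<epsilon> > 0 \<and> \<epsilon> powr h * l (1 / \<epsilon>) \<ge> 0"
  proof -
    have "\<forall>\<^sub>F \<epsilon> in at_right 0. l (inverse \<epsilon>) > 0"
      using filterlim_inverse_at_top_right l by (rule eventually_compose_filterlim[rotated])
    moreover have "\<forall>\<^sub>F \<epsilon> in at_right (0::real). \<epsilon> > 0" by (rule eventually_at_right_less)
    ultimately show ?thesis by eventually_elim (simp add: inverse_eq_divide)
  qed
  have Xeq: "\<Phi> (X \<epsilon> \<omega>) = (centred_scaling \<mu> h l (section_mean m Z) \<epsilon> \<omega>, sqrt_scaling h l (section_variance m Z) \<epsilon> \<omega>)"
    if "\<epsilon> > 0 \<and> \<epsilon> powr h * l (1 / \<epsilon>) \<ge> 0" for \<epsilon> \<omega>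
  proof -
    have "pmean m (X \<epsilon> \<omega>) = pmean m (\<lambda>i. centred_scaling \<mu> h l (Z i) \<epsilon> \<omega>)"
      "pvar m (X \<epsilon> \<omega>) = pvar m (\<lambda>i. centred_scaling \<mu> h l (Z i) \<epsilon> \<omega>)"
      by (auto simp: X_def intro!: pmean_cong pvar_cong)
    then show ?thesis using section_scaling[where m = m and \<epsilon> = \<epsilon> and h = h and l = l and \<mu> = \<mu> and Z = Z and \<omega> = \<omega>] m that by (simp add: \<Phi>_def)
  qed
  have Weq: "\<Phi> (W \<omega>) = (section_mean m Y \<omega>, (\<lambda>t. sqrt (section_variance m Y \<omega> t)))" for \<omega>
  proof -
    have "pmean m (W \<omega>) = pmean m (\<lambda>i. Y i \<omega>)" "pvar m (W \<omega>) = pvar m (\<lambda>i. Y i \<omega>)"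
      by (auto simp: W_def intro!: pmean_cong pvar_cong)
    then show ?thesis by (simp add: \<Phi>_def section_mean_path[of m Y] section_variance_path[of m Y])
  qed
  have YD: "AE \<omega> in N. W \<omega> \<in> \<D>"
  proof -
    have "AE \<omega> in N. \<forall>i\<in>{1..m}. Y i \<omega> 0 = 0" using Y0 by (intro AE_finite_allI) auto
    moreover have "AE \<omega> in N. \<forall>i\<in>{1..m}. Y i \<omega> \<in> cadlag_paths" using Yp by (rule AE_all_cadlag)
    ultimately show ?thesis by eventually_elim (auto simp: \<D>_def W_def)
  qed
  have XD: "AE \<omega> in M. X \<epsilon> \<omega> \<in> \<D>" if "\<epsilon> > 0" for \<epsilon>
  proof -
    have "AE \<omega> in M. \<forall>i\<in>{1..m}. Z i \<omega> 0 = 0" using Z0 by (intro AE_finite_allI) auto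
    moreover have "AE \<omega> in M. \<forall>i\<in>{1..m}. Z i \<omega> \<in> cadlag_paths" using Zp by (rule AE_all_cadlag)
    ultimately show ?thesis
    proof eventually_elim
      case (elim \<omega>)
      then show ?case
        using centred_scaling_cadlag[OF _ that, of "Z _" \<omega> \<mu> h l] by (auto simp: \<D>_def X_def centred_scaling_def[of _ _ _ _ _ _, THEN fun_cong])
    qed
  qed
  have main: "\<forall>\<^sub>F \<epsilon> in at_right 0. (LINT \<omega>|completion N. f (\<Phi> (W \<omega>))) - e < (LINT \<omega>|completion M. f (\<Phi> (X \<epsilon> \<omega>)))"
    if f: "continuous_map WM2_topology euclideanreal f" and B: "\<And>x. x \<in> topspace WM2_topology \<Longrightarrow> \<bar>f x\<bar> \<le> B" and e: "e > 0"
    for f :: "(real \<Rightarrow> real) \<times> (real \<Rightarrow> real) \<Rightarrow> real" and B e :: real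
  proof (rule weak_lower_bound[OF P Q, where I = "{1..m}" and \<D> = \<D> and G = G and B = B and F = "\<lambda>y. f (\<Phi> y)"])
    have seq: "(\<lambda>n. f (us n, vs n)) \<longlonglongrightarrow> f (u, v)"
      if "u \<in> cadlag_paths" "\<And>n. us n \<in> cadlag_paths" "graph_converges us u"
        "v \<in> cadlag_paths" "\<And>n. vs n \<in> cadlag_paths" "graph_converges vs v" for u us v vs
      by (rule continuous_map_WM2_tendsto[OF f]) (intro that graph_converges_M2)+
    show "finite {1..m}" by simp
    show "\<bar>f (\<Phi> y)\<bar> \<le> B" if "y \<in> \<D>" for y
      using \<Phi>D[OF that] by (intro B) (auto simp: WM2_topology_def mem_Times_iff)
    show "G y p \<in> {0..1}" for y p unfolding G_def by (rule signed_level_bounds)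
    show "\<forall>\<^sub>F \<epsilon> in at_right 0. AE \<omega> in completion M. X \<epsilon> \<omega> \<in> \<D>"
      using pos by eventually_elim (auto intro: AE_completion XD)
    show "AE \<omega> in completion N. W \<omega> \<in> \<D>" by (rule AE_completion[OF YD])
    show "\<forall>\<^sub>F \<epsilon> in at_right 0. (\<lambda>\<omega>. f (\<Phi> (X \<epsilon> \<omega>))) \<in> borel_measurable (completion M)"
      using pos
    proof eventually_elim
      case (elim \<epsilon>)
      define C where "C = (\<lambda>i. centred_scaling \<mu> h l (Z i) \<epsilon>)"
      have C: "process M cadlag_paths (C i)" if "i \<in> {1..m}" for i
        unfolding C_def using Zp[OF that] elim by (intro process_centred_scaling) auto
      have C0: "AE \<omega> in M. C i \<omega> 0 = 0" if "i \<in> {1..m}" for i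
        using Z0[OF that] by eventually_elim (simp add: C_def centred_scaling_def)
      have "(\<lambda>\<omega>. f (section_mean m C \<omega>, (\<lambda>t. sqrt (section_variance m C \<omega> t)))) \<in> borel_measurable (completion M)"
      proof (rule continuous_functional_measurable[where f = f])
        show "process M cadlag_paths (section_mean m C)" using C by (rule process_section_mean)
        show "process M cadlag_paths (\<lambda>\<omega> t. sqrt (section_variance m C \<omega> t))"
          using m C C0 by (rule process_section_variance(2))
      qed (blast intro: seq)
      moreover have "\<Phi> (X \<epsilon> \<omega>) = (section_mean m C \<omega>, (\<lambda>t. sqrt (section_variance m C \<omega> t)))" for \<omega>
      proof -
        have "pmean m (X \<epsilon> \<omega>) = pmean m (\<lambda>i. C i \<omega>)" "pvar m (X \<epsilon> \<omega>) = pvar m (\<lambda>i. C i \<omega>)"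
          by (auto simp: X_def C_def intro!: pmean_cong pvar_cong)
        then show ?thesis by (simp add: \<Phi>_def section_mean_path[of m C] section_variance_path[of m C])
      qed
      ultimately show ?case by simp
    qed
    show "(\<lambda>\<omega>. f (\<Phi> (W \<omega>))) \<in> borel_measurable (completion N)"
      unfolding Weq
    proof (rule continuous_functional_measurable[where f = f])
      show "process N cadlag_paths (section_mean m Y)" using Yp by (rule process_section_mean)
      show "process N cadlag_paths (\<lambda>\<omega> t. sqrt (section_variance m Y \<omega> t))"
        using m Yp Y0 by (rule process_section_variance(2))
    qed (blast intro: seq)
    show "\<forall>\<^sub>F \<epsilon> in at_right 0. \<forall>p. (\<lambda>\<omega>. G (X \<epsilon> \<omega>) p) \<in> borel_measurable (completion M)"
      using pos
    proof eventually_elim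
      case (elim \<epsilon>)
      have "(\<lambda>\<omega>. X \<epsilon> \<omega> i t) \<in> borel_measurable (completion M)" if "t \<ge> 0" for i t
        using processD(1)[OF process_centred_scaling[OF Zp, of i \<epsilon> \<mu> h l] that] elim by (cases "i \<in> {1..m}") (auto simp: X_def)
      then show ?case unfolding G_def by (intro allI signed_level_measurable)
    qed
    have "(\<lambda>\<omega>. W \<omega> i t) \<in> borel_measurable (completion N)" if "t \<ge> 0" for i t
      using processD(1)[OF Yp that, of i] by (cases "i \<in> {1..m}") (auto simp: W_def)
    then show "(\<lambda>\<omega>. G (W \<omega>) p) \<in> borel_measurable (completion N)" for p unfolding G_def by (intro signed_level_measurable)
    show "AE \<omega> in completion N. \<forall>ys. (\<forall>n. ys n \<in> \<D>) \<longrightarrow> (\<forall>p\<in>{1..m} \<times> UNIV. (\<lambda>n. G (ys n) p) \<longlonglongrightarrow> G (W \<omega>) p) \<longrightarrow>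
        (\<lambda>n. f (\<Phi> (ys n))) \<longlonglongrightarrow> f (\<Phi> (W \<omega>))"
      using AE_completion[OF YD] AE_completion[OF jumps]
    proof eventually_elim
      case (elim \<omega>)
      show ?case
      proof (intro allI impI)
        fix ys assume ys: "\<forall>n. ys n \<in> \<D>" and lim: "\<forall>p\<in>{1..m} \<times> UNIV. (\<lambda>n. G (ys n) p) \<longlonglongrightarrow> G (W \<omega>) p"
        have yc: "ys n i \<in> cadlag_paths" if "i \<in> {1..m}" for n i using ys that by (auto simp: \<D>_def)
        have wc: "W \<omega> i \<in> cadlag_paths" "W \<omega> i 0 = 0" if "i \<in> {1..m}" for i using elim(1) that by (auto simp: \<D>_def)
        \<comment> \<open>Convergence of the coordinates in the cube is graph convergence of each
          section; the absence of common jumps then admits the mean, and the start at 0 the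
          variance.\<close>
        have g: "graph_converges (\<lambda>n. ys n i) (W \<omega> i)" if i: "i \<in> {1..m}" for i
        proof (rule graph_converges_of_signed_levels[OF wc(1)[OF i] yc[OF i]])
          show "(\<lambda>n. signed_level k (ys n i)) \<longlonglongrightarrow> signed_level k (W \<omega> i)" for k
            using lim[rule_format, of "(i, k)"] i by (simp add: G_def)
        qed
        have "graph_converges (\<lambda>n. pmean m (ys n)) (pmean m (W \<omega>))"
        proof (rule graph_converges_pmean)
          fix t :: real and i j assume "t > 0" "i \<in> {1..m}" "j \<in> {1..m}" "i \<noteq> j"
          then show "isCont (W \<omega> i) t \<or> isCont (W \<omega> j) t" using elim(2) by (auto simp: W_def)
        qed (use m g wc in auto)
        moreover have "graph_converges (\<lambda>n t. sqrt (pvar m (ys n) t)) (\<lambda>t. sqrt (pvar m (W \<omega>) t))"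
          by (rule graph_converges_sqrt_pvar[OF m]) (use yc wc g in auto)
        ultimately have "(\<lambda>n. f (fst (\<Phi> (ys n)), snd (\<Phi> (ys n)))) \<longlonglongrightarrow> f (fst (\<Phi> (W \<omega>)), snd (\<Phi> (W \<omega>)))"
          using \<Phi>D elim(1) ys by (intro seq) (auto simp: \<Phi>_def)
        then show "(\<lambda>n. f (\<Phi> (ys n))) \<longlonglongrightarrow> f (\<Phi> (W \<omega>))" by simp
      qed
    qed
    fix K L and a :: "nat \<times> nat \<Rightarrow> nat"
    \<comment> \<open>One factor per section, made of the tents of its first \<open>K\<close>
      levels: a bounded M2 continuous functional, hence admissible in the assumed marginal
      convergence.\<close>
    let ?\<phi> = "\<lambda>i x. \<Prod>k<K. tent L (a (i, k)) (signed_level k x)"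
    have "((\<lambda>\<epsilon>. LINT \<omega>|completion M0. ?\<phi> i (centred_scaling \<mu> h l Z1 \<epsilon> \<omega>)) \<longlongrightarrow> (LINT \<omega>|completion N0. ?\<phi> i (Y1 \<omega>))) (at_right 0)" for i
    proof -
      have "continuous_map M2_topology euclideanreal (?\<phi> i) \<and> (\<exists>B. \<forall>x\<in>topspace M2_topology. \<bar>?\<phi> i x\<bar> \<le> B)"
        by (intro conjI signed_level_product_continuous_map exI[of _ 1] ballI signed_level_product_bound)
      from conv[unfolded converges_weakly_def, rule_format, OF this] show ?thesis .
    qed
    then have lim: "((\<lambda>\<epsilon>. \<Prod>i\<in>{1..m}. LINT \<omega>|completion M0. ?\<phi> i (centred_scaling \<mu> h l Z1 \<epsilon> \<omega>))
        \<longlongrightarrow> (\<Prod>i\<in>{1..m}. LINT \<omega>|completion N0. ?\<phi> i (Y1 \<omega>))) (at_right 0)"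
      by (intro tendsto_prod)
    have eqY: "(LINT \<omega>|completion N. (\<Prod>p\<in>{1..m} \<times> {..<K}. tent L (a p) (G (W \<omega>) p)))
        = (\<Prod>i\<in>{1..m}. LINT \<omega>|completion N0. ?\<phi> i (Y1 \<omega>))"
    proof -
      have "(\<Prod>p\<in>{1..m} \<times> {..<K}. tent L (a p) (G (W \<omega>) p)) = (\<Prod>p\<in>{1..m} \<times> {..<K}. tent L (a p) (signed_level (snd p) (Y (fst p) \<omega>)))" for \<omega>
        by (intro prod.cong) (auto simp: G_def W_def)
      then show ?thesis
        using expectation_signed_level_product[OF N indY finite_atLeastAtMost Y1, where S = "\<lambda>z. z" and K = K and N = L and a = a]
        by (simp add: path_component_measurable)
    qed
    have eqX: "(LINT \<omega>|completion M. (\<Prod>p\<in>{1..m} \<times> {..<K}. tent L (a p) (G (X \<epsilon> \<omega>) p)))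
        = (\<Prod>i\<in>{1..m}. LINT \<omega>|completion M0. ?\<phi> i (centred_scaling \<mu> h l Z1 \<epsilon> \<omega>))" if \<epsilon>: "\<epsilon> > 0" for \<epsilon>
    proof -
      \<comment> \<open>The scaling as an operation on single paths, obtained by letting the path
        itself be the outcome.\<close>
      let ?S = "centred_scaling \<mu> h l (\<lambda>z. z) \<epsilon>"
      have S: "centred_scaling \<mu> h l U \<epsilon> \<omega> = ?S (U \<omega>)" for U :: "'x \<Rightarrow> real \<Rightarrow> real" and \<omega>
        by (simp add: centred_scaling_def)
      have "(\<Prod>p\<in>{1..m} \<times> {..<K}. tent L (a p) (G (X \<epsilon> \<omega>) p)) = (\<Prod>p\<in>{1..m} \<times> {..<K}. tent L (a p) (signed_level (snd p) (?S (Z (fst p) \<omega>))))" for \<omega>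
        by (intro prod.cong) (auto simp: G_def X_def S[of "Z _" \<omega>])
      moreover have "(LINT \<omega>|completion M. (\<Prod>p\<in>{1..m} \<times> {..<K}. tent L (a p) (signed_level (snd p) (?S (Z (fst p) \<omega>)))))
          = (\<Prod>i\<in>{1..m}. LINT \<omega>|completion M0. ?\<phi> i (?S (Z1 \<omega>)))"
      proof (rule expectation_signed_level_product[OF M indZ finite_atLeastAtMost Z1])
        fix t :: real assume t: "t \<ge> 0"
        then have [measurable]: "(\<lambda>z. z (t / \<epsilon>)) \<in> borel_measurable path_algebra"
          using \<epsilon> by (intro path_component_measurable) auto
        show "(\<lambda>z. ?S z t) \<in> borel_measurable path_algebra" unfolding centred_scaling_def by measurable
        show "?S (restrict x {0..}) t = ?S x t" for x using t \<epsilon> by (simp add: centred_scaling_def)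
      qed
      ultimately show ?thesis by (simp add: S[of Z1])
    qed
    have "\<forall>\<^sub>F \<epsilon> in at_right 0. (\<Prod>i\<in>{1..m}. LINT \<omega>|completion M0. ?\<phi> i (centred_scaling \<mu> h l Z1 \<epsilon> \<omega>))
        = (LINT \<omega>|completion M. (\<Prod>p\<in>{1..m} \<times> {..<K}. tent L (a p) (G (X \<epsilon> \<omega>) p)))"
      using pos by eventually_elim (use eqX in simp)
    from Lim_transform_eventually[OF lim this]
    show "((\<lambda>\<epsilon>. LINT \<omega>|completion M. (\<Prod>p\<in>{1..m} \<times> {..<K}. tent L (a p) (G (X \<epsilon> \<omega>) p)))
        \<longlongrightarrow> (LINT \<omega>|completion N. (\<Prod>p\<in>{1..m} \<times> {..<K}. tent L (a p) (G (W \<omega>) p)))) (at_right 0)"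
      unfolding eqY .
  qed (rule e)
  show ?thesis
    unfolding joint_scaling_limit_def converges_weakly_def
  proof (intro allI impI)
    fix f :: "(real \<Rightarrow> real) \<times> (real \<Rightarrow> real) \<Rightarrow> real"
    assume "continuous_map WM2_topology euclideanreal f \<and> (\<exists>B. \<forall>x\<in>topspace WM2_topology. \<bar>f x\<bar> \<le> B)"
    then obtain B where f: "continuous_map WM2_topology euclideanreal f" and B: "\<And>x. x \<in> topspace WM2_topology \<Longrightarrow> \<bar>f x\<bar> \<le> B"
      by blast
    have "((\<lambda>\<epsilon>. LINT \<omega>|completion M. f (\<Phi> (X \<epsilon> \<omega>))) \<longlongrightarrow> (LINT \<omega>|completion N. f (\<Phi> (W \<omega>)))) (at_right 0)"
    proof (rule tendstoI)
      fix e :: real assume e: "e > 0"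
      have "continuous_map WM2_topology euclideanreal (\<lambda>x. - f x)" using f by (rule continuous_map_minus)
      from main[OF this _ e, of B] B
      have "\<forall>\<^sub>F \<epsilon> in at_right 0. (LINT \<omega>|completion N. - f (\<Phi> (W \<omega>))) - e < (LINT \<omega>|completion M. - f (\<Phi> (X \<epsilon> \<omega>)))"
        by simp
      moreover have "\<forall>\<^sub>F \<epsilon> in at_right 0. (LINT \<omega>|completion N. f (\<Phi> (W \<omega>))) - e < (LINT \<omega>|completion M. f (\<Phi> (X \<epsilon> \<omega>)))"
        using f B e by (rule main)
      ultimately show "\<forall>\<^sub>F \<epsilon> in at_right 0. dist (LINT \<omega>|completion M. f (\<Phi> (X \<epsilon> \<omega>))) (LINT \<omega>|completion N. f (\<Phi> (W \<omega>))) < e"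
        by eventually_elim (simp add: dist_real_def abs_less_iff)
    qed
    moreover have "\<forall>\<^sub>F \<epsilon> in at_right 0. (LINT \<omega>|completion M. f (\<Phi> (X \<epsilon> \<omega>)))
        = (LINT \<omega>|completion M. f (centred_scaling \<mu> h l (section_mean m Z) \<epsilon> \<omega>, sqrt_scaling h l (section_variance m Z) \<epsilon> \<omega>))"
      using pos by eventually_elim (simp add: Xeq)
    ultimately show "((\<lambda>\<epsilon>. LINT \<omega>|completion M. f (centred_scaling \<mu> h l (section_mean m Z) \<epsilon> \<omega>, sqrt_scaling h l (section_variance m Z) \<epsilon> \<omega>))
        \<longlongrightarrow> (LINT \<omega>|completion N. f (section_mean m Y \<omega>, (\<lambda>t. sqrt (section_variance m Y \<omega> t))))) (at_right 0)"
      unfolding Weq by (rule Lim_transform_eventually)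
  qed
qed

section \<open>Independent processes have no common jumps\<close>

text \<open>
  Joint oscillation near arbitrarily precise rational locations: a measurable substitute, on the
  product of the path spaces, for the existence of a common jump.
\<close>

definition oscillates :: "real \<Rightarrow> nat \<Rightarrow> real \<Rightarrow> (real \<Rightarrow> real) \<Rightarrow> bool" where
  "oscillates \<eta> n a x \<longleftrightarrow> (\<exists>p q :: rat. \<bar>max 0 (of_rat p) - a\<bar> < inverse (real (Suc n)) \<and>
     \<bar>max 0 (of_rat q) - a\<bar> < inverse (real (Suc n)) \<and> \<eta> < \<bar>x (max 0 (of_rat p)) - x (max 0 (of_rat q))\<bar>)"

text \<open>The index \<open>j\<close> sets both the size of the oscillations and the time horizon;
  the horizon supplies compactness. The location \<open>a\<close> may move with \<open>n\<close>,
  since a jump time need not be rational.\<close>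

definition common_oscillation :: "nat \<Rightarrow> (real \<Rightarrow> real) \<Rightarrow> (real \<Rightarrow> real) \<Rightarrow> bool" where
  "common_oscillation j x y \<longleftrightarrow> (\<forall>n. \<exists>a :: rat. of_rat a \<in> {0..real j} \<and>
     oscillates (inverse (real (Suc j))) n (of_rat a) x \<and> oscillates (inverse (real (Suc j))) n (of_rat a) y)"

lemma common_oscillation_measurable:
  "Measurable.pred (path_algebra \<Otimes>\<^sub>M path_algebra) (\<lambda>p. common_oscillation j (fst p) (snd p))"
proof -
  have [measurable]: "(\<lambda>p. fst p (max 0 (of_rat q))) \<in> borel_measurable (path_algebra \<Otimes>\<^sub>M path_algebra)"
    "(\<lambda>p. snd p (max 0 (of_rat q))) \<in> borel_measurable (path_algebra \<Otimes>\<^sub>M path_algebra)" for q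
    by (rule measurable_compose[OF measurable_fst path_component_measurable], simp)
      (rule measurable_compose[OF measurable_snd path_component_measurable], simp)
  show ?thesis unfolding common_oscillation_def oscillates_def by measurable
qed

lemma common_oscillation_restrict:
  "common_oscillation j (restrict x {0..}) (restrict y {0..}) = common_oscillation j x y"
  by (simp add: common_oscillation_def oscillates_def)

lemma oscillates_of_jump:
  assumes x: "x \<in> cadlag_paths" and t: "t > 0" and d: "\<not> isCont x t"
  obtains \<eta> where "\<eta> > 0" "\<And>\<eta>' n a. \<eta>' \<le> \<eta> \<Longrightarrow> \<bar>a - t\<bar> < inverse (real (Suc n)) / 2 \<Longrightarrow> oscillates \<eta>' n a x"
proof -
  \<comment> \<open>With a third of the jump, values just after and just before \<open>t\<close>
    still differ by more than \<open>\<eta>\<close>.\<close>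
  define \<eta> where "\<eta> = \<bar>x t - left_limit x t\<bar> / 3"
  have \<eta>: "\<eta> > 0" using isCont_iff_left_limit[OF x t] d by (simp add: \<eta>_def)
  show ?thesis
  proof (rule that[OF \<eta>])
    fix \<eta>' n a assume le: "\<eta>' \<le> \<eta>" and a: "\<bar>a - t\<bar> < inverse (real (Suc n)) / 2"
    \<comment> \<open>Half of the precision covers the distance from \<open>a\<close> to
      \<open>t\<close>, the other half the distance from \<open>t\<close> to the sampled
      rationals.\<close>
    define r where "r = inverse (real (Suc n)) / 2"
    have r: "r > 0" by (simp add: r_def)
    obtain b where b: "b > 0" "\<And>s. t \<le> s \<Longrightarrow> s < t + b \<Longrightarrow> \<bar>x s - x t\<bar> < \<eta>"
      using cadlag_right[OF x less_imp_le[OF t] \<eta>] by blast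
    obtain c where c: "c > 0" "c \<le> t" "\<And>s. t - c < s \<Longrightarrow> s < t \<Longrightarrow> \<bar>x s - left_limit x t\<bar> < \<eta>"
      using cadlag_left[OF x t \<eta>] by blast
    have "t < t + min b r" using b(1) r by simp
    then obtain p where p: "t < of_rat p" "of_rat p < t + min b r" using of_rat_dense by blast
    have "t - min c r < t" using c(1) r by simp
    then obtain q where q: "t - min c r < of_rat q" "of_rat q < t" using of_rat_dense by blast
    have "\<bar>x (of_rat p) - x t\<bar> < \<eta>" using p by (intro b(2)) auto
    moreover have "\<bar>x (of_rat q) - left_limit x t\<bar> < \<eta>" using q by (intro c(3)) auto
    moreover have "3 * \<eta> = \<bar>x t - left_limit x t\<bar>" by (simp add: \<eta>_def)
    ultimately have "\<eta> < \<bar>x (of_rat p) - x (of_rat q)\<bar>" by linarith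
    moreover have "max 0 (of_rat p) = (of_rat p :: real)" "max 0 (of_rat q) = (of_rat q :: real)"
      using p q c(2) t by auto
    moreover have "\<bar>of_rat p - a\<bar> < inverse (real (Suc n))" "\<bar>of_rat q - a\<bar> < inverse (real (Suc n))"
      using p q a unfolding r_def by linarith+
    ultimately show "oscillates \<eta>' n a x" unfolding oscillates_def
      by (intro exI[of _ p] exI[of _ q]) (use le in simp)
  qed
qed

lemma common_oscillation_of_jumps:
  assumes x: "x \<in> cadlag_paths" and y: "y \<in> cadlag_paths" and t: "t > 0" "\<not> isCont x t" "\<not> isCont y t"
  obtains j where "common_oscillation j x y"
proof -
  obtain \<eta> where \<eta>: "\<eta> > 0" "\<And>\<eta>' n a. \<eta>' \<le> \<eta> \<Longrightarrow> \<bar>a - t\<bar> < inverse (real (Suc n)) / 2 \<Longrightarrow> oscillates \<eta>' n a x"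
    using oscillates_of_jump[OF x t(1,2)] by blast
  obtain \<theta> where \<theta>: "\<theta> > 0" "\<And>\<eta>' n a. \<eta>' \<le> \<theta> \<Longrightarrow> \<bar>a - t\<bar> < inverse (real (Suc n)) / 2 \<Longrightarrow> oscillates \<eta>' n a y"
    using oscillates_of_jump[OF y t(1,3)] by blast
  have "\<forall>\<^sub>F j in sequentially. inverse (real (Suc j)) < min \<eta> \<theta>"
    using LIMSEQ_inverse_real_of_nat by (rule order_tendstoD(2)) (use \<eta> \<theta> in simp)
  moreover have "\<forall>\<^sub>F j in sequentially. t < real j"
    using filterlim_real_sequentially by (simp add: filterlim_at_top_dense)
  ultimately have "\<forall>\<^sub>F j in sequentially. inverse (real (Suc j)) < min \<eta> \<theta> \<and> t < real j" by eventually_elim simp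
  then obtain j where j: "inverse (real (Suc j)) < min \<eta> \<theta>" "t < real j" by (auto dest: eventually_happens)
  have "common_oscillation j x y" unfolding common_oscillation_def
  proof
    fix n
    have "t < min (real j) (t + inverse (real (Suc n)) / 2)" using j by simp
    then obtain a where a: "t < of_rat a" "of_rat a < min (real j) (t + inverse (real (Suc n)) / 2)"
      using of_rat_dense by blast
    then have "oscillates (inverse (real (Suc j))) n (of_rat a) x" using j by (intro \<eta>(2)) auto
    moreover have "oscillates (inverse (real (Suc j))) n (of_rat a) y" using j a by (intro \<theta>(2)) auto
    moreover have "0 \<le> (of_rat a :: real)" "of_rat a \<le> real j" using a t by linarith+
    then have "of_rat a \<in> {0..real j}" by (simp only: atLeastAtMost_iff)
    ultimately show "\<exists>a. of_rat a \<in> {0..real j} \<and> oscillates (inverse (real (Suc j))) n (of_rat a) x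
        \<and> oscillates (inverse (real (Suc j))) n (of_rat a) y" by blast
  qed
  then show ?thesis by (rule that)
qed

text \<open>Were \<open>x\<close> continuous at the limit of the locations, both sampled values
  would eventually be within \<open>\<eta> / 2\<close> of \<open>x t\<close>, against the
  oscillation. Every cadlag path is continuous at 0 relative to nonnegative times, so the limit is
  positive.\<close>

lemma oscillates_limit:
  assumes x: "x \<in> cadlag_paths" and \<eta>: "\<eta> > 0" and osc: "\<And>n. oscillates \<eta> n (a n) x"
    and r: "strict_mono (r :: nat \<Rightarrow> nat)" and lim: "(\<lambda>n. a (r n)) \<longlonglongrightarrow> t" and t: "t \<ge> 0"
  shows "t > 0 \<and> \<not> isCont x t"
proof -
  have nc: "\<not> continuous (at t within {0..}) x"
  proof
    assume c: "continuous (at t within {0..}) x"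
    have "\<eta> / 2 > 0" using \<eta> by simp
    from continuous_within_nonneg[OF c t this]
    obtain \<delta> where \<delta>: "\<delta> > 0" "\<And>s. s \<ge> 0 \<Longrightarrow> \<bar>s - t\<bar> < \<delta> \<Longrightarrow> \<bar>x s - x t\<bar> < \<eta> / 2" by blast
    have "\<forall>\<^sub>F n in sequentially. dist (a (r n)) t < \<delta> / 2" using lim by (rule tendstoD) (use \<delta> in simp)
    moreover have "\<forall>\<^sub>F n in sequentially. inverse (real (Suc (r n))) < \<delta> / 2"
      by (rule order_tendstoD(2)[OF LIMSEQ_subseq_LIMSEQ[OF LIMSEQ_inverse_real_of_nat r, unfolded comp_def]])
        (use \<delta> in simp)
    ultimately have "\<forall>\<^sub>F n in sequentially. dist (a (r n)) t < \<delta> / 2 \<and> inverse (real (Suc (r n))) < \<delta> / 2"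
      by eventually_elim simp
    then obtain n where n: "\<bar>a (r n) - t\<bar> < \<delta> / 2" "inverse (real (Suc (r n))) < \<delta> / 2"
      by (auto dest!: eventually_happens simp: dist_real_def)
    obtain p q :: rat where pq: "\<bar>max 0 (of_rat p) - a (r n)\<bar> < inverse (real (Suc (r n)))"
      "\<bar>max 0 (of_rat q) - a (r n)\<bar> < inverse (real (Suc (r n)))"
      "\<eta> < \<bar>x (max 0 (of_rat p)) - x (max 0 (of_rat q))\<bar>"
      using osc[of "r n"] unfolding oscillates_def by blast
    have "\<bar>x (max 0 (of_rat p)) - x t\<bar> < \<eta> / 2"
      by (rule \<delta>(2)[OF max.cobounded1]) (use pq(1) n in linarith)
    moreover have "\<bar>x (max 0 (of_rat q)) - x t\<bar> < \<eta> / 2"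
      by (rule \<delta>(2)[OF max.cobounded1]) (use pq(2) n in linarith)
    ultimately show False using pq(3) by linarith
  qed
  then have "t \<noteq> 0" using cadlag_continuous_at_0[OF x] by auto
  then show ?thesis using nc t continuous_at_imp_continuous_at_within by (auto simp: less_le)
qed

text \<open>The locations stay in a compact interval; along a convergent subsequence both paths
  oscillate at the same places and so share the limit as a discontinuity.\<close>

lemma common_jump_of_oscillation:
  assumes x: "x \<in> cadlag_paths" and y: "y \<in> cadlag_paths" and c: "common_oscillation j x y"
  obtains t where "t > 0" "\<not> isCont x t" "\<not> isCont y t"
proof -
  define \<eta> where "\<eta> = inverse (real (Suc j))"
  have \<eta>: "\<eta> > 0" by (simp add: \<eta>_def)
  have "\<forall>n. \<exists>a. a \<in> {0..real j} \<and> oscillates \<eta> n a x \<and> oscillates \<eta> n a y"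
    using c unfolding common_oscillation_def \<eta>_def by blast
  from choice[OF this] obtain a where a: "\<And>n. a n \<in> {0..real j}" "\<And>n. oscillates \<eta> n (a n) x" "\<And>n. oscillates \<eta> n (a n) y"
    by blast
  obtain t r where tr: "t \<in> {0..real j}" "strict_mono r" "(a \<circ> r) \<longlonglongrightarrow> t"
    using compact_Icc[of 0 "real j"] a(1) unfolding compact_def by blast
  have lim: "(\<lambda>n. a (r n)) \<longlonglongrightarrow> t" using tr(3) by (simp add: comp_def)
  have t: "t \<ge> 0" using tr(1) by simp
  show ?thesis
    using oscillates_limit[OF x \<eta> a(2) tr(2) lim t] oscillates_limit[OF y \<eta> a(3) tr(2) lim t] that by blast
qed

text \<open>
  By Fubini it suffices to consider a fixed path of the first process; it has only countably many
  discontinuities, and the second process almost surely jumps at none of them.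
\<close>

lemma no_common_jumps:
  assumes N: "prob_space N" and A: "process N cadlag_paths A" and B: "process N cadlag_paths B"
    and ind: "prob_space.indep_var (completion N) path_algebra (\<lambda>\<omega>. restrict (A \<omega>) {0..}) path_algebra (\<lambda>\<omega>. restrict (B \<omega>) {0..})"
    and fixed: "\<And>t. t > 0 \<Longrightarrow> AE \<omega> in N. isCont (B \<omega>) t"
  shows "AE \<omega> in N. \<forall>t>0. isCont (A \<omega>) t \<or> isCont (B \<omega>) t"
proof -
  interpret C: prob_space "completion N" by (rule prob_space.prob_space_completion[OF N])
  let ?a = "\<lambda>\<omega>. restrict (A \<omega>) {0..}" and ?b = "\<lambda>\<omega>. restrict (B \<omega>) {0..}"
  have ma: "?a \<in> completion N \<rightarrow>\<^sub>M path_algebra" and mb: "?b \<in> completion N \<rightarrow>\<^sub>M path_algebra"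
    using A B by (auto intro: restrict_path_measurable)
  let ?lA = "distr (completion N) path_algebra ?a" and ?lB = "distr (completion N) path_algebra ?b"
  interpret lB: prob_space ?lB by (rule C.prob_space_distr[OF mb])
  \<comment> \<open>Independence makes the joint law a product measure, where a null event can be
    recognised by its sections.\<close>
  have law: "?lA \<Otimes>\<^sub>M ?lB = distr (completion N) (path_algebra \<Otimes>\<^sub>M path_algebra) (\<lambda>\<omega>. (?a \<omega>, ?b \<omega>))"
    using ind unfolding C.indep_var_distribution_eq by blast
  have null: "AE \<omega> in N. \<not> common_oscillation j (A \<omega>) (B \<omega>)" for j
  proof -
    let ?E = "{p \<in> space (path_algebra \<Otimes>\<^sub>M path_algebra). common_oscillation j (fst p) (snd p)}"
    have E: "?E \<in> sets (path_algebra \<Otimes>\<^sub>M path_algebra)"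
      using common_oscillation_measurable[of j] by (simp add: pred_def)
    have E': "?E \<in> sets (path_algebra \<Otimes>\<^sub>M ?lB)" using E by (simp cong: sets_pair_measure_cong)
    have E'': "?E \<in> sets (?lA \<Otimes>\<^sub>M ?lB)" using E by (simp cong: sets_pair_measure_cong)
    have meas: "(\<lambda>x. emeasure ?lB (Pair x -` ?E)) \<in> borel_measurable path_algebra"
      by (rule lB.measurable_emeasure_Pair[OF E'])
    have slice: "emeasure ?lB (Pair (?a \<omega>) -` ?E) = 0" if x: "A \<omega> \<in> cadlag_paths" for \<omega>
    proof -
      have "countable {t. t > 0 \<and> \<not> isCont (A \<omega>) t}" by (rule cadlag_countable_jumps[OF x])
      then have "AE \<omega>' in N. \<forall>t\<in>{t. t > 0 \<and> \<not> isCont (A \<omega>) t}. isCont (B \<omega>') t"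
        using fixed by (subst AE_ball_countable) auto
      with processD(2)[OF B] have ae: "AE \<omega>' in N. \<not> common_oscillation j (A \<omega>) (B \<omega>')"
      proof eventually_elim
        case (elim \<omega>')
        show ?case
        proof
          assume "common_oscillation j (A \<omega>) (B \<omega>')"
          then obtain t where "t > 0" "\<not> isCont (A \<omega>) t" "\<not> isCont (B \<omega>') t"
            using common_jump_of_oscillation[OF x elim(1)] by blast
          then show False using elim(2) by blast
        qed
      qed
      have S: "Pair (?a \<omega>) -` ?E \<in> sets path_algebra"
        by (rule sets_Pair1[OF E])
      have "emeasure ?lB (Pair (?a \<omega>) -` ?E) = emeasure (completion N) (?b -` (Pair (?a \<omega>) -` ?E) \<inter> space (completion N))"
        by (rule emeasure_distr[OF mb S])
      also have "\<dots> = 0"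
      proof -
        have "emeasure (completion N) {\<omega>' \<in> space (completion N). ?b \<omega>' \<in> Pair (?a \<omega>) -` ?E} = 0"
        proof (rule emeasure_eq_0_AE)
          show "AE \<omega>' in completion N. \<not> ?b \<omega>' \<in> Pair (?a \<omega>) -` ?E"
            using AE_completion[OF ae] by eventually_elim (simp add: common_oscillation_restrict)
        qed
        then show ?thesis by (simp add: vimage_def Int_def conj_commute)
      qed
      finally show ?thesis .
    qed
    have "emeasure (?lA \<Otimes>\<^sub>M ?lB) ?E = (\<integral>\<^sup>+x. emeasure ?lB (Pair x -` ?E) \<partial>?lA)"
      by (rule lB.emeasure_pair_measure_alt[OF E''])
    also have "\<dots> = (\<integral>\<^sup>+\<omega>. emeasure ?lB (Pair (?a \<omega>) -` ?E) \<partial>completion N)"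
      by (rule nn_integral_distr[OF ma]) (use meas in simp)
    also have "\<dots> = (\<integral>\<^sup>+\<omega>. 0 \<partial>completion N)"
    proof (rule nn_integral_cong_AE)
      show "AE \<omega> in completion N. emeasure ?lB (Pair (?a \<omega>) -` ?E) = 0"
        using AE_completion[OF processD(2)[OF A]] by eventually_elim (rule slice)
    qed
    finally have "emeasure (distr (completion N) (path_algebra \<Otimes>\<^sub>M path_algebra) (\<lambda>\<omega>. (?a \<omega>, ?b \<omega>))) ?E = 0"
      unfolding law by simp
    moreover have mab: "(\<lambda>\<omega>. (?a \<omega>, ?b \<omega>)) \<in> completion N \<rightarrow>\<^sub>M path_algebra \<Otimes>\<^sub>M path_algebra"
      using ma mb by (rule measurable_Pair)
    ultimately have z: "emeasure (completion N) ((\<lambda>\<omega>. (?a \<omega>, ?b \<omega>)) -` ?E \<inter> space (completion N)) = 0"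
      by (subst (asm) emeasure_distr[OF mab E])
    then have "AE \<omega> in completion N. \<omega> \<notin> (\<lambda>\<omega>. (?a \<omega>, ?b \<omega>)) -` ?E \<inter> space (completion N)"
      by (intro AE_not_in null_setsI measurable_sets[OF mab E])
    then have "AE \<omega> in completion N. \<not> common_oscillation j (A \<omega>) (B \<omega>)"
      using AE_space
    proof eventually_elim
      case (elim \<omega>)
      have "(?a \<omega>, ?b \<omega>) \<in> space (path_algebra \<Otimes>\<^sub>M path_algebra)"
        using measurable_space[OF mab elim(2)] .
      then show ?case using elim common_oscillation_restrict[of j "A \<omega>" "B \<omega>"] by auto
    qed
    then show ?thesis by (simp add: AE_completion_iff)
  qed
  then have "AE \<omega> in N. \<forall>j. \<not> common_oscillation j (A \<omega>) (B \<omega>)" by (simp add: AE_all_countable)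
  then show ?thesis using processD(2)[OF A] processD(2)[OF B]
  proof eventually_elim
    case (elim \<omega>)
    then show ?case using common_oscillation_of_jumps[of "A \<omega>" "B \<omega>"] by metis
  qed
qed

text \<open>Independence of the family is restricted to two disjoint singletons, and the coordinate
  projections remove the resulting one-element products.\<close>

lemma indep_path_pair:
  assumes M: "prob_space M" and ind: "independent_copies M0 X0 M X I" and ij: "i \<in> I" "j \<in> I" "i \<noteq> j"
  shows "prob_space.indep_var (completion M) path_algebra (\<lambda>\<omega>. restrict (X i \<omega>) {0..}) path_algebra (\<lambda>\<omega>. restrict (X j \<omega>) {0..})"
proof -
  interpret C: prob_space "completion M" by (rule prob_space.prob_space_completion[OF M])
  have iv: "C.indep_vars (\<lambda>_. path_algebra) (\<lambda>i \<omega>. restrict (X i \<omega>) {0..}) I"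
    using ind by (simp add: independent_copies_def)
  have "C.indep_var (PiM {i} (\<lambda>_. path_algebra)) (\<lambda>\<omega>. restrict (\<lambda>i. restrict (X i \<omega>) {0..}) {i})
      (PiM {j} (\<lambda>_. path_algebra)) (\<lambda>\<omega>. restrict (\<lambda>i. restrict (X i \<omega>) {0..}) {j})"
    by (rule C.indep_var_restrict[OF iv]) (use ij in auto)
  from C.indep_var_compose[OF this measurable_component_singleton[of i] measurable_component_singleton[of j]]
  show ?thesis by (simp add: comp_def)
qed

text \<open>By self-similarity \<open>Y 0\<close> and \<open>c * Y 0\<close> have the same law for every \<open>c > 0\<close>; let \<open>c\<close> tend to 0.\<close>

lemma self_similar_start:
  assumes N0: "prob_space N0" and Y: "process N0 cadlag_paths Y" and h: "h > 0"
    and ss: "\<forall>a>0. path_law N0 (\<lambda>\<omega> t. Y \<omega> (a * t)) = path_law N0 (\<lambda>\<omega> t. a powr h * Y \<omega> t)"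
  shows "AE \<omega> in N0. Y \<omega> 0 = 0"
proof -
  interpret C: prob_space "completion N0" by (rule prob_space.prob_space_completion[OF N0])
  have Y0 [measurable]: "(\<lambda>\<omega>. Y \<omega> 0) \<in> borel_measurable (completion N0)" by (rule processD(1)[OF Y]) simp
  \<comment> \<open>Bounded, so that the expectations exist without moment assumptions, and zero
    exactly for paths starting at 0.\<close>
  define g where "g = (\<lambda>z :: real \<Rightarrow> real. min 1 \<bar>z 0\<bar>)"
  have g: "g \<in> borel_measurable path_algebra"
  proof -
    have [measurable]: "(\<lambda>z. z 0) \<in> borel_measurable path_algebra" by (rule path_component_measurable) simp
    show ?thesis unfolding g_def by measurable
  qed
  have gr: "g (restrict x {0..}) = g x" for x by (simp add: g_def)
  have eq: "(LINT \<omega>|completion N0. min 1 \<bar>Y \<omega> 0\<bar>) = (LINT \<omega>|completion N0. min 1 (c * \<bar>Y \<omega> 0\<bar>))" if c: "c > 0" for c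
  proof -
    \<comment> \<open>The time factor whose self-similarity multiplier is \<open>c\<close>.\<close>
    define a where "a = c powr (1 / h)"
    have a: "a > 0" "a powr h = c" using c h by (auto simp: a_def powr_powr)
    have p1: "process N0 UNIV (\<lambda>\<omega> t. Y \<omega> (a * t))"
      unfolding process_def using a(1) by (auto intro: processD(1)[OF Y])
    have p2: "process N0 UNIV (\<lambda>\<omega> t. a powr h * Y \<omega> t)"
      unfolding process_def using processD(1)[OF Y] by auto
    have "(LINT \<omega>|completion N0. g (\<lambda>t. Y \<omega> (a * t))) = (LINT \<omega>|completion N0. g (\<lambda>t. a powr h * Y \<omega> t))"
      using path_law_integral[OF p1 g gr] path_law_integral[OF p2 g gr] ss a(1) by simp
    then show ?thesis using a c by (simp add: g_def abs_mult)
  qed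
  have "(\<lambda>n. LINT \<omega>|completion N0. min 1 (inverse (real (Suc n)) * \<bar>Y \<omega> 0\<bar>)) \<longlonglongrightarrow> (LINT \<omega>|completion N0. 0)"
  proof (rule integral_dominated_convergence[where w = "\<lambda>_. 1"])
    show "AE \<omega> in completion N0. (\<lambda>n. min 1 (inverse (real (Suc n)) * \<bar>Y \<omega> 0\<bar>)) \<longlonglongrightarrow> 0"
    proof (rule AE_I2)
      fix \<omega>
      have "(\<lambda>n. min 1 (inverse (real (Suc n)) * \<bar>Y \<omega> 0\<bar>)) \<longlonglongrightarrow> min 1 (0 * \<bar>Y \<omega> 0\<bar>)"
        by (intro tendsto_min tendsto_mult tendsto_const LIMSEQ_inverse_real_of_nat)
      then show "(\<lambda>n. min 1 (inverse (real (Suc n)) * \<bar>Y \<omega> 0\<bar>)) \<longlonglongrightarrow> 0" by simp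
    qed
  qed (auto simp: min_def)
  moreover have "(LINT \<omega>|completion N0. min 1 (inverse (real (Suc n)) * \<bar>Y \<omega> 0\<bar>)) = (LINT \<omega>|completion N0. min 1 \<bar>Y \<omega> 0\<bar>)" for n
    by (rule eq[symmetric]) simp
  ultimately have "(LINT \<omega>|completion N0. min 1 \<bar>Y \<omega> 0\<bar>) = 0"
    using LIMSEQ_unique[OF tendsto_const] by simp
  moreover have "integrable (completion N0) (\<lambda>\<omega>. min 1 \<bar>Y \<omega> 0\<bar>)"
    by (rule C.integrable_const_bound[where B = 1]) auto
  ultimately have "AE \<omega> in completion N0. min 1 \<bar>Y \<omega> 0\<bar> = 0"
    by (subst (asm) integral_nonneg_eq_0_iff_AE) auto
  then have "AE \<omega> in N0. min 1 \<bar>Y \<omega> 0\<bar> = 0" by (simp add: AE_completion_iff)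
  then show ?thesis by eventually_elim (auto simp: min_def split: if_splits)
qed

section \<open>Properties carried over by equality of laws\<close>

lemma start_transfer:
  assumes X: "process M D X" and X': "process M' D' X'" and law: "path_law M' X' = path_law M X" and z: "AE \<omega> in M. X \<omega> 0 = 0"
  shows "AE \<omega> in M'. X' \<omega> 0 = 0"
proof -
  define P where "P = (\<lambda>z :: real \<Rightarrow> real. z 0 = 0)"
  have m: "Measurable.pred path_algebra P"
  proof -
    have [measurable]: "(\<lambda>z. z 0) \<in> borel_measurable path_algebra" by (rule path_component_measurable) simp
    show ?thesis unfolding P_def by measurable
  qed
  have r: "P (restrict x {0..}) = P x" for x by (simp add: P_def)
  have "AE \<omega> in M. P (X \<omega>)" using z by (simp add: P_def)
  then have "AE \<omega> in M'. P (X' \<omega>)"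
    unfolding path_law_AE[OF X m r] path_law_AE[OF X' m r] law .
  then show ?thesis by (simp add: P_def)
qed

text \<open>The law of large numbers tested at rational times, so that it is an event of the path
  algebra. \<open>max 0\<close> keeps the evaluation time nonnegative for every rational, although
  only large ones matter; the lower bound \<open>real (Suc n)\<close> keeps the denominators
  positive.\<close>

definition sublinear :: "real \<Rightarrow> (real \<Rightarrow> real) \<Rightarrow> bool" where
  "sublinear \<mu> z \<longleftrightarrow> (\<forall>k. \<exists>n. \<forall>q :: rat. real (Suc n) \<le> of_rat q \<longrightarrow>
     \<bar>(z (max 0 (of_rat q)) - \<mu> * of_rat q) / of_rat q\<bar> \<le> inverse (real (Suc k)))"

text \<open>From rational to real times by right-continuity: a violation at \<open>t\<close>
  persists just to the right of \<open>t\<close>, where there are rationals.\<close>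

lemma sublinear_iff:
  assumes x: "x \<in> cadlag_paths"
  shows "sublinear \<mu> x \<longleftrightarrow> ((\<lambda>t. (x t - \<mu> * t) / t) \<longlongrightarrow> 0) at_top"
proof
  assume lim: "((\<lambda>t. (x t - \<mu> * t) / t) \<longlongrightarrow> 0) at_top"
  show "sublinear \<mu> x" unfolding sublinear_def
  proof
    fix k
    have "\<forall>\<^sub>F t in at_top. dist ((x t - \<mu> * t) / t) 0 < inverse (real (Suc k))"
      using lim by (rule tendstoD) simp
    then obtain S where S: "\<And>t. t \<ge> S \<Longrightarrow> \<bar>(x t - \<mu> * t) / t\<bar> < inverse (real (Suc k))"
      unfolding eventually_at_top_linorder by auto
    obtain n where n: "S < real n" using reals_Archimedean2 by blast
    show "\<exists>n. \<forall>q :: rat. real (Suc n) \<le> of_rat q \<longrightarrow>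
        \<bar>(x (max 0 (of_rat q)) - \<mu> * of_rat q) / of_rat q\<bar> \<le> inverse (real (Suc k))"
    proof (intro exI[of _ n] allI impI)
      fix q :: rat assume q: "real (Suc n) \<le> of_rat q"
      then have "max 0 (of_rat q) = (of_rat q :: real)" "(of_rat q :: real) \<ge> S" using n by auto
      then show "\<bar>(x (max 0 (of_rat q)) - \<mu> * of_rat q) / of_rat q\<bar> \<le> inverse (real (Suc k))"
        using less_imp_le[OF S[of "of_rat q"]] by simp
    qed
  qed
next
  assume s: "sublinear \<mu> x"
  show "((\<lambda>t. (x t - \<mu> * t) / t) \<longlongrightarrow> 0) at_top"
  proof (rule tendstoI)
    fix e :: real assume e: "e > 0"
    obtain k where k: "inverse (real (Suc k)) < e" using reals_Archimedean[OF e] by blast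
    obtain n where n: "\<And>q :: rat. real (Suc n) \<le> of_rat q \<Longrightarrow>
        \<bar>(x (max 0 (of_rat q)) - \<mu> * of_rat q) / of_rat q\<bar> \<le> inverse (real (Suc k))"
      using s unfolding sublinear_def by blast
    have "\<bar>(x t - \<mu> * t) / t\<bar> \<le> inverse (real (Suc k))" if t: "t \<ge> real (Suc n)" for t
    proof (rule ccontr)
      let ?g = "\<lambda>t. \<bar>(x t - \<mu> * t) / t\<bar>"
      assume "\<not> ?thesis"
      then have lt: "inverse (real (Suc k)) < ?g t" by simp
      have t0: "t > 0" using t by linarith
      then have "(x \<longlongrightarrow> x t) (at_right t)" using x by (auto simp: cadlag_paths_def continuous_within)
      then have "(?g \<longlongrightarrow> ?g t) (at_right t)" using t0 by (intro tendsto_intros) auto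
      then have "\<forall>\<^sub>F s in at_right t. inverse (real (Suc k)) < ?g s" using lt by (rule order_tendstoD(1))
      then obtain b where b: "b > t" "\<And>s. s > t \<Longrightarrow> s < b \<Longrightarrow> inverse (real (Suc k)) < ?g s"
        by (auto simp: eventually_at_right_field)
      obtain q where q: "t < of_rat q" "of_rat q < b" using of_rat_dense[OF b(1)] by blast
      have "max 0 (of_rat q) = (of_rat q :: real)" using q(1) t0 by simp
      then have "?g (of_rat q) \<le> inverse (real (Suc k))" using n[of q] q(1) t by simp
      then show False using b(2)[OF q] by simp
    qed
    then show "\<forall>\<^sub>F t in at_top. dist ((x t - \<mu> * t) / t) 0 < e"
      unfolding eventually_at_top_linorder using k by (intro exI[of _ "real (Suc n)"]) force
  qed
qed

lemma sublinear_transfer: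
  assumes X: "process M cadlag_paths X" and X': "process M' cadlag_paths X'" and law: "path_law M' X' = path_law M X"
    and lim: "AE \<omega> in M. ((\<lambda>t. (X \<omega> t - \<mu> * t) / t) \<longlongrightarrow> 0) at_top"
  shows "AE \<omega> in M'. ((\<lambda>t. (X' \<omega> t - \<mu> * t) / t) \<longlongrightarrow> 0) at_top"
proof -
  have m: "Measurable.pred path_algebra (sublinear \<mu>)"
  proof -
    have [measurable]: "(\<lambda>z. z (max 0 (of_rat q))) \<in> borel_measurable path_algebra" for q
      by (rule path_component_measurable) simp
    show ?thesis unfolding sublinear_def[abs_def] by measurable
  qed
  have r: "sublinear \<mu> (restrict x {0..}) = sublinear \<mu> x" for x by (simp add: sublinear_def)
  have "AE \<omega> in M. sublinear \<mu> (X \<omega>)"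
    using lim processD(2)[OF X] by eventually_elim (simp add: sublinear_iff)
  then have "AE \<omega> in M'. sublinear \<mu> (X' \<omega>)"
    unfolding path_law_AE[OF X m r] path_law_AE[OF X' m r] law .
  then show ?thesis using processD(2)[OF X'] by eventually_elim (simp add: sublinear_iff)
qed

section \<open>Self-similarity and filtrations of the sections\<close>

lemma path_upto_restrict: "path_upto t (restrict x {0..}) = path_upto t x"
  by (simp add: path_upto_def sample_def fun_eq_iff)

text \<open>The variance at time \<open>t\<close> is evaluated on \<open>path_upto t\<close>, which
  makes the map measurable on the whole product space and not only on cadlag families; on the latter
  it yields the sections.\<close>

definition section_map :: "nat \<Rightarrow> (nat \<Rightarrow> real \<Rightarrow> real) \<Rightarrow> (real \<Rightarrow> real) \<times> (real \<Rightarrow> real)" where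
  "section_map m y = (restrict (pmean m y) {0..}, restrict (\<lambda>t. pvar m (\<lambda>i. path_upto t (y i)) t) {0..})"

lemma section_map_measurable:
  "section_map m \<in> PiM {1..m} (\<lambda>_. path_algebra) \<rightarrow>\<^sub>M path_algebra \<Otimes>\<^sub>M path_algebra"
proof -
  have c: "(\<lambda>y. y i v) \<in> borel_measurable (PiM {1..m} (\<lambda>_. path_algebra))" if "i \<in> {1..m}" "v \<ge> 0" for i v
  proof -
    have "(\<lambda>y. y i) \<in> PiM {1..m} (\<lambda>_. path_algebra) \<rightarrow>\<^sub>M path_algebra"
      using that(1) by (rule measurable_component_singleton)
    from measurable_compose[OF this path_component_measurable[OF that(2)]] show ?thesis .
  qed
  have "(\<lambda>y. pmean m y t) \<in> borel_measurable (PiM {1..m} (\<lambda>_. path_algebra))" if "t \<ge> 0" for t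
    unfolding section_mean_def using c that
    by (intro borel_measurable_times borel_measurable_sum borel_measurable_const) auto
  moreover have "(\<lambda>y. pvar m (\<lambda>i. path_upto t (y i)) t) \<in> borel_measurable (PiM {1..m} (\<lambda>_. path_algebra))" if "t \<ge> 0" for t
    using that c by (intro pvar_path_upto_measurable) auto
  ultimately show ?thesis unfolding section_map_def
    by (intro measurable_Pair measurable_restrict) auto
qed

text \<open>The pair of sections is almost surely a fixed measurable map of the vector of paths, so
  its joint law is an image of the law of the vector. Equality in law of two vectors thereby passes
  to their sections.\<close>

lemma joint_path_law_section:
  assumes W: "\<And>i. i \<in> {1..m} \<Longrightarrow> process N cadlag_paths (W i)"
  shows "joint_path_law N (section_mean m W) (section_variance m W)
      = distr (distr (completion N) (PiM {1..m} (\<lambda>_. path_algebra)) (\<lambda>\<omega>. \<lambda>i\<in>{1..m}. restrict (W i \<omega>) {0..}))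
          (path_algebra \<Otimes>\<^sub>M path_algebra) (section_map m)"
proof -
  let ?v = "\<lambda>\<omega>. \<lambda>i\<in>{1..m}. restrict (W i \<omega>) {0..}"
  have v: "?v \<in> completion N \<rightarrow>\<^sub>M PiM {1..m} (\<lambda>_. path_algebra)"
    using W by (intro measurable_restrict restrict_path_measurable)
  have "process N UNIV (section_variance m W)"
    unfolding process_def using section_variance_measurable[OF _ W] by auto
  moreover have "process N cadlag_paths (section_mean m W)" using W by (rule process_section_mean)
  ultimately have m: "(\<lambda>\<omega>. (restrict (section_mean m W \<omega>) {0..}, restrict (section_variance m W \<omega>) {0..}))
      \<in> completion N \<rightarrow>\<^sub>M path_algebra \<Otimes>\<^sub>M path_algebra"
    by (intro measurable_Pair restrict_path_measurable)
  have "AE \<omega> in N. \<forall>i\<in>{1..m}. W i \<omega> \<in> cadlag_paths" using W by (rule AE_all_cadlag)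
  then have eq: "AE \<omega> in N. (section_map m \<circ> ?v) \<omega> = (restrict (section_mean m W \<omega>) {0..}, restrict (section_variance m W \<omega>) {0..})"
  proof eventually_elim
    case (elim \<omega>)
    have "pmean m (?v \<omega>) t = section_mean m W \<omega> t" if "t \<ge> 0" for t
      using that by (simp add: section_mean_def)
    moreover have "pvar m (\<lambda>i. path_upto t (?v \<omega> i)) t = section_variance m W \<omega> t" for t
    proof -
      have "pvar m (\<lambda>i. path_upto t (?v \<omega> i)) = pvar m (\<lambda>i. path_upto t (W i \<omega>))"
        by (rule pvar_cong) (simp add: path_upto_restrict)
      then show ?thesis using pvar_path_upto[of m "\<lambda>i. W i \<omega>" t] elim
        unfolding section_variance_path[of m W] by simp
    qed
    ultimately show ?case by (simp add: section_map_def restrict_def fun_eq_iff)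
  qed
  have "distr (distr (completion N) (PiM {1..m} (\<lambda>_. path_algebra)) ?v) (path_algebra \<Otimes>\<^sub>M path_algebra) (section_map m)
      = distr (completion N) (path_algebra \<Otimes>\<^sub>M path_algebra) (section_map m \<circ> ?v)"
    by (rule distr_distr[OF section_map_measurable v])
  also have "\<dots> = joint_path_law N (section_mean m W) (section_variance m W)"
    unfolding joint_path_law_def
    by (rule distr_cong_AE[OF refl refl AE_completion[OF eq] measurable_comp[OF v section_map_measurable] m])
  finally show ?thesis by simp
qed

lemma path_law_map:
  assumes X: "process M D X" and S: "\<And>t. t \<ge> 0 \<Longrightarrow> (\<lambda>z. S z t) \<in> borel_measurable path_algebra"
    and r: "\<And>x t. t \<ge> 0 \<Longrightarrow> S (restrict x {0..}) t = S x t"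
  shows "path_law M (\<lambda>\<omega>. S (X \<omega>)) = distr (path_law M X) path_algebra (\<lambda>z. restrict (S z) {0..})"
proof -
  have m: "(\<lambda>z. restrict (S z) {0..}) \<in> path_algebra \<rightarrow>\<^sub>M path_algebra"
    using S by (intro measurable_restrict) auto
  have "restrict (S (restrict x {0..})) {0..} = restrict (S x) {0..}" for x
    using r by (simp add: restrict_def fun_eq_iff)
  then show ?thesis unfolding path_law_def
    by (subst distr_distr[OF m restrict_path_measurable[OF X]]) (simp add: comp_def)
qed

text \<open>By independence the vector has a product law with identical factors, which depend only
  on the transformed law of \<open>Y1\<close>. Two transformations with the same effect on that law
  are thus interchangeable.\<close>

lemma vector_law_map:
  assumes N: "prob_space N" and ind: "independent_copies N0 Y1 N Y I" and I: "I \<noteq> {}" and Y1: "process N0 cadlag_paths Y1"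
    and S: "\<And>t. t \<ge> 0 \<Longrightarrow> (\<lambda>z. S z t) \<in> borel_measurable path_algebra"
    and r: "\<And>x t. t \<ge> 0 \<Longrightarrow> S (restrict x {0..}) t = S x t"
  shows "distr (completion N) (PiM I (\<lambda>_. path_algebra)) (\<lambda>\<omega>. \<lambda>i\<in>I. restrict (S (Y i \<omega>)) {0..})
      = PiM I (\<lambda>_. path_law N0 (\<lambda>\<omega>. S (Y1 \<omega>)))"
proof -
  interpret C: prob_space "completion N" by (rule prob_space.prob_space_completion[OF N])
  have m: "(\<lambda>z. restrict (S z) {0..}) \<in> path_algebra \<rightarrow>\<^sub>M path_algebra"
    using S by (intro measurable_restrict) auto
  have eq: "restrict (S (restrict x {0..})) {0..} = restrict (S x) {0..}" for x
    using r by (simp add: restrict_def fun_eq_iff)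
  have Y: "process N cadlag_paths (Y i)" and law: "path_law N (Y i) = path_law N0 Y1" if "i \<in> I" for i
    using ind that by (auto simp: independent_copies_def)
  have "C.indep_vars (\<lambda>_. path_algebra) (\<lambda>i \<omega>. restrict (Y i \<omega>) {0..}) I"
    using ind by (simp add: independent_copies_def)
  from C.indep_vars_compose2[OF this m]
  have iv: "C.indep_vars (\<lambda>_. path_algebra) (\<lambda>i \<omega>. restrict (S (Y i \<omega>)) {0..}) I" by (simp add: eq)
  have meas: "(\<lambda>\<omega>. restrict (S (Y i \<omega>)) {0..}) \<in> completion N \<rightarrow>\<^sub>M path_algebra" if "i \<in> I" for i
    using measurable_compose[OF restrict_path_measurable[OF Y[OF that]] m] by (simp add: eq)
  have "distr (completion N) (PiM I (\<lambda>_. path_algebra)) (\<lambda>\<omega>. \<lambda>i\<in>I. restrict (S (Y i \<omega>)) {0..})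
      = PiM I (\<lambda>i. distr (completion N) path_algebra (\<lambda>\<omega>. restrict (S (Y i \<omega>)) {0..}))"
    using iv by (subst (asm) C.indep_vars_iff_distr_eq_PiM'[OF I]) (auto intro: meas)
  also have "\<dots> = PiM I (\<lambda>_. path_law N0 (\<lambda>\<omega>. S (Y1 \<omega>)))"
  proof (rule PiM_cong[OF refl])
    fix i assume i: "i \<in> I"
    have "distr (completion N) path_algebra (\<lambda>\<omega>. restrict (S (Y i \<omega>)) {0..}) = path_law N (\<lambda>\<omega>. S (Y i \<omega>))"
      by (simp add: path_law_def)
    also have "\<dots> = distr (path_law N (Y i)) path_algebra (\<lambda>z. restrict (S z) {0..})"
      using Y[OF i] S r by (rule path_law_map)
    also have "\<dots> = path_law N0 (\<lambda>\<omega>. S (Y1 \<omega>))"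
      unfolding law[OF i] using Y1 S r by (rule path_law_map[symmetric])
    finally show "distr (completion N) path_algebra (\<lambda>\<omega>. restrict (S (Y i \<omega>)) {0..}) = path_law N0 (\<lambda>\<omega>. S (Y1 \<omega>))" .
  qed
  finally show ?thesis .
qed

text \<open>Scaling the times and scaling the values of the components produce the same product law.
  The sections commute with both operations, the variance picking up the square of the value factor,
  hence the exponent \<open>2 * h\<close>.\<close>

lemma joint_self_similarity:
  assumes N: "prob_space N" and m: "m \<ge> 1" and Y1: "process N0 cadlag_paths Y1"
    and ind: "independent_copies N0 Y1 N Y {1..m}" and a: "a > 0"
    and ss: "path_law N0 (\<lambda>\<omega> t. Y1 \<omega> (a * t)) = path_law N0 (\<lambda>\<omega> t. a powr h * Y1 \<omega> t)"
  shows "joint_path_law N (\<lambda>\<omega> t. section_mean m Y \<omega> (a * t)) (\<lambda>\<omega> t. section_variance m Y \<omega> (a * t))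
      = joint_path_law N (\<lambda>\<omega> t. a powr h * section_mean m Y \<omega> t) (\<lambda>\<omega> t. a powr (2 * h) * section_variance m Y \<omega> t)"
proof -
  have Y: "process N cadlag_paths (Y i)" if "i \<in> {1..m}" for i
    using ind that by (auto simp: independent_copies_def)
  have I: "{1..m} \<noteq> {}" using m by simp
  define W where "W = (\<lambda>i \<omega> t. Y i \<omega> (a * t))"
  define U where "U = (\<lambda>i \<omega> t. a powr h * Y i \<omega> t)"
  have Wp: "process N cadlag_paths (W i)" if i: "i \<in> {1..m}" for i
    unfolding process_def
  proof (intro conjI allI impI)
    show "(\<lambda>\<omega>. W i \<omega> t) \<in> borel_measurable (completion N)" if "t \<ge> 0" for t
      unfolding W_def using a that by (intro processD(1)[OF Y[OF i]]) simp
    show "AE \<omega> in N. W i \<omega> \<in> cadlag_paths"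
      using processD(2)[OF Y[OF i]] by eventually_elim (simp add: W_def cadlag_time_scale a)
  qed
  have Up: "process N cadlag_paths (U i)" if i: "i \<in> {1..m}" for i
    unfolding process_def
  proof (intro conjI allI impI)
    show "(\<lambda>\<omega>. U i \<omega> t) \<in> borel_measurable (completion N)" if "t \<ge> 0" for t
      unfolding U_def using processD(1)[OF Y[OF i] that] by simp
    show "AE \<omega> in N. U i \<omega> \<in> cadlag_paths"
      using processD(2)[OF Y[OF i]] by eventually_elim (simp add: U_def cadlag_mult cadlag_const)
  qed
  have W_eq: "section_mean m W = (\<lambda>\<omega> t. section_mean m Y \<omega> (a * t))"
    "section_variance m W = (\<lambda>\<omega> t. section_variance m Y \<omega> (a * t))"
  proof -
    show "section_mean m W = (\<lambda>\<omega> t. section_mean m Y \<omega> (a * t))"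
      by (simp add: fun_eq_iff section_mean_def W_def)
    show "section_variance m W = (\<lambda>\<omega> t. section_variance m Y \<omega> (a * t))"
    proof (intro ext)
      fix \<omega> t
      have "pvar m (\<lambda>i. W i \<omega>) t = pvar m (\<lambda>i. Y i \<omega>) (a * t)"
        using pvar_affine[OF m a, of 1 "\<lambda>i. Y i \<omega>" "\<lambda>_. 0" t] by (simp add: W_def)
      then show "section_variance m W \<omega> t = section_variance m Y \<omega> (a * t)"
        unfolding section_variance_path[of m W] section_variance_path[of m Y] .
    qed
  qed
  have U_eq: "section_mean m U = (\<lambda>\<omega> t. a powr h * section_mean m Y \<omega> t)"
    "section_variance m U = (\<lambda>\<omega> t. a powr (2 * h) * section_variance m Y \<omega> t)"
  proof -
    show "section_mean m U = (\<lambda>\<omega> t. a powr h * section_mean m Y \<omega> t)"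
      by (simp add: fun_eq_iff section_mean_def U_def flip: sum_distrib_left)
    have sq: "(a powr h)\<^sup>2 = a powr (2 * h)" by (simp add: power2_eq_square flip: powr_add)
    show "section_variance m U = (\<lambda>\<omega> t. a powr (2 * h) * section_variance m Y \<omega> t)"
    proof (intro ext)
      fix \<omega> t
      have "pvar m (\<lambda>i. U i \<omega>) t = a powr (2 * h) * pvar m (\<lambda>i. Y i \<omega>) t"
        using pvar_affine[OF m zero_less_one, of "a powr h" "\<lambda>i. Y i \<omega>" "\<lambda>_. 0" t] by (simp add: U_def sq)
      then show "section_variance m U \<omega> t = a powr (2 * h) * section_variance m Y \<omega> t"
        unfolding section_variance_path[of m U] section_variance_path[of m Y] .
    qed
  qed
  have "distr (completion N) (PiM {1..m} (\<lambda>_. path_algebra)) (\<lambda>\<omega>. \<lambda>i\<in>{1..m}. restrict (W i \<omega>) {0..})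
      = PiM {1..m} (\<lambda>_. path_law N0 (\<lambda>\<omega> t. Y1 \<omega> (a * t)))"
    unfolding W_def
  proof (rule vector_law_map[OF N ind I Y1, where S = "\<lambda>z t. z (a * t)"])
    show "(\<lambda>z. z (a * t)) \<in> borel_measurable path_algebra" if "t \<ge> 0" for t
      using a that by (intro path_component_measurable) simp
  qed (use a in simp)
  also have "\<dots> = distr (completion N) (PiM {1..m} (\<lambda>_. path_algebra)) (\<lambda>\<omega>. \<lambda>i\<in>{1..m}. restrict (U i \<omega>) {0..})"
    unfolding U_def ss
  proof (rule vector_law_map[OF N ind I Y1, where S = "\<lambda>z t. a powr h * z t", symmetric])
    show "(\<lambda>z. a powr h * z t) \<in> borel_measurable path_algebra" if "t \<ge> 0" for t
      using path_component_measurable[OF that] by simp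
  qed simp
  finally show ?thesis
    using joint_path_law_section[of m N W, OF Wp] joint_path_law_section[of m N U, OF Up] unfolding W_eq U_eq by simp
qed

section \<open>Positivity of the variance at all times\<close>

lemma joint_path_law_AE:
  assumes X: "process M D X" and Y: "process M D' Y" and P: "Measurable.pred (path_algebra \<Otimes>\<^sub>M path_algebra) P"
  shows "(AE p in joint_path_law M X Y. P p) \<longleftrightarrow> (AE \<omega> in M. P (restrict (X \<omega>) {0..}, restrict (Y \<omega>) {0..}))"
  unfolding joint_path_law_def
  by (subst AE_distr_iff[OF measurable_Pair[OF restrict_path_measurable[OF X] restrict_path_measurable[OF Y]]])
    (use P in \<open>simp_all add: pred_def AE_completion_iff\<close>)

lemma section_variance_pos:
  assumes N: "prob_space N" and m: "m \<ge> 2" and Y1: "process N0 cadlag_paths Y1"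
    and ind: "independent_copies N0 Y1 N Y {1..m}"
    and ss: "\<forall>a>0. path_law N0 (\<lambda>\<omega> t. Y1 \<omega> (a * t)) = path_law N0 (\<lambda>\<omega> t. a powr h * Y1 \<omega> t)"
    and pos: "AE \<omega> in N. section_variance m Y \<omega> 1 > 0"
  shows "AE \<omega> in N. \<forall>t>0. section_variance m Y \<omega> t > 0"
proof -
  have Y: "process N cadlag_paths (Y i)" if "i \<in> {1..m}" for i
    using ind that by (auto simp: independent_copies_def)
  have mm: "(\<lambda>\<omega>. section_mean m Y \<omega> t) \<in> borel_measurable (completion N)"
    and mv: "(\<lambda>\<omega>. section_variance m Y \<omega> t) \<in> borel_measurable (completion N)" if "t \<ge> 0" for t
    using section_mean_measurable[of t m N Y, OF that Y] section_variance_measurable[of t m N Y, OF that Y] by auto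
  have m1: "m \<ge> 1" using m by simp
  have at: "AE \<omega> in N. section_variance m Y \<omega> a > 0" if a: "a > 0" for a
  proof -
    have p: "process N UNIV (\<lambda>\<omega> t. section_mean m Y \<omega> (a * t))" "process N UNIV (\<lambda>\<omega> t. section_variance m Y \<omega> (a * t))"
      "process N UNIV (\<lambda>\<omega> t. a powr h * section_mean m Y \<omega> t)" "process N UNIV (\<lambda>\<omega> t. a powr (2 * h) * section_variance m Y \<omega> t)"
      unfolding process_def using mm mv a by auto
    have P: "Measurable.pred (path_algebra \<Otimes>\<^sub>M path_algebra) (\<lambda>p. snd p 1 > 0)"
    proof -
      have [measurable]: "(\<lambda>p. snd p 1) \<in> borel_measurable (path_algebra \<Otimes>\<^sub>M path_algebra)"
        by (rule measurable_compose[OF measurable_snd path_component_measurable]) simp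
      show ?thesis by measurable
    qed
    \<comment> \<open>Positivity at time 1 survives a positive factor, and equality of the joint
      laws turns the factor into the time \<open>a\<close>.\<close>
    have "AE \<omega> in N. a powr (2 * h) * section_variance m Y \<omega> 1 > 0"
      using pos by eventually_elim (use a in simp)
    then have "AE p in joint_path_law N (\<lambda>\<omega> t. a powr h * section_mean m Y \<omega> t) (\<lambda>\<omega> t. a powr (2 * h) * section_variance m Y \<omega> t). snd p 1 > 0"
      unfolding joint_path_law_AE[OF p(3,4) P] by simp
    then have "AE p in joint_path_law N (\<lambda>\<omega> t. section_mean m Y \<omega> (a * t)) (\<lambda>\<omega> t. section_variance m Y \<omega> (a * t)). snd p 1 > 0"
      by (simp only: joint_self_similarity[OF N m1 Y1 ind a ss[rule_format, OF a]])
    then show ?thesis unfolding joint_path_law_AE[OF p(1,2) P] by simp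
  qed
  \<comment> \<open>One null set serves all positive rationals; below every \<open>t > 0\<close>
    there is one of them, from which positivity spreads upwards.\<close>
  have "AE \<omega> in N. \<forall>q\<in>{q :: rat. q > 0}. section_variance m Y \<omega> (of_rat q) > 0"
    by (subst AE_ball_countable) (use at in auto)
  moreover have "AE \<omega> in N. \<forall>i\<in>{1..m}. Y i \<omega> \<in> cadlag_paths" using Y by (rule AE_all_cadlag)
  ultimately show ?thesis
  proof eventually_elim
    case (elim \<omega>)
    show ?case
    proof (intro allI impI)
      fix t :: real assume "t > 0"
      from of_rat_dense[OF this] obtain q where q: "0 < (of_rat q :: real)" "of_rat q < t" by blast
      then have "section_variance m Y \<omega> (of_rat q) > 0" using elim(1) by simp
      then have pq: "pvar m (\<lambda>i. Y i \<omega>) (of_rat q) > 0" unfolding section_variance_path[of m Y] .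
      show "section_variance m Y \<omega> t > 0"
        unfolding section_variance_path[of m Y]
        by (rule pvar_positive_mono[OF m _ q(1) less_imp_le[OF q(2)] pq]) (use elim(2) in blast)
    qed
  qed
qed

section \<open>Augmented filtrations and predictable times\<close>

abbreviation natural_generators :: "'w measure \<Rightarrow> ('w \<Rightarrow> real \<Rightarrow> real) set \<Rightarrow> real \<Rightarrow> 'w set set" where
  "natural_generators M \<X> s \<equiv> {(\<lambda>\<omega>. X \<omega> u) -` B \<inter> space M | X u B. X \<in> \<X> \<and> u \<in> {0..s} \<and> B \<in> sets borel}
     \<union> null_sets (completion M)"

lemma natural_generators_Pow: "natural_generators M \<X> s \<subseteq> Pow (space M)"
proof -
  have "A \<subseteq> space M" if "A \<in> null_sets (completion M)" for A
    using null_setsD2[OF that] sets.sets_into_space by fastforce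
  then show ?thesis by auto
qed

lemma sets_augmented_natural_filtration:
  "sets (augmented_natural_filtration M \<X> t)
    = sigma_sets (space M) (\<Inter>s\<in>{t<..}. sigma_sets (space M) (natural_generators M \<X> s))"
  unfolding augmented_natural_filtration_def
proof (rule sets_measure_of)
  have "sigma_sets (space M) (natural_generators M \<X> (t + 1)) \<subseteq> Pow (space M)"
    using sigma_sets_into_sp[OF natural_generators_Pow] by blast
  then show "(\<Inter>s\<in>{t<..}. sigma_sets (space M) (natural_generators M \<X> s)) \<subseteq> Pow (space M)"
    by (intro INF_lower2[of "t + 1"]) auto
qed

text \<open>The mean at time \<open>u\<close> is a function of the coordinates at \<open>u\<close>.
  The variance at \<open>u\<close> agrees with a function of the path values up to \<open>u\<close>
  only where the paths are cadlag; the null sets among the generators bridge the difference.\<close>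

lemma section_filtration_subset:
  assumes Y: "\<And>i. i \<in> {1..m} \<Longrightarrow> process N cadlag_paths (Y i)"
  shows "sets (augmented_natural_filtration N {section_mean m Y, section_variance m Y} t)
      \<subseteq> sets (augmented_natural_filtration N (Y ` {1..m}) t)"
proof -
  have "natural_generators N {section_mean m Y, section_variance m Y} s
      \<subseteq> sigma_sets (space N) (natural_generators N (Y ` {1..m}) s)" for s
  proof -
    define G where "G = sigma (space N) (natural_generators N (Y ` {1..m}) s)"
    have sG: "sets G = sigma_sets (space N) (natural_generators N (Y ` {1..m}) s)" and spG: "space G = space N"
      unfolding G_def by (rule sets_measure_of[OF natural_generators_Pow], rule space_measure_of[OF natural_generators_Pow])
    have nullG: "A \<in> sets G" if "A \<in> null_sets (completion N)" for A
      unfolding sG using that by (intro sigma_sets.Basic) blast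
    have YG: "(\<lambda>\<omega>. Y i \<omega> v) \<in> borel_measurable G" if "i \<in> {1..m}" "v \<in> {0..s}" for i v
    proof (rule measurableI)
      fix B :: "real set" assume "B \<in> sets borel"
      then show "(\<lambda>\<omega>. Y i \<omega> v) -` B \<inter> space G \<in> sets G"
        unfolding sG spG using that by (intro sigma_sets.Basic) blast
    qed simp
    have mean: "(\<lambda>\<omega>. section_mean m Y \<omega> u) \<in> borel_measurable G" if "u \<in> {0..s}" for u
      unfolding section_mean_def using YG that
      by (intro borel_measurable_times borel_measurable_sum borel_measurable_const)
    have var: "(\<lambda>\<omega>. section_variance m Y \<omega> u) -` B \<inter> space N \<in> sets G" if u: "u \<in> {0..s}" and B: "B \<in> sets borel" for u B
    proof -
      let ?g = "\<lambda>\<omega>. pvar m (\<lambda>i. path_upto u (Y i \<omega>)) u"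
      have g: "?g \<in> borel_measurable G" using u YG by (intro pvar_path_upto_measurable) auto
      have "AE \<omega> in N. \<forall>i\<in>{1..m}. Y i \<omega> \<in> cadlag_paths" using Y by (rule AE_all_cadlag)
      then have "AE \<omega> in completion N. ?g \<omega> = section_variance m Y \<omega> u"
        by (intro AE_completion) (auto elim!: eventually_mono simp: section_variance_path[of m Y] intro!: pvar_path_upto)
      then have "{\<omega> \<in> space N. ?g \<omega> \<noteq> section_variance m Y \<omega> u} \<in> null_sets (completion N)" (is "?W \<in> _")
        unfolding completion.AE_iff_null_sets by simp
      \<comment> \<open>The exceptional set and its subsets are null in the completion, hence
        members of \<open>G\<close>, so passing between the two versions keeps
        measurability.\<close>
      then have "?W \<in> sets G" "(\<lambda>\<omega>. section_variance m Y \<omega> u) -` B \<inter> ?W \<in> sets G"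
        by (auto intro: nullG completion.complete2[rotated])
      moreover have "?g -` B \<inter> space G \<in> sets G" using g B by (rule measurable_sets)
      moreover have "(\<lambda>\<omega>. section_variance m Y \<omega> u) -` B \<inter> space N
          = ((?g -` B \<inter> space G) - ?W) \<union> ((\<lambda>\<omega>. section_variance m Y \<omega> u) -` B \<inter> ?W)"
        by (auto simp: spG)
      ultimately show ?thesis by auto
    qed
    show ?thesis
    proof
      fix A assume "A \<in> natural_generators N {section_mean m Y, section_variance m Y} s"
      then consider "A \<in> null_sets (completion N)"
        | u B where "u \<in> {0..s}" "B \<in> sets borel" "A = (\<lambda>\<omega>. section_mean m Y \<omega> u) -` B \<inter> space N"
        | u B where "u \<in> {0..s}" "B \<in> sets borel" "A = (\<lambda>\<omega>. section_variance m Y \<omega> u) -` B \<inter> space N"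
        by blast
      then have "A \<in> sets G"
      proof cases
        case 1
        then show ?thesis by (rule nullG)
      next
        case (2 u B)
        then show ?thesis using measurable_sets[OF mean[OF 2(1)] 2(2)] spG by simp
      next
        case (3 u B)
        then show ?thesis using var by simp
      qed
      then show "A \<in> sigma_sets (space N) (natural_generators N (Y ` {1..m}) s)" by (simp add: sG)
    qed
  qed
  then have "sigma_sets (space N) (natural_generators N {section_mean m Y, section_variance m Y} s)
      \<subseteq> sigma_sets (space N) (natural_generators N (Y ` {1..m}) s)" for s
    by (rule sigma_sets_mono)
  then show ?thesis unfolding sets_augmented_natural_filtration
    by (intro sigma_sets_mono' INF_mono) auto
qed

lemma space_augmented_natural_filtration: "space (augmented_natural_filtration M \<X> t) = space M"
  by (simp add: augmented_natural_filtration_def space_measure_of_conv)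

lemma stopping_time_mono_filtration:
  assumes "stopping_time F \<tau>" "\<And>t. sets (F t) \<subseteq> sets (G t)" "\<And>t. space (F t) = space (G t)"
  shows "stopping_time G \<tau>"
  using assms unfolding stopping_time_def pred_def by (metis subsetD)

lemma finite_predictable_time_mono_filtration:
  assumes "finite_predictable_time M F \<tau>" "\<And>t. sets (F t) \<subseteq> sets (G t)" "\<And>t. space (F t) = space (G t)"
  shows "finite_predictable_time M G \<tau>"
proof -
  have mono: "stopping_time G \<rho>" if "stopping_time F \<rho>" for \<rho>
    using that assms(2,3) by (rule stopping_time_mono_filtration)
  obtain \<sigma> where \<tau>: "stopping_time F \<tau>" "\<forall>\<omega>\<in>space M. 0 \<le> \<tau> \<omega>"
    and \<sigma>: "\<forall>n. stopping_time F (\<sigma> n) \<and> (\<forall>\<omega>\<in>space M. 0 \<le> \<sigma> n \<omega>)"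
    and ann: "AE \<omega> in M. incseq (\<lambda>n. \<sigma> n \<omega>) \<and> (\<lambda>n. \<sigma> n \<omega>) \<longlonglongrightarrow> \<tau> \<omega> \<and> (\<tau> \<omega> > 0 \<longrightarrow> (\<forall>n. \<sigma> n \<omega> < \<tau> \<omega>))"
    using assms(1) unfolding finite_predictable_time_def by blast
  have "\<forall>n. stopping_time G (\<sigma> n) \<and> (\<forall>\<omega>\<in>space M. 0 \<le> \<sigma> n \<omega>)" using \<sigma> mono by blast
  then show ?thesis unfolding finite_predictable_time_def using mono[OF \<tau>(1)] \<tau>(2) ann by blast
qed

text \<open>It brings deterministic times under quasi-left-continuity, which thereby rules out fixed
  jump times. The announcing times \<open>t - t * inverse (real (Suc n))\<close> are constants,
  nonnegative and strictly below \<open>t\<close>.\<close>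

lemma finite_predictable_time_const:
  assumes "t > 0"
  shows "finite_predictable_time M F (\<lambda>_. t)"
proof -
  define \<sigma> where "\<sigma> = (\<lambda>(n :: nat) (\<omega> :: 'a). t - t * inverse (real (Suc n)))"
  have inc: "incseq (\<lambda>n. \<sigma> n \<omega>)" for \<omega>
    unfolding \<sigma>_def using assms by (intro incseq_SucI) (simp add: field_simps)
  have "(\<lambda>n. \<sigma> n \<omega>) \<longlonglongrightarrow> t - t * 0" for \<omega>
    unfolding \<sigma>_def by (intro tendsto_intros LIMSEQ_inverse_real_of_nat)
  then have lim: "(\<lambda>n. \<sigma> n \<omega>) \<longlonglongrightarrow> t" for \<omega> by simp
  have "0 \<le> \<sigma> n \<omega>" "\<sigma> n \<omega> < t" for n \<omega> unfolding \<sigma>_def using assms by (auto simp: field_simps)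
  moreover have "stopping_time F (\<sigma> n)" for n unfolding \<sigma>_def by (rule stopping_time_const)
  ultimately show ?thesis
    unfolding finite_predictable_time_def using inc lim assms
    by (intro conjI exI[of _ \<sigma>]) (auto intro: stopping_time_const)
qed

lemma isCont_pmean:
  assumes "\<And>i. i \<in> {1..m} \<Longrightarrow> isCont (y i) t"
  shows "isCont (pmean m y) t"
  unfolding section_mean_def[abs_def] using assms by (intro continuous_intros) auto

text \<open>A predictable time of the filtration of the sections is predictable for the larger
  filtration of the vector. No component jumps there almost surely, and neither does the
  mean.\<close>

lemma quasi_left_continuous_section_mean:
  assumes Y: "\<And>i. i \<in> {1..m} \<Longrightarrow> process N cadlag_paths (Y i)" and m: "m \<ge> 1"
    and q: "quasi_left_continuous N (augmented_natural_filtration N (Y ` {1..m})) (Y ` {1..m})"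
  shows "quasi_left_continuous N (augmented_natural_filtration N {section_mean m Y, section_variance m Y}) {section_mean m Y}"
  unfolding quasi_left_continuous_def
proof (intro allI impI)
  fix \<tau> assume \<tau>: "finite_predictable_time N (augmented_natural_filtration N {section_mean m Y, section_variance m Y}) \<tau>"
  then have "finite_predictable_time N (augmented_natural_filtration N (Y ` {1..m})) \<tau>"
    by (rule finite_predictable_time_mono_filtration)
      (use section_filtration_subset[of m N Y, OF Y] in \<open>auto simp: space_augmented_natural_filtration\<close>)
  then have "AE \<omega> in N. \<forall>X\<in>Y ` {1..m}. jump (X \<omega>) (\<tau> \<omega>) = 0"
    using q unfolding quasi_left_continuous_def by blast
  moreover have "AE \<omega> in N. \<forall>i\<in>{1..m}. Y i \<omega> \<in> cadlag_paths" using Y by (rule AE_all_cadlag)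
  moreover have "AE \<omega> in N. 0 \<le> \<tau> \<omega>" using \<tau> unfolding finite_predictable_time_def by (intro AE_I2) blast
  ultimately show "AE \<omega> in N. \<forall>X\<in>{section_mean m Y}. jump (X \<omega>) (\<tau> \<omega>) = 0"
  proof eventually_elim
    case (elim \<omega>)
    have "jump (pmean m (\<lambda>i. Y i \<omega>)) (\<tau> \<omega>) = 0"
    proof (cases "\<tau> \<omega> > 0")
      case True
      have "isCont (pmean m (\<lambda>i. Y i \<omega>)) (\<tau> \<omega>)"
        using elim(1,2) jump_eq_0_iff[OF _ True] by (intro isCont_pmean) auto
      moreover have "pmean m (\<lambda>i. Y i \<omega>) \<in> cadlag_paths" using elim(2) by (intro pmean_cadlag) auto
      ultimately show ?thesis using jump_eq_0_iff[OF _ True] by blast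
    next
      case False
      \<comment> \<open>At time 0 the jump vanishes by the convention for left limits.\<close>
      then show ?thesis by (simp add: jump_def left_limit_def)
    qed
    then show ?case by (simp add: section_mean_path[of m Y])
  qed
qed

section \<open>The functional limit condition for the sections\<close>

theorem theorem4p3:
  fixes M0 :: "'a measure" and Z1 :: "'a \<Rightarrow> real \<Rightarrow> real"
    and N0 :: "'b measure" and Y1 :: "'b \<Rightarrow> real \<Rightarrow> real"
    and M :: "'c measure" and Z :: "nat \<Rightarrow> 'c \<Rightarrow> real \<Rightarrow> real"
    and N :: "'d measure" and Y :: "nat \<Rightarrow> 'd \<Rightarrow> real \<Rightarrow> real"
    and \<mu> h :: real and l :: "real \<Rightarrow> real" and m :: nat
  assumes "prob_space M0" and "prob_space N0" and "prob_space M" and "prob_space N"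
    and "marginal_limit_condition M0 Z1 \<mu> h l N0 Y1"
    and "m \<ge> 2"
    and "independent_copies M0 Z1 M Z {1..m}"
    and "independent_copies N0 Y1 N Y {1..m}"
    and "quasi_left_continuous N (augmented_natural_filtration N (Y ` {1..m})) (Y ` {1..m})"
    and "AE \<omega> in N. section_variance m Y \<omega> 1 > 0"
  shows "joint_scaling_limit M (section_mean m Z) (section_variance m Z) \<mu> h l
           N (section_mean m Y) (section_variance m Y)
    \<and> (AE \<omega> in N. continuous_on {0..} (section_variance m Y \<omega>))
    \<and> functional_limit_condition M (section_mean m Z) (section_variance m Z) \<mu> h l
           N (section_mean m Y) (section_variance m Y)"
proof -
  note M0 = assms(1) and N0 = assms(2) and M = assms(3) and N = assms(4) and m = assms(6)
    and indZ = assms(7) and indY = assms(8) and qlc = assms(9) and pos = assms(10)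
  from assms(5) have Z1: "process M0 cadlag_paths Z1" "AE \<omega> in M0. Z1 \<omega> 0 = 0"
    and h: "0 < h" "h < 1" and l: "\<forall>\<^sub>F x in at_top. l x > 0" "slowly_varying l"
    and Y1: "process N0 cadlag_paths Y1"
    and conv: "converges_weakly M2_topology M0 (centred_scaling \<mu> h l Z1) N0 Y1 (at_right 0)"
    and lln: "AE \<omega> in M0. ((\<lambda>t. (Z1 \<omega> t - \<mu> * t) / t) \<longlongrightarrow> 0) at_top"
    and ss: "\<forall>a>0. path_law N0 (\<lambda>\<omega> t. Y1 \<omega> (a * t)) = path_law N0 (\<lambda>\<omega> t. a powr h * Y1 \<omega> t)"
    unfolding marginal_limit_condition_def by blast+
  have Zp: "process M cadlag_paths (Z i)" and Zlaw: "path_law M (Z i) = path_law M0 Z1"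
    and Yp: "process N cadlag_paths (Y i)" and Ylaw: "path_law N (Y i) = path_law N0 Y1" if "i \<in> {1..m}" for i
    using indZ indY that by (auto simp: independent_copies_def)
  have Z0: "AE \<omega> in M. Z i \<omega> 0 = 0" if "i \<in> {1..m}" for i
    by (rule start_transfer[OF Z1(1) Zp[OF that] Zlaw[OF that] Z1(2)])
  have Y0: "AE \<omega> in N. Y i \<omega> 0 = 0" if "i \<in> {1..m}" for i
    by (rule start_transfer[OF Y1 Yp[OF that] Ylaw[OF that] self_similar_start[OF N0 Y1 h(1) ss]])
  have fixed: "AE \<omega> in N. isCont (Y i \<omega>) t" if i: "i \<in> {1..m}" and t: "t > 0" for i t
  proof -
    have "AE \<omega> in N. \<forall>X\<in>Y ` {1..m}. jump (X \<omega>) t = 0"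
      using qlc finite_predictable_time_const[OF t] unfolding quasi_left_continuous_def by blast
    then show ?thesis using processD(2)[OF Yp[OF i]]
      by eventually_elim (use i t jump_eq_0_iff in blast)
  qed
  \<comment> \<open>Keeping \<open>i \<noteq> j\<close> inside the event lets both indices range
    over the whole finite set, so that the finitely many almost sure events can be
    intersected.\<close>
  have "AE \<omega> in N. i \<noteq> j \<longrightarrow> (\<forall>t>0. isCont (Y i \<omega>) t \<or> isCont (Y j \<omega>) t)" if "i \<in> {1..m}" "j \<in> {1..m}" for i j
  proof (cases "i = j")
    case False
    have "AE \<omega> in N. \<forall>t>0. isCont (Y i \<omega>) t \<or> isCont (Y j \<omega>) t"
      by (rule no_common_jumps[OF N Yp Yp indep_path_pair[OF N indY] fixed]) (use that False in auto)
    then show ?thesis by eventually_elim simp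
  qed simp
  then have jumps: "AE \<omega> in N. \<forall>i\<in>{1..m}. \<forall>j\<in>{1..m}. i \<noteq> j \<longrightarrow> (\<forall>t>0. isCont (Y i \<omega>) t \<or> isCont (Y j \<omega>) t)"
    by (intro AE_finite_allI) auto
  have joint: "joint_scaling_limit M (section_mean m Z) (section_variance m Z) \<mu> h l
      N (section_mean m Y) (section_variance m Y)"
    by (rule joint_scaling_limit_of_sections[OF M0 N0 M N m Z1(1) Y1 l(1) conv indZ indY Z0 Y0 jumps])
  have cont: "AE \<omega> in N. continuous_on {0..} (section_variance m Y \<omega>)"
    using m Yp Y0 by (rule section_variance_continuous)
  have m1: "m \<ge> 1" using m by simp
  have pZ: "process M cadlag_paths (section_mean m Z)" and pY: "process N cadlag_paths (section_mean m Y)"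
    by (rule process_section_mean, erule Zp) (rule process_section_mean, erule Yp)
  have vZ: "process M cadlag_paths_nonneg (section_variance m Z)" using m Zp Z0 by (rule process_section_variance(1))
  have vY: "process N cadlag_paths_nonneg (section_variance m Y)" using m Yp Y0 by (rule process_section_variance(1))
  have start: "AE \<omega> in M. section_mean m Z \<omega> 0 = 0"
  proof -
    have "AE \<omega> in M. \<forall>i\<in>{1..m}. Z i \<omega> 0 = 0" using Z0 by (intro AE_finite_allI) auto
    then show ?thesis by eventually_elim (simp add: section_mean_def)
  qed
  have "AE \<omega> in M. ((\<lambda>t. (Z i \<omega> t - \<mu> * t) / t) \<longlongrightarrow> 0) at_top" if "i \<in> {1..m}" for i
    by (rule sublinear_transfer[OF Z1(1) Zp[OF that] Zlaw[OF that] lln])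
  then have all_lln: "AE \<omega> in M. \<forall>i\<in>{1..m}. ((\<lambda>t. (Z i \<omega> t - \<mu> * t) / t) \<longlongrightarrow> 0) at_top"
    by (intro AE_finite_allI) auto
  have mean_lln: "AE \<omega> in M. ((\<lambda>t. (section_mean m Z \<omega> t - \<mu> * t) / t) \<longlongrightarrow> 0) at_top"
    using all_lln
  proof eventually_elim
    case (elim \<omega>)
    have "((\<lambda>t. 1 / real m * (\<Sum>i=1..m. (Z i \<omega> t - \<mu> * t) / t)) \<longlongrightarrow> 1 / real m * (\<Sum>i=1..m. 0)) at_top"
      using elim by (intro tendsto_intros) auto
    moreover have "1 / real m * (\<Sum>i=1..m. (Z i \<omega> t - \<mu> * t) / t) = (section_mean m Z \<omega> t - \<mu> * t) / t" for t
      using m1 by (simp add: section_mean_def sum_subtractf diff_divide_distrib right_diff_distrib flip: sum_divide_distrib)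
    ultimately show ?case by simp
  qed
  have var_lln: "AE \<omega> in M. ((\<lambda>t. section_variance m Z \<omega> t / t\<^sup>2) \<longlongrightarrow> 0) at_top"
  proof -
    have "AE \<omega> in M. \<forall>i\<in>{1..m}. Z i \<omega> \<in> cadlag_paths" using Zp by (rule AE_all_cadlag)
    with all_lln show ?thesis
      by eventually_elim (unfold section_variance_path[of m Z], rule pvar_growth[OF m], blast+)
  qed
  have selfsim: "\<forall>a>0. joint_path_law N (\<lambda>\<omega> t. section_mean m Y \<omega> (a * t)) (\<lambda>\<omega> t. section_variance m Y \<omega> (a * t))
      = joint_path_law N (\<lambda>\<omega> t. a powr h * section_mean m Y \<omega> t) (\<lambda>\<omega> t. a powr (2 * h) * section_variance m Y \<omega> t)"
    using joint_self_similarity[OF N m1 Y1 indY] ss by blast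
  have qlc': "quasi_left_continuous N (augmented_natural_filtration N {section_mean m Y, section_variance m Y}) {section_mean m Y}"
    using Yp m1 qlc by (rule quasi_left_continuous_section_mean)
  have pos': "AE \<omega> in N. \<forall>t>0. section_variance m Y \<omega> t > 0"
    by (rule section_variance_pos[OF N m Y1 indY ss pos])
  have jump_var: "AE \<omega> in N. \<forall>t>0. jump (section_variance m Y \<omega>) t \<ge> 0"
    using cont
  proof eventually_elim
    case (elim \<omega>)
    have "jump (section_variance m Y \<omega>) t = 0" if "t > 0" for t
    proof -
      \<comment> \<open>Restriction to an open half-line turns continuity relative to nonnegative
        times into \<open>isCont\<close>, so every jump at a positive time is zero.\<close>
      have "continuous_on {0<..} (section_variance m Y \<omega>)" using elim by (rule continuous_on_subset) auto
      then have "isCont (section_variance m Y \<omega>) t" using that by (simp add: continuous_on_eq_continuous_at)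
      then show ?thesis using jump_eq_0_iff[OF cadlag_of_continuous[OF elim] that] by simp
    qed
    then show ?case by simp
  qed
  have "functional_limit_condition M (section_mean m Z) (section_variance m Z) \<mu> h l
      N (section_mean m Y) (section_variance m Y)"
    unfolding functional_limit_condition_def
    by (intro conjI pZ vZ start l pY vY joint h mean_lln var_lln selfsim qlc' pos' jump_var)
  then show ?thesis using joint cont by blast
qed

end
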